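(* Fix any real $\varepsilon$ with $\varepsilon < 1/33$. There is an algorithm that solves \textsc{list-3-colouring} on the class of $n$-vertex graphs of diameter $3$ in time $2^{O(n^{2/3-\varepsilon})}$.
   Context: An instance of \textsc{list-3-colouring} consists of a finite simple graph $G$ and a list assignment $L: V(G) \to 2^{\{1,2,3\}}$; the question is whether there is a proper colouring $f: V(G) \to \{1,2,3\}$ (adjacent vertices receive different colours) with $f(v) \in L(v)$ for all $v \in V(G)$. A graph has diameter $3$ if every two vertices are joined by a path with at most $3$ edges (and this maximum is attained). Here $n=|V(G)|$. *)

theory Defs
  imports "Graph_Theory.Pair_Digraph" "HOL-Library.Landau_Symbols"
begin

section \<open>The problem\<close>

text \<open>
  Finite simple graphs are the symmetric, loop-free, finite digraphs without parallel arcs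
  of locale \<open>pair_graph\<close>; an undirected edge is a pair of opposite arcs.
\<close>

definition has_diameter :: "'a pair_pre_digraph \<Rightarrow> nat \<Rightarrow> bool" where
  "has_diameter G d \<longleftrightarrow>
     (\<forall>u \<in> pverts G. \<forall>v \<in> pverts G.
        \<exists>p. pre_digraph.apath (with_proj G) u p v \<and> length p \<le> d) \<and>
     (\<exists>u \<in> pverts G. \<exists>v \<in> pverts G.
        \<forall>p. pre_digraph.apath (with_proj G) u p v \<longrightarrow> d \<le> length p)"

definition list_3_colouring_instance :: "'a pair_pre_digraph \<Rightarrow> ('a \<Rightarrow> nat set) \<Rightarrow> bool" where
  "list_3_colouring_instance G L \<longleftrightarrow> pair_graph G \<and> (\<forall>v \<in> pverts G. L v \<subseteq> {1, 2, 3})"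

definition list_3_colourable :: "'a pair_pre_digraph \<Rightarrow> ('a \<Rightarrow> nat set) \<Rightarrow> bool" where
  "list_3_colourable G L \<longleftrightarrow>
     (\<exists>f :: 'a \<Rightarrow> nat. (\<forall>v \<in> pverts G. f v \<in> L v) \<and> (\<forall>(u, v) \<in> parcs G. f u \<noteq> f v))"


section \<open>The model of computation\<close>

text \<open>
  Algorithms are programs of a deterministic first-order functional language over binary trees
  (pure LISP; compare the languages WHILE and F in N. D. Jones, Computability and Complexity
  from a Programming Perspective). Every elementary operation costs one unit. This is a
  realistic cost measure: with values represented by pointers to shared cells, an operation
  allocates at most one cell, tests are made only on the root of a tree, and a call passes a
  number of arguments that is bounded by a constant of the program. Hence a run of cost \<open>t\<close> is
  simulated by a multitape Turing machine in time polynomial in \<open>t\<close> and the input size, and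
  conversely Turing machines are simulated with constant overhead per step. A polynomial
  overhead is immaterial for running times of the form \<open>2^(O(n^c))\<close> with \<open>c > 0\<close>.
\<close>

datatype tree = Leaf | Node tree tree

datatype expr =
    Param nat
  | LeafE
  | NodeE expr expr
  | LeftE expr
  | RightE expr
  | IfNode expr expr expr
  | Call nat "expr list"

text \<open>A program is the list of the bodies of its functions; function \<open>0\<close> is the entry point.\<close>

type_synonym program = "expr list"

fun left :: "tree \<Rightarrow> tree" where
  "left Leaf = Leaf"
| "left (Node l r) = l"

fun right :: "tree \<Rightarrow> tree" where
  "right Leaf = Leaf"
| "right (Node l r) = r"

text \<open>
  \<open>eval P env e v t\<close>: with argument values \<open>env\<close>, the evaluation of \<open>e\<close> (by value) terminates
  with result \<open>v\<close> at cost \<open>t\<close>. Ill-formed references and nonterminating evaluations have no result.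
\<close>

inductive eval :: "program \<Rightarrow> tree list \<Rightarrow> expr \<Rightarrow> tree \<Rightarrow> nat \<Rightarrow> bool"
  and evals :: "program \<Rightarrow> tree list \<Rightarrow> expr list \<Rightarrow> tree list \<Rightarrow> nat \<Rightarrow> bool"
  for P :: program where
  Param: "i < length env \<Longrightarrow> eval P env (Param i) (env ! i) 1"
| LeafE: "eval P env LeafE Leaf 1"
| NodeE: "eval P env a x s \<Longrightarrow> eval P env b y t \<Longrightarrow> eval P env (NodeE a b) (Node x y) (s + t + 1)"
| LeftE: "eval P env a x s \<Longrightarrow> eval P env (LeftE a) (left x) (s + 1)"
| RightE: "eval P env a x s \<Longrightarrow> eval P env (RightE a) (right x) (s + 1)"
| IfTrue: "eval P env c (Node x y) s \<Longrightarrow> eval P env a v t \<Longrightarrow> eval P env (IfNode c a b) v (s + t + 1)"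
| IfFalse: "eval P env c Leaf s \<Longrightarrow> eval P env b v t \<Longrightarrow> eval P env (IfNode c a b) v (s + t + 1)"
| Call: "f < length P \<Longrightarrow> evals P env es vs s \<Longrightarrow> eval P vs (P ! f) v t \<Longrightarrow>
    eval P env (Call f es) v (s + t + 1)"
| Nil: "evals P env [] [] 0"
| Cons: "eval P env e v s \<Longrightarrow> evals P env es vs t \<Longrightarrow> evals P env (e # es) (v # vs) (s + t)"

inductive_cases eval_elims:
  "eval P env (Param i) v t"
  "eval P env LeafE v t"
  "eval P env (NodeE a b) v t"
  "eval P env (LeftE a) v t"
  "eval P env (RightE a) v t"
  "eval P env (IfNode c a b) v t"
  "eval P env (Call f es) v t"
  "evals P env [] vs t"
  "evals P env (e # es) vs t"

lemma eval_deterministic: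
  "eval P env e v t \<Longrightarrow> eval P env e v' t' \<Longrightarrow> v' = v \<and> t' = t"
  "evals P env es vs t \<Longrightarrow> evals P env es vs' t' \<Longrightarrow> vs' = vs \<and> t' = t"
proof (induction arbitrary: v' t' and vs' t' rule: eval_evals.inducts)
  case (Param i env)
  from Param.prems show ?case
    by (rule eval_elims)
      (metis Suc_eq_plus1 One_nat_def tree.distinct(1))+
next
  case (LeafE env)
  from LeafE.prems show ?case
    by (rule eval_elims)
      (metis Suc_eq_plus1 One_nat_def tree.distinct(1))+
next
  case (NodeE env a x s b y t)
  from NodeE.prems show ?case
    by (rule eval_elims)
      (metis NodeE.IH Suc_eq_plus1 One_nat_def tree.distinct(1))+
next
  case (LeftE env a x s)
  from LeftE.prems show ?case
    by (rule eval_elims)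
      (metis LeftE.IH Suc_eq_plus1 One_nat_def tree.distinct(1))+
next
  case (RightE env a x s)
  from RightE.prems show ?case
    by (rule eval_elims)
      (metis RightE.IH Suc_eq_plus1 One_nat_def tree.distinct(1))+
next
  case (IfTrue env c x y s a v t b)
  from IfTrue.prems show ?case
    by (rule eval_elims)
      (metis IfTrue.IH Suc_eq_plus1 One_nat_def tree.distinct(1))+
next
  case (IfFalse env c s b v t a)
  from IfFalse.prems show ?case
    by (rule eval_elims)
      (metis IfFalse.IH Suc_eq_plus1 One_nat_def tree.distinct(1))+
next
  case (Call f env es vs s v t)
  from Call.prems show ?case
    by (rule eval_elims)
      (metis Call.IH Suc_eq_plus1 One_nat_def tree.distinct(1))+
next
  case (Nil env)
  from Nil.prems show ?case
    by (rule eval_elims)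
      (metis Suc_eq_plus1 One_nat_def tree.distinct(1))+
next
  case (Cons env e v s es vs t)
  from Cons.prems show ?case
    by (rule eval_elims)
      (metis Cons.IH Suc_eq_plus1 One_nat_def tree.distinct(1))+
qed

definition runs :: "program \<Rightarrow> tree \<Rightarrow> tree \<Rightarrow> nat \<Rightarrow> bool" where
  "runs P x y t \<longleftrightarrow> eval P [x] (Call 0 [Param 0]) y t"


section \<open>Encoding of instances and answers\<close>

fun enc_bool :: "bool \<Rightarrow> tree" where
  "enc_bool False = Leaf"
| "enc_bool True = Node Leaf Leaf"

fun enc_list :: "tree list \<Rightarrow> tree" where
  "enc_list [] = Leaf"
| "enc_list (x # xs) = Node x (enc_list xs)"

text \<open>
  With respect to an enumeration \<open>vs\<close> of the vertices, an instance is given by the list which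
  contains, for every vertex, the characteristic vector of its colour list and its row of the
  adjacency matrix.
\<close>

definition enc_instance :: "'a pair_pre_digraph \<Rightarrow> ('a \<Rightarrow> nat set) \<Rightarrow> 'a list \<Rightarrow> tree" where
  "enc_instance G L vs = enc_list (map (\<lambda>v.
     Node (enc_list (map (\<lambda>c. enc_bool (c \<in> L v)) [1, 2, 3]))
          (enc_list (map (\<lambda>w. enc_bool ((v, w) \<in> parcs G)) vs))) vs)"

text \<open>
  \<open>P\<close> is correct, within time \<open>T n\<close> for \<open>n\<close>-vertex graphs, on all instances whose graph lies in
  the class \<open>C\<close>, whatever the enumeration of the vertices; on other inputs nothing is required.
  The vertices are natural numbers so that one program serves all instances (up to isomorphism
  these are all finite graphs).
\<close>

definition solves_list_3_colouring ::
  "program \<Rightarrow> (nat pair_pre_digraph \<Rightarrow> bool) \<Rightarrow> (nat \<Rightarrow> real) \<Rightarrow> bool" where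
  "solves_list_3_colouring P C T \<longleftrightarrow>
     (\<forall>G L vs. list_3_colouring_instance G L \<and> C G \<and> distinct vs \<and> set vs = pverts G \<longrightarrow>
        (\<exists>t. runs P (enc_instance G L vs) (enc_bool (list_3_colourable G L)) t \<and>
             real t \<le> T (card (pverts G))))"

end

theory Submission
  imports Defs
begin

text \<open>
  A bounded search: a colour guess costs one unit of a budget, everything else is free. Let \<open>X\<close> be
  the set of vertices that still have all three colours, and let \<open>d\<close> be a threshold. If giving \<open>v\<close>
  the colour \<open>c\<close> would remove at least \<open>d\<close> colours by propagation, the free step is to remove \<open>c\<close> from \<open>v\<close>;
  if two vertices of \<open>X\<close> have common neighbours that see at least \<open>d\<close> vertices of \<open>X\<close>, the free step
  is to identify them. Where a colouring disagrees with a free step, at most two guesses make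
  progress \<open>d\<close>, so this costs \<open>O(n / d)\<close> guesses in total.

  Suppose that no free step is left. Degrees in \<open>X\<close> are at most \<open>d\<close>, and, up to \<open>O(d)\<close> vertices and
  their neighbours, any two vertices of \<open>X\<close> are joined by a path of length three inside \<open>X\<close>, because
  the diameter is three. So most vertices have many vertices two steps away, and guessing
  the colours on a random set \<open>S\<close> of density about \<open>d t / n\<close> with \<open>n\<^sup>2 \<le> d\<^sup>2 t\<^sup>5\<close> takes vertices carrying
  a constant fraction of the edges out of \<open>X\<close>. Hence some nonempty \<open>S\<close> costs \<open>|S|\<close> guesses and removes a
  fraction of at least \<open>|S| / O(d t)\<close> of the edges, and \<open>O(d t log n)\<close> guesses remove all of them; then
  \<open>X\<close> has at most \<open>3 d\<close> vertices left. Once all lists have at most two colours the instance is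
  solved like 2-SAT. The choice \<open>d = n\<^bsup>3/8\<^esup>\<close>, \<open>t = n\<^bsup>1/4\<^esup>\<close> balances the bounds at \<open>O(n\<^bsup>5/8\<^esup> log n)\<close>
  guesses, where \<open>5/8 < 2/3 - 1/33\<close>.
\<close>

section \<open>Random subsets\<close>

text \<open>The random set lives only in the analysis. The search branches over every vertex and
  colour, so it meets the right colours on a suitable \<open>S\<close> without knowing
  \<open>S\<close>, at a polynomial factor per guess. Free steps do not branch, so \<open>k\<close>
  guesses on \<open>F\<close> levels give about \<open>(3 * n * F) ^ k\<close> nodes.

  Why \<open>n\<^sup>2 \<le> d\<^sup>2 * t ^ 5\<close>: a typical vertex \<open>v\<close> has
  \<open>t\<close> neighbours \<open>b\<close> of one colour, and each \<open>b\<close> has about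
  \<open>t\<close> neighbours of each of the two other colours. Common neighbours of two vertices of
  one colour see few vertices, or a free step would apply, so these sets can be made disjoint. A
  random set of density \<open>p\<close> meets both sets at \<open>b\<close> with probability about
  \<open>(t * p)\<^sup>2\<close>; then \<open>b\<close> is forced and \<open>v\<close> loses a
  colour. With \<open>p = d * t / n\<close>, the condition says that
  \<open>t * (t * p)\<^sup>2\<close>, the sum over the \<open>t\<close> choices of \<open>b\<close>,
  is at least of order one. Equality here and in \<open>n / d = d * t\<close> gives
  \<open>t ^ 4 = n\<close> and so the exponents of \<open>d\<close> and \<open>t\<close>.\<close>

definition rexp :: "real \<Rightarrow> 'a set \<Rightarrow> ('a set \<Rightarrow> real) \<Rightarrow> real" where
  "rexp p D F = (\<Sum>S\<in>Pow D. p ^ card S * (1 - p) ^ card (D - S) * F S)"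

lemma rexp_empty [simp]: "rexp p {} F = F {}"
  by (simp add: rexp_def)

text \<open>\<open>rexp p D F\<close> is the expectation of \<open>F S\<close> for a random
  \<open>S\<close> that contains each element of \<open>D\<close> independently with probability
  \<open>p\<close>, written as a finite sum. Conditioning on \<open>x\<close> is the recursion
  behind \<open>rexp_one\<close>, \<open>rexp_card\<close>, \<open>rexp_prod\<close> and
  \<open>rexp_miss\<close>.\<close>

lemma rexp_insert:
  assumes "finite D" "x \<notin> D"
  shows "rexp p (insert x D) F = (1 - p) * rexp p D F + p * rexp p D (\<lambda>S. F (insert x S))"
proof -
  let ?w = "\<lambda>S. p ^ card S * (1 - p) ^ card (insert x D - S) * F S"
  have inj: "inj_on (insert x) (Pow D)"
    using assms(2) by (auto simp: inj_on_def)
  have "rexp p (insert x D) F = (\<Sum>S\<in>Pow D. ?w S) + (\<Sum>S\<in>insert x ` Pow D. ?w S)"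
    unfolding rexp_def Pow_insert
    by (rule sum.union_disjoint) (use assms in auto)
  also have "(\<Sum>S\<in>insert x ` Pow D. ?w S) = (\<Sum>S\<in>Pow D. ?w (insert x S))"
    by (simp add: sum.reindex[OF inj])
  also have "\<dots> = p * rexp p D (\<lambda>S. F (insert x S))"
    unfolding rexp_def sum_distrib_left
  proof (rule sum.cong[OF refl])
    fix S assume "S \<in> Pow D"
    then have "S \<subseteq> D" "x \<notin> S" "finite S" using assms by (auto dest: finite_subset)
    moreover have "insert x D - insert x S = D - S" using assms \<open>S \<subseteq> D\<close> by auto
    ultimately show "?w (insert x S) = p * (p ^ card S * (1 - p) ^ card (D - S) * F (insert x S))"
      by simp
  qed
  also have "(\<Sum>S\<in>Pow D. ?w S) = (1 - p) * rexp p D F"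
    unfolding rexp_def sum_distrib_left
  proof (rule sum.cong[OF refl])
    fix S assume "S \<in> Pow D"
    then have "S \<subseteq> D" "x \<notin> S" using assms by auto
    then have "insert x D - S = insert x (D - S)" by auto
    then show "?w S = (1 - p) * (p ^ card S * (1 - p) ^ card (D - S) * F S)"
      using assms by simp
  qed
  finally show ?thesis .
qed

lemma rexp_cong:
  assumes "\<And>S. S \<subseteq> D \<Longrightarrow> F S = G S"
  shows "rexp p D F = rexp p D G"
  unfolding rexp_def by (rule sum.cong) (auto simp: assms)

lemma rexp_add: "rexp p D (\<lambda>S. F S + G S) = rexp p D F + rexp p D G"
  by (simp add: rexp_def sum.distrib distrib_left)

lemma rexp_diff: "rexp p D (\<lambda>S. F S - G S) = rexp p D F - rexp p D G"
  by (simp add: rexp_def sum_subtractf right_diff_distrib)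

lemma rexp_scale: "rexp p D (\<lambda>S. a * F S) = a * rexp p D F"
  by (simp add: rexp_def sum_distrib_left mult_ac)

lemma rexp_sum: "rexp p D (\<lambda>S. \<Sum>i\<in>I. F i S) = (\<Sum>i\<in>I. rexp p D (F i))"
  unfolding rexp_def sum_distrib_left by (rule sum.swap)

lemma rexp_mono:
  assumes "0 \<le> p" "p \<le> 1" "\<And>S. S \<subseteq> D \<Longrightarrow> F S \<le> G S"
  shows "rexp p D F \<le> rexp p D G"
  unfolding rexp_def by (intro sum_mono mult_left_mono) (use assms in auto)

lemma rexp_one: "finite D \<Longrightarrow> rexp p D (\<lambda>_. 1) = 1"
  by (induction D rule: finite_induct) (simp_all add: rexp_insert)

lemma rexp_card: "finite D \<Longrightarrow> rexp p D (\<lambda>S. real (card S)) = p * card D"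
proof (induction D rule: finite_induct)
  case (insert x D)
  have "rexp p D (\<lambda>S. real (card (insert x S))) = rexp p D (\<lambda>S. real (card S) + 1)"
  proof (rule rexp_cong)
    fix S assume "S \<subseteq> D"
    then have "finite S" "x \<notin> S" using insert finite_subset by auto
    then show "real (card (insert x S)) = real (card S) + 1" by simp
  qed
  then show ?case using insert by (simp add: rexp_insert rexp_add rexp_one algebra_simps)
qed simp

text \<open>Independence: the parts of the random set in disjoint ground sets do not influence each
  other.\<close>

lemma rexp_prod:
  assumes "finite D1" "finite D2" "D1 \<inter> D2 = {}"
  shows "rexp p (D1 \<union> D2) (\<lambda>S. F (S \<inter> D1) * G (S \<inter> D2)) = rexp p D1 F * rexp p D2 G"
  using assms
proof (induction D1 arbitrary: F rule: finite_induct)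
  case empty
  have "rexp p D2 (\<lambda>S. F {} * G (S \<inter> D2)) = rexp p D2 (\<lambda>S. F {} * G S)"
    by (rule rexp_cong) (simp add: Int_absorb2)
  then show ?case by (simp add: rexp_scale)
next
  case (insert x D1)
  have x: "x \<notin> D1 \<union> D2" using insert by auto
  have 1: "rexp p (D1 \<union> D2) (\<lambda>S. F (S \<inter> insert x D1) * G (S \<inter> D2)) =
      rexp p (D1 \<union> D2) (\<lambda>S. F (S \<inter> D1) * G (S \<inter> D2))"
  proof (rule rexp_cong)
    fix S assume "S \<subseteq> D1 \<union> D2"
    then have "S \<inter> insert x D1 = S \<inter> D1" using x by auto
    then show "F (S \<inter> insert x D1) * G (S \<inter> D2) = F (S \<inter> D1) * G (S \<inter> D2)" by simp
  qed
  have 2: "rexp p (D1 \<union> D2) (\<lambda>S. F (insert x S \<inter> insert x D1) * G (insert x S \<inter> D2)) =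
      rexp p (D1 \<union> D2) (\<lambda>S. (\<lambda>T. F (insert x T)) (S \<inter> D1) * G (S \<inter> D2))"
  proof (rule rexp_cong)
    fix S assume "S \<subseteq> D1 \<union> D2"
    then have "insert x S \<inter> insert x D1 = insert x (S \<inter> D1)" "insert x S \<inter> D2 = S \<inter> D2"
      using x by auto
    then show "F (insert x S \<inter> insert x D1) * G (insert x S \<inter> D2) =
      (\<lambda>T. F (insert x T)) (S \<inter> D1) * G (S \<inter> D2)" by simp
  qed
  have "rexp p (insert x D1 \<union> D2) (\<lambda>S. F (S \<inter> insert x D1) * G (S \<inter> D2)) =
     (1 - p) * rexp p (D1 \<union> D2) (\<lambda>S. F (S \<inter> insert x D1) * G (S \<inter> D2)) +
     p * rexp p (D1 \<union> D2) (\<lambda>S. F (insert x S \<inter> insert x D1) * G (insert x S \<inter> D2))"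
    using rexp_insert[of "D1 \<union> D2" x] x insert by simp
  also have "\<dots> = (1 - p) * (rexp p D1 F * rexp p D2 G) +
     p * (rexp p D1 (\<lambda>T. F (insert x T)) * rexp p D2 G)"
    unfolding 1 2 using insert by (subst (1 2) insert.IH) auto
  also have "\<dots> = rexp p (insert x D1) F * rexp p D2 G"
    using insert by (simp add: rexp_insert algebra_simps)
  finally show ?case .
qed

lemma rexp_miss:
  "finite A \<Longrightarrow> rexp p A (\<lambda>S. of_bool (S \<inter> A = {})) = (1 - p) ^ card A"
proof (induction A rule: finite_induct)
  case (insert x A)
  have "rexp p A (\<lambda>S. of_bool (S \<inter> insert x A = {})) = rexp p A (\<lambda>S. of_bool (S \<inter> A = {}))"
    by (rule rexp_cong) (use insert in auto)
  moreover have "rexp p A (\<lambda>S. of_bool (insert x S \<inter> insert x A = {})) = 0"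
    by (simp add: rexp_def)
  ultimately show ?case using insert by (simp add: rexp_insert)
qed simp

lemma rexp_hit_both:
  assumes "finite A" "finite C" "A \<inter> C = {}"
  shows "rexp p (A \<union> C) (\<lambda>S. of_bool (S \<inter> A \<noteq> {} \<and> S \<inter> C \<noteq> {})) =
    (1 - (1 - p) ^ card A) * (1 - (1 - p) ^ card C)"
proof -
  have hit: "rexp p A (\<lambda>S. of_bool (S \<inter> A \<noteq> {})) = 1 - (1 - p) ^ card A" if "finite A" for A :: "'a set"
  proof -
    have "rexp p A (\<lambda>S. of_bool (S \<inter> A \<noteq> {})) = rexp p A (\<lambda>S. 1 - of_bool (S \<inter> A = {}))"
      by (rule rexp_cong) auto
    then show ?thesis using that by (simp add: rexp_diff rexp_one rexp_miss)
  qed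
  have "rexp p (A \<union> C) (\<lambda>S. of_bool (S \<inter> A \<noteq> {} \<and> S \<inter> C \<noteq> {})) =
     rexp p (A \<union> C) (\<lambda>S. (\<lambda>T. of_bool (T \<inter> A \<noteq> {})) (S \<inter> A) * (\<lambda>T. of_bool (T \<inter> C \<noteq> {})) (S \<inter> C))"
    by (rule rexp_cong) auto
  also have "\<dots> = (1 - (1 - p) ^ card A) * (1 - (1 - p) ^ card C)"
    by (subst rexp_prod) (use assms hit in auto)
  finally show ?thesis .
qed

text \<open>The events for different \<open>b\<close> live on disjoint ground sets, so they are
  independent, and each fails with probability at most \<open>1 - q\<^sup>2\<close>. The induction
  splits off the ground set of one \<open>b\<close>, which is why \<open>X\<close> varies.\<close>

lemma rexp_miss_family:
  assumes p: "0 \<le> p" "p \<le> 1"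
    and "finite B" "finite X"
    and "\<And>b. b \<in> B \<Longrightarrow> A b \<subseteq> X \<and> C b \<subseteq> X \<and> A b \<inter> C b = {}"
    and "\<And>b b'. b \<in> B \<Longrightarrow> b' \<in> B \<Longrightarrow> b \<noteq> b' \<Longrightarrow> (A b \<union> C b) \<inter> (A b' \<union> C b') = {}"
    and "\<And>b. b \<in> B \<Longrightarrow> q \<le> 1 - (1 - p) ^ card (A b)"
    and "\<And>b. b \<in> B \<Longrightarrow> q \<le> 1 - (1 - p) ^ card (C b)"
    and q: "0 \<le> q"
  shows "rexp p X (\<lambda>S. of_bool (\<forall>b\<in>B. \<not> (S \<inter> A b \<noteq> {} \<and> S \<inter> C b \<noteq> {}))) \<le> (1 - q\<^sup>2) ^ card B"
  using assms(3-8)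
proof (induction B arbitrary: X rule: finite_induct)
  case empty
  then show ?case by (simp add: rexp_one)
next
  case (insert b B)
  let ?D = "A b \<union> C b"
  let ?Q = "\<lambda>B S. of_bool (\<forall>b\<in>B. \<not> (S \<inter> A b \<noteq> {} \<and> S \<inter> C b \<noteq> {})) :: real"
  have D: "?D \<subseteq> X" "finite ?D" "finite (A b)" "finite (C b)" "A b \<inter> C b = {}"
    using insert.prems(1) insert.prems(2)[of b] finite_subset by auto
  have sub: "A b' \<subseteq> X - ?D \<and> C b' \<subseteq> X - ?D" if "b' \<in> B" for b'
    using insert.prems(2)[of b'] insert.prems(3)[of b b'] insert.hyps(2) that by auto
  have X: "X = ?D \<union> (X - ?D)" using D by auto
  have "rexp p X (?Q (insert b B)) =
      rexp p (?D \<union> (X - ?D)) (\<lambda>S. ?Q {b} (S \<inter> ?D) * ?Q B (S \<inter> (X - ?D)))"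
  proof (subst X, rule rexp_cong)
    fix S
    have e1: "S \<inter> ?D \<inter> A b = S \<inter> A b" "S \<inter> ?D \<inter> C b = S \<inter> C b" by auto
    have e2: "S \<inter> (X - ?D) \<inter> A b' = S \<inter> A b'" "S \<inter> (X - ?D) \<inter> C b' = S \<inter> C b'" if "b' \<in> B" for b'
      using sub[OF that] by auto
    show "?Q (insert b B) S = ?Q {b} (S \<inter> ?D) * ?Q B (S \<inter> (X - ?D))"
      using e1 e2 by (auto simp: of_bool_def)
  qed
  also have "\<dots> = rexp p ?D (?Q {b}) * rexp p (X - ?D) (?Q B)"
    by (rule rexp_prod) (use D insert.prems in auto)
  also have "\<dots> \<le> (1 - q\<^sup>2) * (1 - q\<^sup>2) ^ card B"
  proof (rule mult_mono)
    have "rexp p ?D (?Q {b}) = rexp p ?D (\<lambda>S. 1 - of_bool (S \<inter> A b \<noteq> {} \<and> S \<inter> C b \<noteq> {}))"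
      by (rule rexp_cong) auto
    also have "\<dots> = 1 - (1 - (1 - p) ^ card (A b)) * (1 - (1 - p) ^ card (C b))"
      using D by (simp add: rexp_diff rexp_one rexp_hit_both)
    also have "\<dots> \<le> 1 - q * q"
      using mult_mono[OF insert.prems(4)[of b] insert.prems(5)[of b]] q insert.prems(4)[of b]
      by auto
    finally show "rexp p ?D (?Q {b}) \<le> 1 - q\<^sup>2" by (simp add: power2_eq_square)
    show "rexp p (X - ?D) (?Q B) \<le> (1 - q\<^sup>2) ^ card B"
      by (rule insert.IH) (use insert.prems sub in auto)
    have "q \<le> 1 - (1 - p) ^ card (A b)" using insert.prems by auto
    also have "\<dots> \<le> 1" using p by simp
    finally show "0 \<le> 1 - q\<^sup>2" using q by (simp add: power_le_one)
    show "0 \<le> rexp p (X - ?D) (?Q B)"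
      unfolding rexp_def using p by (intro sum_nonneg) auto
  qed
  finally show ?case using insert.hyps by simp
qed

text \<open>A rational substitute for \<open>exp (- m * x)\<close>, sufficient where only constant
  probabilities matter.\<close>

lemma power_le_inverse:
  fixes x :: real assumes "0 \<le> x" "x \<le> 1"
  shows "(1 - x) ^ m \<le> 1 / (1 + m * x)"
proof (induction m)
  case (Suc m)
  have pos: "1 + m * x > 0" "1 + Suc m * x > 0" using assms by (auto intro: add_pos_nonneg)
  have "(1 - x) ^ Suc m \<le> (1 - x) * (1 / (1 + m * x))"
    unfolding power_Suc by (rule mult_left_mono[OF Suc]) (use assms in auto)
  also have "\<dots> \<le> 1 / (1 + Suc m * x)"
  proof -
    have "(1 - x) * (1 + Suc m * x) = 1 + m * x - Suc m * (x * x)" by (simp add: algebra_simps)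
    also have "\<dots> \<le> 1 + m * x" by simp
    finally show ?thesis using pos by (simp add: field_simps)
  qed
  finally show ?case .
qed simp

section \<open>Sets of guesses that remove many edges\<close>

text \<open>\<open>N\<close> is the neighbourhood in the graph induced by \<open>X\<close>. If the colours on \<open>S\<close> are guessed according
  to \<open>f\<close>, propagation shortens the lists of the vertices in \<open>kill_set X N f S\<close>.\<close>

definition kill_set :: "'a set \<Rightarrow> ('a \<Rightarrow> 'a set) \<Rightarrow> ('a \<Rightarrow> nat) \<Rightarrow> 'a set \<Rightarrow> 'a set" where
  "kill_set X N f S = {z \<in> X. z \<in> S \<or> N z \<inter> S \<noteq> {} \<or>
     (\<exists>b \<in> N z. \<exists>s \<in> S \<inter> N b. \<exists>s' \<in> S \<inter> N b. f s \<noteq> f s')}"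

text \<open>\<open>D x\<close> collects the vertices whose lists are shortened when \<open>x\<close> alone is given some colour.\<close>

locale near_diameter_3 =
  fixes X :: "'a set" and N :: "'a \<Rightarrow> 'a set" and f :: "'a \<Rightarrow> nat" and D :: "'a \<Rightarrow> 'a set"
    and d t n :: nat
  assumes fin: "finite X" and card_X: "card X \<le> n"
    and N_sub: "x \<in> X \<Longrightarrow> N x \<subseteq> X"
    and N_sym: "x \<in> X \<Longrightarrow> y \<in> N x \<Longrightarrow> x \<in> N y"
    and f_proper: "x \<in> X \<Longrightarrow> y \<in> N x \<Longrightarrow> f x \<noteq> f y"
    and f_less: "x \<in> X \<Longrightarrow> f x < 3"
    and card_N: "x \<in> X \<Longrightarrow> card (N x) \<le> d"
    and D_sub: "x \<in> X \<Longrightarrow> D x \<subseteq> X"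
    and card_D: "x \<in> X \<Longrightarrow> card (D x) \<le> 3 * d"
    and links: "x \<in> X \<Longrightarrow> z \<in> X \<Longrightarrow> z \<in> D x \<or> z \<in> (\<Union>u\<in>D x. N u) \<or> x \<in> (\<Union>u\<in>D z. N u)
        \<or> (\<exists>a \<in> N x. \<exists>b \<in> N a. z \<in> N b)"
    and common: "x \<in> X \<Longrightarrow> y \<in> X \<Longrightarrow> x \<noteq> y \<Longrightarrow> f x = f y \<Longrightarrow> card (\<Union>u\<in>N x \<inter> N y. N u) \<le> d"
    and d_pos: "0 < d" and t_pos: "0 < t" and n_le: "n\<^sup>2 \<le> d\<^sup>2 * t ^ 5"
begin

text \<open>The number of arcs of the induced graph with tail in \<open>Z\<close>; all of them
  disappear when \<open>Z\<close> leaves \<open>X\<close>. Weighting vertices by degree makes the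
  double counting in \<open>wgt_good\<close> exact.\<close>

definition wgt :: "'a set \<Rightarrow> nat" where "wgt Z = (\<Sum>z\<in>Z. card (N z))"

text \<open>\<open>1440 = 20 * 72\<close> serves \<open>wgt_short_two_step\<close>; it also leaves a
  surplus in \<open>exists_killing_set\<close>, where \<open>1440 * (5 / 64)\<close> has to exceed
  the density constant \<open>90\<close>.\<close>

abbreviation "M \<equiv> 1440 * d * t"

lemma finN: "x \<in> X \<Longrightarrow> finite (N x)"
  using N_sub fin finite_subset by metis

lemma wgt_mono: "A \<subseteq> B \<Longrightarrow> B \<subseteq> X \<Longrightarrow> wgt A \<le> wgt B"
  unfolding wgt_def by (rule sum_mono2) (use fin finite_subset in auto)

lemma wgt_UN:
  assumes "finite I" "\<And>i. i \<in> I \<Longrightarrow> A i \<subseteq> X"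
  shows "wgt (\<Union>i\<in>I. A i) \<le> (\<Sum>i\<in>I. wgt (A i))"
  using assms
proof (induction I rule: finite_induct)
  case (insert i I)
  have "finite (A i)" "finite (\<Union>i\<in>I. A i)"
    using insert by (auto intro!: finite_subset[OF _ fin])
  then have "wgt (A i \<union> (\<Union>i\<in>I. A i)) \<le> wgt (A i) + wgt (\<Union>i\<in>I. A i)"
    unfolding wgt_def by (subst sum.union_inter[symmetric]) auto
  with insert show ?case by fastforce
qed (simp add: wgt_def)

lemma wgt_Un: "A \<subseteq> X \<Longrightarrow> B \<subseteq> X \<Longrightarrow> wgt (A \<union> B) \<le> wgt A + wgt B"
  using wgt_UN[of "{True, False}" "\<lambda>b. if b then A else B"] by (auto simp: Un_commute)

text \<open>Since \<open>f\<close> is proper and uses three colours, \<open>a\<close> carries the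
  third one: these are ends of paths \<open>b\<close>, \<open>y\<close>, \<open>a\<close> through
  all three colours.\<close>

definition two_step :: "'a \<Rightarrow> nat \<Rightarrow> 'a set" where
  "two_step b c = {a. \<exists>y \<in> N b. f y = c \<and> a \<in> N y \<and> f a \<noteq> f b}"

text \<open>The threshold: \<open>private_nbrs\<close> discards at most \<open>d * t\<close> of the
  \<open>4 * d * t\<close> ends, and with degrees at most \<open>d\<close> the remaining
  \<open>3 * d * t\<close> ends require \<open>3 * t\<close> neighbours of colour
  \<open>c\<close>.\<close>

definition atypical :: "'a set" where
  "atypical = {b \<in> X. \<exists>c<3. c \<noteq> f b \<and> card (two_step b c) < 4 * d * t}"

definition good :: "'a set" where
  "good = {v \<in> X. v \<notin> atypical \<and> 2 * card (N v \<inter> atypical) \<le> card (N v)}"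

lemma two_step_sub: "b \<in> X \<Longrightarrow> two_step b c \<subseteq> X"
  unfolding two_step_def using N_sub by blast

text \<open>A vertex violating \<open>no_hub\<close> yields a killing set by itself, since its
  colour is struck from all of \<open>N a\<close>; \<open>exists_killing_set\<close> treats it
  apart. Without hubs, small sets and their neighbourhoods have small weight.\<close>

context
  assumes no_hub: "\<And>a. a \<in> X \<Longrightarrow> M * wgt (N a) \<le> wgt X"
begin

lemma wgt_single: 
  assumes "z \<in> X" shows "M * card (N z) \<le> wgt X"
proof (cases "N z = {}")
  case False
  \<comment> \<open>\<open>z\<close> lies in \<open>N u\<close>, so the hub bound at
    \<open>u\<close> covers \<open>z\<close> as well.\<close>
  then obtain u where u: "u \<in> N z" by auto
  then have "z \<in> N u" "u \<in> X" using N_sub N_sym assms by blast+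
  then have "card (N z) \<le> wgt (N u)"
    using wgt_mono[of "{z}" "N u"] N_sub by (auto simp: wgt_def)
  then show ?thesis using no_hub[OF \<open>u \<in> X\<close>] by (meson le_trans mult_le_mono2)
qed simp

lemma wgt_small:
  assumes "Z \<subseteq> X" shows "M * wgt Z \<le> card Z * wgt X"
proof -
  have "M * wgt Z = (\<Sum>z\<in>Z. M * card (N z))" by (simp add: wgt_def sum_distrib_left)
  also have "\<dots> \<le> (\<Sum>z\<in>Z. wgt X)" by (rule sum_mono) (use wgt_single assms in auto)
  finally show ?thesis by simp
qed

lemma wgt_nbhd:
  assumes "Z \<subseteq> X" shows "M * wgt (\<Union>u\<in>Z. N u) \<le> card Z * wgt X"
proof -
  have "M * wgt (\<Union>u\<in>Z. N u) \<le> M * (\<Sum>u\<in>Z. wgt (N u))"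
    using wgt_UN[of Z N] N_sub assms fin finite_subset by (intro mult_le_mono2) blast
  also have "\<dots> = (\<Sum>u\<in>Z. M * wgt (N u))" by (simp add: sum_distrib_left)
  also have "\<dots> \<le> (\<Sum>u\<in>Z. wgt X)" by (rule sum_mono) (use no_hub assms in auto)
  finally show ?thesis by simp
qed

text \<open>Two vertices of \<open>W\<close> can only be linked through a long path with two vertices of the
  two other colours, read in one of its two directions.\<close>

lemma wgt_short_two_step:
  assumes "e < 3" "c < 3" "c \<noteq> e"
  shows "72 * wgt {b \<in> X. f b = e \<and> card (two_step b c) < 4 * d * t} \<le> wgt X"
proof -
  define W where "W = {b \<in> X. f b = e \<and> card (two_step b c) < 4 * d * t}"
  \<comment> \<open>\<open>R x\<close> collects what \<open>x\<close> is linked to. It consists of a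
    small set and neighbourhoods of small sets, so its weight is at most
    \<open>10 * d * t * wgt X / M\<close>.\<close>
  define R where "R x = D x \<union> (\<Union>u\<in>D x. N u) \<union> (\<Union>u\<in>two_step x c. N u)" for x
  have W: "W \<subseteq> X" "finite W" using fin by (auto simp: W_def)
  have R_sub: "R x \<subseteq> X" if "x \<in> X" for x
    unfolding R_def using that D_sub N_sub two_step_sub by blast
  have sym: "z \<in> R x \<or> x \<in> R z" if x: "x \<in> W" and z: "z \<in> W" for x z
  proof -
    have xz: "x \<in> X" "z \<in> X" "f x = e" "f z = e" using x z by (auto simp: W_def)
    consider "z \<in> D x \<or> z \<in> (\<Union>u\<in>D x. N u) \<or> x \<in> (\<Union>u\<in>D z. N u)"
      | a b where "a \<in> N x" "b \<in> N a" "z \<in> N b"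
      using links[OF xz(1,2)] by blast
    then show ?thesis
    proof cases
      case 1 then show ?thesis by (auto simp: R_def)
    next
      case 2
      have ab: "a \<in> X" "b \<in> X" using 2 xz N_sub by blast+
      have sym: "x \<in> N a" "a \<in> N b" "b \<in> N z" using 2 N_sym xz ab by blast+
      have col: "f a \<noteq> e" "f b \<noteq> e" "f a \<noteq> f b" "f a < 3" "f b < 3"
        using 2 sym xz ab f_proper f_less by metis+
      show ?thesis
      proof (cases "f a = c")
        case True
        then have "b \<in> two_step x c" using 2 col xz by (auto simp: two_step_def)
        then show ?thesis using 2 by (auto simp: R_def)
      next
        case False
        then have "f b = c" using col assms by linarith
        then have "a \<in> two_step z c" using sym col xz by (auto simp: two_step_def)
        then show ?thesis using sym by (auto simp: R_def)
      qed
    qed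
  qed
  have R_wgt: "M * wgt (R x) \<le> 10 * d * t * wgt X" if x: "x \<in> W" for x
  proof -
    have xX: "x \<in> X" using x W by auto
    have sub: "D x \<subseteq> X" "(\<Union>u\<in>D x. N u) \<subseteq> X" "(\<Union>u\<in>two_step x c. N u) \<subseteq> X"
      using D_sub[OF xX] two_step_sub[OF xX] N_sub by blast+
    have "wgt (R x) \<le> wgt (D x) + wgt (\<Union>u\<in>D x. N u) + wgt (\<Union>u\<in>two_step x c. N u)"
      unfolding R_def using sub by (meson Un_least add_mono_thms_linordered_semiring(3) le_trans wgt_Un)
    then have "M * wgt (R x) \<le> M * wgt (D x) + M * wgt (\<Union>u\<in>D x. N u) + M * wgt (\<Union>u\<in>two_step x c. N u)"
      by (metis distrib_left mult_le_mono2)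
    also have "\<dots> \<le> card (D x) * wgt X + card (D x) * wgt X + card (two_step x c) * wgt X"
      by (intro add_mono wgt_small wgt_nbhd D_sub two_step_sub xX)
    also have "\<dots> \<le> (3 * d) * wgt X + (3 * d) * wgt X + (4 * d * t) * wgt X"
      by (intro add_mono mult_le_mono1 card_D xX) (use x in \<open>auto simp: W_def\<close>)
    also have "\<dots> = (6 * d + 4 * d * t) * wgt X" by (simp add: algebra_simps)
    also have "\<dots> \<le> (10 * d * t) * wgt X"
    proof (rule mult_le_mono1)
      have "d \<le> d * t" using t_pos by simp
      then show "6 * d + 4 * d * t \<le> 10 * d * t" by (simp add: mult.assoc)
    qed
    finally show ?thesis .
  qed
  let ?w = "\<lambda>x. card (N x)"
  \<comment> \<open>Count weighted pairs of \<open>W\<close>: each pair is related by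
    \<open>R\<close> in at least one direction, and swapping shows that both directions contribute
    the same sum. With the bound on \<open>wgt (R x)\<close>, one factor \<open>wgt W\<close>
    cancels.\<close>
  have "wgt W * wgt W = (\<Sum>x\<in>W. \<Sum>z\<in>W. ?w x * ?w z)"
    by (simp add: wgt_def sum_product)
  also have "\<dots> \<le> (\<Sum>x\<in>W. \<Sum>z\<in>W. (if z \<in> R x then ?w x * ?w z else 0) + (if x \<in> R z then ?w x * ?w z else 0))"
    by (intro sum_mono) (use sym in auto)
  also have "\<dots> = (\<Sum>x\<in>W. \<Sum>z\<in>W. (if z \<in> R x then ?w x * ?w z else 0)) +
     (\<Sum>x\<in>W. \<Sum>z\<in>W. (if x \<in> R z then ?w x * ?w z else 0))"
    by (simp add: sum.distrib)
  also have "(\<Sum>x\<in>W. \<Sum>z\<in>W. (if x \<in> R z then ?w x * ?w z else 0)) =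
    (\<Sum>x\<in>W. \<Sum>z\<in>W. (if z \<in> R x then ?w x * ?w z else 0))"
    by (subst sum.swap) (auto intro!: sum.cong)
  also have "(\<Sum>x\<in>W. \<Sum>z\<in>W. (if z \<in> R x then ?w x * ?w z else 0)) \<le> (\<Sum>x\<in>W. ?w x * wgt (R x))"
  proof (rule sum_mono)
    fix x assume "x \<in> W"
    have "(\<Sum>z\<in>W. (if z \<in> R x then ?w x * ?w z else 0)) = (\<Sum>z\<in>W \<inter> R x. ?w x * ?w z)"
      using W by (simp add: sum.inter_restrict)
    also have "\<dots> = ?w x * wgt (W \<inter> R x)" by (simp add: wgt_def sum_distrib_left)
    also have "\<dots> \<le> ?w x * wgt (R x)"
      using \<open>x \<in> W\<close> W by (intro mult_le_mono2 wgt_mono R_sub) auto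
    finally show "(\<Sum>z\<in>W. (if z \<in> R x then ?w x * ?w z else 0)) \<le> ?w x * wgt (R x)" .
  qed
  finally have "wgt W * wgt W \<le> 2 * (\<Sum>x\<in>W. ?w x * wgt (R x))" by simp
  then have "M * (wgt W * wgt W) \<le> M * (2 * (\<Sum>x\<in>W. ?w x * wgt (R x)))" by (rule mult_le_mono2)
  also have "\<dots> = 2 * (\<Sum>x\<in>W. ?w x * (M * wgt (R x)))"
    by (simp add: sum_distrib_left mult_ac)
  also have "\<dots> \<le> 2 * (\<Sum>x\<in>W. ?w x * (10 * d * t * wgt X))"
    by (intro mult_le_mono2 sum_mono R_wgt)
  also have "\<dots> = wgt W * (20 * d * t * wgt X)"
    unfolding wgt_def[of W] sum_distrib_right by (simp add: sum_distrib_left mult_ac)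
  finally have "(20 * d * t * wgt W) * (72 * wgt W) \<le> (20 * d * t * wgt W) * wgt X"
    by (simp add: mult_ac)
  then have "72 * wgt W \<le> wgt X \<or> wgt W = 0"
    using d_pos t_pos by (cases "wgt W = 0") auto
  then show ?thesis unfolding W_def by auto
qed

text \<open>A union bound over the pairs \<open>(f b, c)\<close>; the crude count of nine pairs
  turns \<open>1 / 72\<close> into \<open>1 / 8\<close>.\<close>

lemma wgt_atypical: "8 * wgt atypical \<le> wgt X"
proof -
  define I where "I = {p :: nat \<times> nat. fst p < 3 \<and> snd p < 3 \<and> snd p \<noteq> fst p}"
  define W where "W p = {b \<in> X. f b = fst p \<and> card (two_step b (snd p)) < 4 * d * t}" for p
  have I: "I \<subseteq> {..<3} \<times> {..<3}" by (auto simp: I_def)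
  then have finI: "finite I" by (rule finite_subset) auto
  have "card I \<le> card ({..<3::nat} \<times> {..<3::nat})" by (rule card_mono[OF _ I]) auto
  then have cI: "card I \<le> 9" by simp
  have "atypical \<subseteq> (\<Union>p\<in>I. W p)"
  proof
    fix b assume "b \<in> atypical"
    then obtain c where "b \<in> X" "c < 3" "c \<noteq> f b" "card (two_step b c) < 4 * d * t"
      by (auto simp: atypical_def)
    then have "(f b, c) \<in> I" "b \<in> W (f b, c)" using f_less by (auto simp: I_def W_def)
    then show "b \<in> (\<Union>p\<in>I. W p)" by blast
  qed
  then have "wgt atypical \<le> wgt (\<Union>p\<in>I. W p)" by (rule wgt_mono) (auto simp: W_def)
  also have "\<dots> \<le> (\<Sum>p\<in>I. wgt (W p))" by (rule wgt_UN[OF finI]) (auto simp: W_def)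
  finally have "72 * wgt atypical \<le> (\<Sum>p\<in>I. 72 * wgt (W p))" by (simp add: sum_distrib_left[symmetric])
  also have "\<dots> \<le> (\<Sum>p\<in>I. wgt X)"
    by (rule sum_mono) (use wgt_short_two_step in \<open>auto simp: I_def W_def\<close>)
  also have "\<dots> \<le> 9 * wgt X" using cI by simp
  finally show ?thesis by simp
qed

text \<open>A vertex is bad if it is atypical or if more than half of its neighbours are. Double
  counting the arcs into \<open>atypical\<close> bounds the weight of the second kind by
  \<open>2 * wgt atypical\<close>, so bad vertices carry at most \<open>3 / 8\<close> of the
  weight.\<close>

lemma wgt_good: "5 * wgt X \<le> 8 * wgt good"
proof -
  have at: "atypical \<subseteq> X" by (auto simp: atypical_def)
  have "(\<Sum>v\<in>X. card (N v \<inter> atypical)) = (\<Sum>v\<in>X. \<Sum>b\<in>atypical. if b \<in> N v then 1 else 0)"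
  proof (rule sum.cong[OF refl])
    fix v
    have "N v \<inter> atypical = atypical \<inter> {b. b \<in> N v}" by auto
    then show "card (N v \<inter> atypical) = (\<Sum>b\<in>atypical. if b \<in> N v then 1 else 0)"
      using finite_subset[OF at fin] by (simp add: sum.If_cases)
  qed
  also have "\<dots> = (\<Sum>b\<in>atypical. \<Sum>v\<in>X. if b \<in> N v then 1 else 0)" by (rule sum.swap)
  also have "\<dots> = (\<Sum>b\<in>atypical. card (N b))"
  proof (rule sum.cong[OF refl])
    fix b assume "b \<in> atypical"
    then have "X \<inter> {v. b \<in> N v} = N b" using at N_sub N_sym by blast
    then show "(\<Sum>v\<in>X. if b \<in> N v then 1 else 0) = card (N b)" using fin by (simp add: sum.If_cases)
  qed
  finally have dc: "(\<Sum>v\<in>X. card (N v \<inter> atypical)) = wgt atypical" by (simp add: wgt_def)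
  have "wgt X = wgt good + wgt (X - good)"
    unfolding wgt_def using fin by (subst sum.subset_diff[of good X]) (auto simp: good_def)
  also have "wgt (X - good) \<le> wgt (atypical \<union> {v \<in> X. card (N v) < 2 * card (N v \<inter> atypical)})"
    by (rule wgt_mono) (use at in \<open>auto simp: good_def\<close>)
  also have "\<dots> \<le> wgt atypical + wgt {v \<in> X. card (N v) < 2 * card (N v \<inter> atypical)}"
    by (rule wgt_Un) (use at in auto)
  also have "wgt {v \<in> X. card (N v) < 2 * card (N v \<inter> atypical)} \<le>
     (\<Sum>v\<in>{v \<in> X. card (N v) < 2 * card (N v \<inter> atypical)}. 2 * card (N v \<inter> atypical))"
    unfolding wgt_def by (rule sum_mono) auto
  also have "\<dots> \<le> (\<Sum>v\<in>X. 2 * card (N v \<inter> atypical))"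
    by (rule sum_mono2) (use fin in auto)
  also have "\<dots> = 2 * wgt atypical" by (simp add: sum_distrib_left[symmetric] dc)
  finally have "wgt X \<le> wgt good + 3 * wgt atypical" by simp
  then show ?thesis using wgt_atypical by simp
qed

end

text \<open>Neighbours shared with another \<open>b'\<close> account for at most \<open>d\<close>
  ends of \<open>two_step b c\<close>, because \<open>common\<close> applies to vertices of equal
  colour. All other ends are reached through private neighbours, each of degree at most
  \<open>d\<close>.\<close>

lemma private_nbrs:
  assumes B: "B \<subseteq> X" "card B = t" "finite B" "\<And>b'. b' \<in> B \<Longrightarrow> f b' = e"
    and b: "b \<in> B" "b \<notin> atypical" and c: "c < 3" "c \<noteq> e"
  shows "3 * t \<le> card ({y \<in> N b. f y = c} - (\<Union>b'\<in>B - {b}. N b'))"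
proof -
  let ?A = "{y \<in> N b. f y = c} - (\<Union>b'\<in>B - {b}. N b')"
  have bX: "b \<in> X" "f b = e" using assms by auto
  have A: "finite ?A" "?A \<subseteq> X" using finN bX N_sub by auto
  have "4 * d * t \<le> card (two_step b c)"
    using b c bX unfolding atypical_def by force
  also have "two_step b c \<subseteq> (\<Union>y\<in>?A. N y) \<union> (\<Union>b'\<in>B - {b}. \<Union>u\<in>N b \<inter> N b'. N u)"
    unfolding two_step_def by blast
  then have "card (two_step b c) \<le> card ((\<Union>y\<in>?A. N y) \<union> (\<Union>b'\<in>B - {b}. \<Union>u\<in>N b \<inter> N b'. N u))"
    by (rule card_mono[rotated]) (rule finite_subset[OF _ fin], use A B N_sub in blast)
  also have "\<dots> \<le> card (\<Union>y\<in>?A. N y) + card (\<Union>b'\<in>B - {b}. \<Union>u\<in>N b \<inter> N b'. N u)"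
    by (rule card_Un_le)
  also have "card (\<Union>y\<in>?A. N y) \<le> card ?A * d"
  proof -
    have "card (\<Union>y\<in>?A. N y) \<le> (\<Sum>y\<in>?A. card (N y))" by (rule card_UN_le[OF A(1)])
    also have "\<dots> \<le> card ?A * d" by (rule sum_bounded_above[of ?A "\<lambda>y. card (N y)" d, simplified]) (use A card_N in auto)
    finally show ?thesis .
  qed
  also have "card (\<Union>b'\<in>B - {b}. \<Union>u\<in>N b \<inter> N b'. N u) \<le> t * d"
  proof -
    have "card (\<Union>b'\<in>B - {b}. \<Union>u\<in>N b \<inter> N b'. N u) \<le> (\<Sum>b'\<in>B - {b}. card (\<Union>u\<in>N b \<inter> N b'. N u))"
      by (rule card_UN_le) (use B in auto)
    also have "\<dots> \<le> card (B - {b}) * d"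
      by (rule sum_bounded_above[of "B - {b}" _ d, simplified]) (use B bX common in auto)
    also have "\<dots> \<le> t * d" using B card_Diff1_le[of B b] by (intro mult_le_mono1) auto
    finally show ?thesis .
  qed
  finally have "3 * t * d \<le> card ?A * d" by (simp add: algebra_simps)
  then show ?thesis using d_pos by simp
qed

end

section \<open>Random guesses shorten the lists of good vertices\<close>

context near_diameter_3
begin

text \<open>\<open>v\<close> is itself typical and hence has at least \<open>4 * t\<close>
  neighbours; at least half of them are typical, and they carry only the two colours other than
  \<open>f v\<close>. \<open>B\<close> has to be monochromatic because \<open>common\<close> speaks
  of equal colours.\<close>

lemma good_nbrs:
  assumes "v \<in> good"
  obtains B e where "B \<subseteq> N v" "B \<inter> atypical = {}" "card B = t" "\<And>b. b \<in> B \<Longrightarrow> f b = e"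
proof -
  have v: "v \<in> X" "v \<notin> atypical" "2 * card (N v \<inter> atypical) \<le> card (N v)"
    using assms by (auto simp: good_def)
  define c :: nat where "c = (if f v = 0 then 1 else 0)"
  have c: "c < 3" "c \<noteq> f v" by (auto simp: c_def)
  have "4 * d * t \<le> card (two_step v c)" using v c by (force simp: atypical_def)
  also have "\<dots> \<le> card (\<Union>y\<in>N v. N y)"
    by (rule card_mono, rule finite_subset[OF _ fin]) (use v N_sub in \<open>auto simp: two_step_def\<close>)
  also have "\<dots> \<le> (\<Sum>y\<in>N v. card (N y))" by (rule card_UN_le[OF finN[OF v(1)]])
  also have "\<dots> \<le> card (N v) * d"
    by (rule sum_bounded_above[of "N v" _ d, simplified]) (use v N_sub card_N in auto)
  finally have "4 * t \<le> card (N v)" using d_pos by simp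
  moreover have "card (N v - atypical) = card (N v) - card (N v \<inter> atypical)"
    by (rule card_Diff_subset_Int) (use finN[OF v(1)] in auto)
  ultimately have big: "2 * t \<le> card (N v - atypical)" using v by linarith
  define P where "P e = {b \<in> N v - atypical. f b = e}" for e
  define e1 :: nat where "e1 = (if f v = 0 then 1 else 0)"
  define e2 :: nat where "e2 = (if f v = 2 then 1 else 2)"
  have e: "x = e1 \<or> x = e2" if "x < 3" "x \<noteq> f v" for x
    using that f_less[OF v(1)] by (cases "f v = 0"; cases "f v = 2"; cases "x = 0"; cases "x = 1") (auto simp: e1_def e2_def)
  have "N v - atypical \<subseteq> P e1 \<union> P e2"
  proof
    fix b assume b: "b \<in> N v - atypical"
    then have "f b < 3" "f b \<noteq> f v" using f_less f_proper[OF v(1)] N_sub[OF v(1)] by (auto, metis)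
    then show "b \<in> P e1 \<union> P e2" using e b by (auto simp: P_def)
  qed
  then have "card (N v - atypical) \<le> card (P e1 \<union> P e2)"
    by (rule card_mono[rotated]) (use finN[OF v(1)] in \<open>auto simp: P_def\<close>)
  also have "\<dots> \<le> card (P e1) + card (P e2)" by (rule card_Un_le)
  finally have "card (N v - atypical) \<le> card (P e1) + card (P e2)" .
  with big have "t \<le> card (P e1) \<or> t \<le> card (P e2)" by linarith
  then obtain e where "t \<le> card (P e)" by auto
  then obtain B where "B \<subseteq> P e" "card B = t" using obtain_subset_with_card_n by metis
  then show ?thesis using that[of B e] by (auto simp: P_def)
qed

text \<open>\<open>v\<close> is killed as soon as some \<open>b\<close> in \<open>B\<close> sees two
  colours in \<open>S\<close>. The private neighbourhoods of different \<open>b\<close> are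
  disjoint, so these \<open>t\<close> chances are independent.\<close>

lemma kill_probability:
  assumes v: "v \<in> good" and p: "p = 90 * d * t / n" "p \<le> 1" and n: "n > 0"
  shows "1 / 8 \<le> rexp p X (\<lambda>S. of_bool (v \<in> kill_set X N f S))"
proof -
  obtain B e where B: "B \<subseteq> N v" "B \<inter> atypical = {}" "card B = t" "\<And>b. b \<in> B \<Longrightarrow> f b = e"
    using good_nbrs[OF v] by blast
  have vX: "v \<in> X" using v by (auto simp: good_def)
  have BX: "B \<subseteq> X" "finite B" using B(1) N_sub[OF vX] finite_subset[OF _ fin] by auto
  have "B \<noteq> {}" using B(3) t_pos by auto
  then have "e < 3" using B(4) BX f_less by blast
  define c1 :: nat where "c1 = (if e = 0 then 1 else 0)"
  define c2 :: nat where "c2 = (if e = 2 then 1 else 2)"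
  have c: "c1 < 3" "c2 < 3" "c1 \<noteq> e" "c2 \<noteq> e" "c1 \<noteq> c2"
    using \<open>e < 3\<close> by (auto simp: c1_def c2_def)
  define A where "A c b = {y \<in> N b. f y = c} - (\<Union>b'\<in>B - {b}. N b')" for c b
  \<comment> \<open>\<open>x\<close> is the expected number of sampled vertices among
    \<open>3 * t\<close> private neighbours; \<open>q\<close> is the hitting probability that
    \<open>power_le_inverse\<close> guarantees.\<close>
  define x where "x = 3 * real t * p"
  define q where "q = x / (1 + x)"
  have p0: "0 \<le> p" using p(1) by simp
  have x0: "0 \<le> x" using p0 by (simp add: x_def)
  have q: "0 \<le> q" "q \<le> 1" using x0 by (auto simp: q_def)
  have hit: "q \<le> 1 - (1 - p) ^ card (A c b)" if "b \<in> B" "c < 3" "c \<noteq> e" for b c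
  proof -
    have "3 * t \<le> card (A c b)"
      unfolding A_def by (rule private_nbrs) (use that B BX in auto)
    then have "(1 - p) ^ card (A c b) \<le> (1 - p) ^ (3 * t)"
      using p0 p(2) by (intro power_decreasing) auto
    also have "\<dots> \<le> 1 / (1 + real (3 * t) * p)" by (rule power_le_inverse) (use p0 p(2) in auto)
    also have "\<dots> = 1 - q" using x0 by (simp add: q_def x_def field_simps)
    finally show ?thesis by simp
  qed
  have sub: "A c b \<subseteq> X" if "b \<in> B" for c b using that BX N_sub by (auto simp: A_def)
  have killed: "v \<in> kill_set X N f S" if hb: "b \<in> B" "S \<inter> A c1 b \<noteq> {}" "S \<inter> A c2 b \<noteq> {}" for b S
  proof -
    obtain s s' where "s \<in> S \<inter> A c1 b" "s' \<in> S \<inter> A c2 b" using hb(2,3) by blast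
    then have "s \<in> S \<inter> N b" "s' \<in> S \<inter> N b" "f s = c1" "f s' = c2" by (auto simp: A_def)
    then have "\<exists>b \<in> N v. \<exists>s \<in> S \<inter> N b. \<exists>s' \<in> S \<inter> N b. f s \<noteq> f s'"
      using hb(1) B(1) c(5) by blast
    then show ?thesis using vX by (simp add: kill_set_def)
  qed
  have fam: "rexp p X (\<lambda>S. of_bool (\<forall>b\<in>B. \<not> (S \<inter> A c1 b \<noteq> {} \<and> S \<inter> A c2 b \<noteq> {}))) \<le> (1 - q\<^sup>2) ^ card B"
  proof (rule rexp_miss_family)
    show "A c1 b \<subseteq> X \<and> A c2 b \<subseteq> X \<and> A c1 b \<inter> A c2 b = {}" if "b \<in> B" for b
      using sub[OF that] c(5) by (auto simp: A_def)
    show "(A c1 b \<union> A c2 b) \<inter> (A c1 b' \<union> A c2 b') = {}" if "b \<in> B" "b' \<in> B" "b \<noteq> b'" for b b'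
      using that by (auto simp: A_def)
      show "q \<le> 1 - (1 - p) ^ card (A c1 b)" "q \<le> 1 - (1 - p) ^ card (A c2 b)" if "b \<in> B" for b
      using hit that c by blast+
  qed (use p0 p(2) BX fin q in auto)
  have q2: "0 \<le> q\<^sup>2" "q\<^sup>2 \<le> 1" using q by (auto simp: power_le_one)
  \<comment> \<open>If \<open>x\<close> is at least one, a single \<open>b\<close> succeeds with
    constant probability. Otherwise \<open>q\<close> is of order \<open>x\<close>, and
    \<open>n_le\<close> keeps \<open>t * x\<^sup>2\<close> above a constant. The value
    \<open>1 / 7\<close> makes the failure probability \<open>7 / 8\<close> below.\<close>
  have qt: "1 / 7 \<le> t * q\<^sup>2"
  proof (cases "x \<ge> 1")
    case True
    then have "1 / 2 \<le> q" by (simp add: q_def field_simps)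
    then have "(1 / 2)\<^sup>2 \<le> q\<^sup>2" by (intro power_mono) auto
    moreover have "q\<^sup>2 \<le> t * q\<^sup>2" using t_pos q2 by (simp add: mult_le_cancel_right1)
    ultimately show ?thesis by (simp add: power2_eq_square)
  next
    case False
    then have "x / 2 \<le> q" using x0 unfolding q_def by (intro divide_left_mono) auto
    then have "(x / 2)\<^sup>2 \<le> q\<^sup>2" using x0 by (intro power_mono) auto
    then have "t * (x / 2)\<^sup>2 \<le> t * q\<^sup>2" by (intro mult_left_mono) auto
    moreover have "t * (x / 2)\<^sup>2 = 18225 * (real (d\<^sup>2 * t ^ 5) / n\<^sup>2)"
    proof -
      have "x / 2 = 135 * (d * t\<^sup>2) / n" by (simp add: x_def p(1) power2_eq_square)
      then show ?thesis
        by (simp add: power_divide power_mult_distrib power2_eq_square eval_nat_numeral)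
    qed
    moreover have "1 \<le> real (d\<^sup>2 * t ^ 5) / n\<^sup>2"
    proof -
      have "real (n\<^sup>2) \<le> real (d\<^sup>2 * t ^ 5)" using n_le of_nat_le_iff by blast
      then show ?thesis using n by (simp add: field_simps)
    qed
    ultimately show ?thesis by simp
  qed
  have "(1 - q\<^sup>2) ^ card B \<le> 1 / (1 + card B * q\<^sup>2)" by (rule power_le_inverse) (use q2 in auto)
  also have "\<dots> \<le> 1 / (1 + 1 / 7)" using qt B(3) by (intro divide_left_mono) auto
  finally have "(1 - q\<^sup>2) ^ card B \<le> 7 / 8" by simp
  with fam have "1 / 8 \<le> 1 - rexp p X (\<lambda>S. of_bool (\<forall>b\<in>B. \<not> (S \<inter> A c1 b \<noteq> {} \<and> S \<inter> A c2 b \<noteq> {})))"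
    by simp
  also have "\<dots> = rexp p X (\<lambda>S. 1 - of_bool (\<forall>b\<in>B. \<not> (S \<inter> A c1 b \<noteq> {} \<and> S \<inter> A c2 b \<noteq> {})))"
    by (simp add: rexp_diff rexp_one fin)
  also have "\<dots> \<le> rexp p X (\<lambda>S. of_bool (v \<in> kill_set X N f S))"
    by (rule rexp_mono) (use p0 p(2) killed in auto)
  finally show ?thesis .
qed

text \<open>First moment method: the expectation of \<open>M\<close> times the killed weight exceeds
  that of the cost \<open>card S * wgt X\<close>, so some \<open>S\<close> achieves it. Hubs and a
  density above one are treated directly.\<close>

theorem exists_killing_set:
  assumes "wgt X > 0"
  shows "\<exists>S \<subseteq> X. S \<noteq> {} \<and> card S * wgt X \<le> M * wgt (kill_set X N f S)"
proof (cases "\<forall>a \<in> X. M * wgt (N a) \<le> wgt X")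
  case False
  then obtain a where a: "a \<in> X" "wgt X < M * wgt (N a)" by auto
  have "wgt (N a) \<le> wgt (kill_set X N f {a})"
    by (rule wgt_mono) (use a N_sub N_sym in \<open>auto simp: kill_set_def\<close>)
  then have "M * wgt (N a) \<le> M * wgt (kill_set X N f {a})" by (rule mult_le_mono2)
  then have "wgt X \<le> M * wgt (kill_set X N f {a})" using a(2) by linarith
  then show ?thesis using a(1) by (intro exI[of _ "{a}"]) simp
next
  case True
  have X: "X \<noteq> {}" using assms by (auto simp: wgt_def)
  then have n: "n > 0" using card_X fin card_gt_0_iff[of X] by linarith
  show ?thesis
  proof (cases "90 * d * t \<le> n")
    case False
    \<comment> \<open>The density would exceed one; \<open>X\<close> then has fewer than
      \<open>90 * d * t\<close> elements and can be guessed entirely.\<close>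
    have "kill_set X N f X = X" by (auto simp: kill_set_def)
    moreover have "card X * wgt X \<le> M * wgt X"
      by (rule mult_le_mono1) (use False card_X in linarith)
    ultimately show ?thesis using X by auto
  next
    case le: True
    define p where "p = real (90 * d * t) / n"
    have p: "0 \<le> p" "p \<le> 1" using le n by (auto simp: p_def divide_le_eq_1 simp del: of_nat_mult)
    \<comment> \<open>Good vertices carry \<open>5 / 8\<close> of the weight and are killed with
      probability at least \<open>1 / 8\<close>, so the first term has expectation at least
      \<open>1440 * (5 / 64) * d * t * wgt X\<close>; the second has at most
      \<open>90 * d * t * wgt X\<close>.\<close>
    define G where "G S = M * (\<Sum>v\<in>good. card (N v) * of_bool (v \<in> kill_set X N f S)) -
      real (wgt X) * real (card S)" for S
    have goodX: "good \<subseteq> X" by (auto simp: good_def)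
    define m where "m = real d * real t"
    have m: "m > 0" using d_pos t_pos by (simp add: m_def)
    define Q where "Q = (\<Sum>v\<in>good. card (N v) * rexp p X (\<lambda>S. of_bool (v \<in> kill_set X N f S)))"
    have G: "rexp p X G = 1440 * m * Q - wgt X * (p * card X)"
      unfolding G_def Q_def m_def using fin by (simp add: rexp_diff rexp_scale rexp_sum rexp_card)
    have "(\<Sum>v\<in>good. card (N v) * (1 / 8)) \<le> Q" unfolding Q_def
      by (intro sum_mono mult_left_mono kill_probability) (use p n in \<open>auto simp: p_def\<close>)
    moreover have "(\<Sum>v\<in>good. card (N v) * (1 / 8)) = real (wgt good) / 8"
      by (simp add: wgt_def sum_divide_distrib)
    moreover have "5 * wgt X \<le> 8 * wgt good" using wgt_good True by blast
    then have "5 * real (wgt X) \<le> 8 * real (wgt good)" by linarith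
    ultimately have "5 / 64 * wgt X \<le> Q" by linarith
    then have "1440 * m * (5 / 64 * wgt X) \<le> 1440 * m * Q" using m by (intro mult_left_mono) auto
    moreover have "wgt X * (p * card X) \<le> wgt X * (90 * m)"
    proof (rule mult_left_mono)
      have "p * card X \<le> p * n" using p card_X by (intro mult_left_mono) auto
      then show "p * card X \<le> 90 * m" using n by (simp add: p_def m_def)
    qed simp
    moreover have "1440 * m * (5 / 64 * wgt X) - wgt X * (90 * m) = 22.5 * (m * wgt X)"
      by (simp add: field_simps)
    moreover have "m * wgt X > 0" using assms m by simp
    ultimately have pos: "rexp p X G > 0" using G by linarith
    have "\<exists>S \<subseteq> X. G S > 0"
    proof (rule ccontr)
      assume "\<not> ?thesis"
      then have "rexp p X G \<le> rexp p X (\<lambda>_. 0)" by (intro rexp_mono p) (auto simp: not_less)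
      then show False using pos by (simp add: rexp_def)
    qed
    then obtain S where S: "S \<subseteq> X" "G S > 0" by auto
    \<comment> \<open>\<open>G\<close> vanishes on the empty set. A nonempty \<open>S\<close>
      ensures in \<open>solve_complete\<close> that guessing on it lowers the measure.\<close>
    have "S \<noteq> {}"
    proof
      assume "S = {}"
      then have "kill_set X N f S = {}" by (auto simp: kill_set_def)
      with S \<open>S = {}\<close> show False by (simp add: G_def)
    qed
    have "(\<Sum>v\<in>good. card (N v) * of_bool (v \<in> kill_set X N f S)) = wgt (good \<inter> kill_set X N f S)"
      unfolding wgt_def using finite_subset[OF goodX fin]
      by (simp add: of_bool_def sum.inter_restrict if_distrib cong: if_cong)
    also have "\<dots> \<le> wgt (kill_set X N f S)" by (rule wgt_mono) (auto simp: kill_set_def)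
    finally have "M * (\<Sum>v\<in>good. card (N v) * of_bool (v \<in> kill_set X N f S)) \<le> M * wgt (kill_set X N f S)"
      by (rule mult_le_mono2)
    moreover {
    have "real (card S * wgt X) < real (M * (\<Sum>v\<in>good. card (N v) * of_bool (v \<in> kill_set X N f S)))"
      using S(2) unfolding G_def by (simp add: mult.commute)
    then have "card S * wgt X < M * (\<Sum>v\<in>good. card (N v) * of_bool (v \<in> kill_set X N f S))"
      by (simp only: of_nat_less_iff) }
    ultimately have "card S * wgt X \<le> M * wgt (kill_set X N f S)" by linarith
    then show ?thesis using S(1) \<open>S \<noteq> {}\<close> by blast
  qed
qed

end

section \<open>States and propagation\<close>

type_synonym state = "(bool list \<times> bool list) list"

definition colours :: "state \<Rightarrow> nat \<Rightarrow> nat set" where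
  "colours st i = {c. c < 3 \<and> fst (st ! i) ! c}"

definition adj :: "state \<Rightarrow> nat \<Rightarrow> nat \<Rightarrow> bool" where
  "adj st i j \<longleftrightarrow> snd (st ! i) ! j"

definition shaped :: "nat \<Rightarrow> state \<Rightarrow> bool" where
  "shaped n st \<longleftrightarrow> length st = n \<and> (\<forall>i<n. length (fst (st ! i)) = 3 \<and> length (snd (st ! i)) = n)"

definition wf_state :: "nat \<Rightarrow> state \<Rightarrow> bool" where
  "wf_state n st \<longleftrightarrow> shaped n st \<and>
     (\<forall>i<n. \<not> adj st i i) \<and> (\<forall>i<n. \<forall>j<n. adj st i j \<longrightarrow> adj st j i)"

definition coloured :: "nat \<Rightarrow> state \<Rightarrow> (nat \<Rightarrow> nat) \<Rightarrow> bool" where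
  "coloured n st f \<longleftrightarrow> (\<forall>i<n. f i \<in> colours st i) \<and> (\<forall>i<n. \<forall>j<n. adj st i j \<longrightarrow> f i \<noteq> f j)"

definition vand :: "bool list \<Rightarrow> bool list \<Rightarrow> bool list" where
  "vand a b = map2 (\<and>) a b"

definition vdiff :: "bool list \<Rightarrow> bool list \<Rightarrow> bool list" where
  "vdiff a b = map2 (\<lambda>x y. x \<and> \<not> y) a b"

definition vor :: "bool list \<Rightarrow> bool list \<Rightarrow> bool list" where
  "vor a b = map2 (\<or>) a b"

definition vany :: "bool list \<Rightarrow> bool" where
  "vany a \<longleftrightarrow> True \<in> set a"

definition full :: "bool list \<Rightarrow> bool" where
  "full l \<longleftrightarrow> l ! 0 \<and> l ! 1 \<and> l ! 2"

text \<open>Removes the colours that a neighbour with list \<open>l\<close> leaves no choice about;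
  an empty list removes everything.\<close>

definition strike :: "bool list \<Rightarrow> bool list \<Rightarrow> bool list" where
  "strike b l = [b ! 0 \<and> (l ! 1 \<or> l ! 2), b ! 1 \<and> (l ! 0 \<or> l ! 2), b ! 2 \<and> (l ! 0 \<or> l ! 1)]"

fun upd :: "bool list \<Rightarrow> bool list \<Rightarrow> state \<Rightarrow> bool list" where
  "upd b [] st = b"
| "upd b (r # rs) st = upd (if r then strike b (fst (hd st)) else b) rs (tl st)"

definition rnd :: "state \<Rightarrow> state" where
  "rnd st = map (\<lambda>e. (upd (fst e) (snd e) st, snd e)) st"

definition propagate :: "state \<Rightarrow> state" where
  "propagate st = (rnd ^^ (3 * length st)) st"

text \<open>An empty list at \<open>j\<close> satisfies the premise for every \<open>c\<close>, so
  emptiness spreads to the neighbours, as in \<open>strike\<close>.\<close>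

definition closed :: "nat \<Rightarrow> state \<Rightarrow> bool" where
  "closed n st \<longleftrightarrow> (\<forall>i<n. \<forall>j<n. \<forall>c. adj st i j \<and> colours st j \<subseteq> {c} \<longrightarrow> c \<notin> colours st i)"

definition meas :: "state \<Rightarrow> nat" where
  "meas st = sum_list (map (\<lambda>e. length (filter id (fst e))) st)"

text \<open>Lists may shrink while the edges stay. Every step except contraction respects this
  relation, and colourings pull back along it.\<close>

definition same_graph :: "nat \<Rightarrow> state \<Rightarrow> state \<Rightarrow> bool" where
  "same_graph n st st' \<longleftrightarrow> (\<forall>i<n. \<forall>j<n. adj st' i j = adj st i j) \<and>
     (\<forall>i<n. colours st' i \<subseteq> colours st i)"

lemma less_3: "(c::nat) < 3 \<longleftrightarrow> c = 0 \<or> c = 1 \<or> c = 2" by linarith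

lemma ex_less_3: "(\<exists>c<3. P c) \<longleftrightarrow> P 0 \<or> P 1 \<or> P (2::nat)"
  unfolding less_3 by blast

lemma finite_colours [simp]: "finite (colours st i)"
  by (rule finite_subset[of _ "{..<3}"]) (auto simp: colours_def)

lemma colours_less: "c \<in> colours st i \<Longrightarrow> c < 3"
  by (simp add: colours_def)

lemma colours_sub: "colours st i \<subseteq> {..<3}"
  by (auto simp: colours_def)

lemma card_colours: "card (colours st i) \<le> 3"
  using card_mono[OF _ colours_sub] by simp

lemma shaped_length: "shaped n st \<Longrightarrow> length st = n"
  by (simp add: shaped_def)

lemma shaped_nth: "shaped n st \<Longrightarrow> i < n \<Longrightarrow> length (fst (st ! i)) = 3 \<and> length (snd (st ! i)) = n"
  by (simp add: shaped_def)

lemma shapedI: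
  "length st = n \<Longrightarrow> (\<And>i. i < n \<Longrightarrow> length (fst (st ! i)) = 3 \<and> length (snd (st ! i)) = n) \<Longrightarrow> shaped n st"
  by (simp add: shaped_def)

lemma meas_eq: "shaped n st \<Longrightarrow> meas st = (\<Sum>i<n. card (colours st i))"
proof -
  assume s: "shaped n st"
  then have len: "length st = n" by (simp add: shaped_def)
  have "meas st = (\<Sum>i<n. length (filter id (fst (st ! i))))"
    unfolding meas_def using len by (simp add: sum_list_sum_nth atLeast0LessThan)
  also have "\<dots> = (\<Sum>i<n. card (colours st i))"
    by (rule sum.cong[OF refl]) (use shaped_nth[OF s] in \<open>auto simp: length_filter_conv_card colours_def\<close>)
  finally show ?thesis .
qed

lemma same_graph_trans: "same_graph n a b \<Longrightarrow> same_graph n b c \<Longrightarrow> same_graph n a c"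
  unfolding same_graph_def by blast

lemma same_graph_refl: "same_graph n a a"
  unfolding same_graph_def by blast

lemma same_graph_coloured: "same_graph n a b \<Longrightarrow> coloured n b f \<Longrightarrow> coloured n a f"
  unfolding same_graph_def coloured_def by blast

lemma same_graph_wf: "wf_state n a \<Longrightarrow> shaped n b \<Longrightarrow> same_graph n a b \<Longrightarrow> wf_state n b"
  unfolding same_graph_def wf_state_def by blast

text \<open>Each shortened list is a unit of progress at least; this is how numbers of affected
  vertices are compared with the threshold \<open>d\<close>.\<close>

lemma same_graph_gain:
  assumes "shaped n a" "shaped n b" "same_graph n a b"
  shows "meas b + card {i. i < n \<and> colours b i \<noteq> colours a i} \<le> meas a"
proof -
  have "meas b + card {i. i < n \<and> colours b i \<noteq> colours a i} =
    (\<Sum>i<n. card (colours b i) + (if colours b i \<noteq> colours a i then 1 else 0))"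
    by (simp add: meas_eq[OF assms(2)] sum.distrib sum.If_cases Int_def)
  also have "\<dots> \<le> (\<Sum>i<n. card (colours a i))"
  proof (rule sum_mono)
    fix i assume "i \<in> {..<n}"
    then have "colours b i \<subseteq> colours a i" using assms by (auto simp: same_graph_def)
    then have "colours b i = colours a i \<or> card (colours b i) < card (colours a i)"
      using psubset_card_mono[OF finite_colours[of a i], of "colours b i"] by blast
    then show "card (colours b i) + (if colours b i \<noteq> colours a i then 1 else 0) \<le> card (colours a i)"
      by auto
  qed
  finally show ?thesis using assms by (simp add: meas_eq)
qed

lemma same_graph_meas: "shaped n a \<Longrightarrow> shaped n b \<Longrightarrow> same_graph n a b \<Longrightarrow> meas b \<le> meas a"
  using same_graph_gain by (meson add_leD1)

lemma same_graph_meas_less: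
  assumes "shaped n a" "shaped n b" "same_graph n a b" "i < n" "colours b i \<noteq> colours a i"
  shows "meas b < meas a"
proof -
  have "card {i. i < n \<and> colours b i \<noteq> colours a i} > 0"
    using assms(4,5) by (subst card_gt_0_iff) auto
  then show ?thesis using same_graph_gain[OF assms(1-3)] by linarith
qed

lemma strike_nth:
  assumes "c < 3" shows "strike b l ! c \<longleftrightarrow> b ! c \<and> (\<exists>c'<3. c' \<noteq> c \<and> l ! c')"
  using less_3[THEN iffD1, OF assms] by (elim disjE) (simp_all add: strike_def ex_less_3 nth_Cons')

lemma length_upd: "length b = 3 \<Longrightarrow> length (upd b rs st) = 3"
  by (induction b rs st rule: upd.induct) (auto simp: strike_def)

lemma upd_nth:
  assumes "length rs \<le> length st" "c < 3"
  shows "upd b rs st ! c \<longleftrightarrow> b ! c \<and> (\<forall>j<length rs. rs ! j \<longrightarrow> (\<exists>c'<3. c' \<noteq> c \<and> fst (st ! j) ! c'))"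
  using assms(1)
proof (induction b rs st rule: upd.induct)
  case (2 b r rs st)
  then obtain e st' where st: "st = e # st'" by (cases st) auto
  show ?case
    using 2 unfolding st by (simp add: All_less_Suc2 strike_nth[OF assms(2)])
qed simp

lemma shaped_rnd: 
  assumes "shaped n st" shows "shaped n (rnd st)"
  by (rule shapedI) (use shaped_nth[OF assms] shaped_length[OF assms] in \<open>simp_all add: rnd_def length_upd\<close>)

lemma adj_rnd: "shaped n st \<Longrightarrow> i < n \<Longrightarrow> adj (rnd st) i j = adj st i j"
  by (simp add: rnd_def adj_def shaped_def)

lemma colours_rnd:
  assumes "shaped n st" "i < n"
  shows "colours (rnd st) i = {c \<in> colours st i. \<forall>j<n. adj st i j \<longrightarrow> \<not> colours st j \<subseteq> {c}}"
proof -
  have len: "length st = n" "length (snd (st ! i)) = n"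
    using shaped_length[OF assms(1)] shaped_nth[OF assms] by auto
  have "fst (rnd st ! i) ! c \<longleftrightarrow> fst (st ! i) ! c \<and>
      (\<forall>j<n. adj st i j \<longrightarrow> (\<exists>c'<3. c' \<noteq> c \<and> fst (st ! j) ! c'))" if "c < 3" for c
    using assms(2) len that by (simp add: rnd_def upd_nth adj_def)
  then have "c \<in> colours (rnd st) i \<longleftrightarrow> c \<in> colours st i \<and>
      (\<forall>j<n. adj st i j \<longrightarrow> \<not> colours st j \<subseteq> {c})" for c
    unfolding colours_def subset_iff by (cases "c < 3") auto
  then show ?thesis by blast
qed

lemma same_graph_rnd:
  assumes "shaped n st" shows "same_graph n st (rnd st)"
proof -
  have "colours (rnd st) i \<subseteq> colours st i" if "i < n" for i
    unfolding colours_rnd[OF assms that] by blast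
  then show ?thesis using adj_rnd[OF assms] by (simp add: same_graph_def)
qed

lemma coloured_rnd:
  assumes "shaped n st" "coloured n st f" shows "coloured n (rnd st) f"
  unfolding coloured_def
proof (intro conjI allI impI)
  have f: "f i \<in> colours st i" if "i < n" for i using assms(2) that by (simp add: coloured_def)
  have proper: "f i \<noteq> f j" if "i < n" "j < n" "adj st i j" for i j
    using assms(2) that by (simp add: coloured_def)
  fix i assume i: "i < n"
  have "\<not> colours st j \<subseteq> {f i}" if "j < n" "adj st i j" for j
    using f[OF that(1)] proper[OF i that] by auto
  then show "f i \<in> colours (rnd st) i" unfolding colours_rnd[OF assms(1) i] using f[OF i] by blast
  fix j assume "j < n" "adj (rnd st) i j"
  then show "f i \<noteq> f j" using proper[OF i] adj_rnd[OF assms(1) i] by blast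
qed

lemma closed_iff_rnd: "shaped n st \<Longrightarrow> closed n st \<longleftrightarrow> (\<forall>i<n. colours (rnd st) i = colours st i)"
proof -
  assume s: "shaped n st"
  have "colours (rnd st) i = colours st i \<longleftrightarrow>
      (\<forall>j<n. \<forall>c. adj st i j \<and> colours st j \<subseteq> {c} \<longrightarrow> c \<notin> colours st i)" if "i < n" for i
    unfolding colours_rnd[OF s that] by blast
  then show ?thesis by (simp add: closed_def)
qed

lemma shaped_propagate: "shaped n st \<Longrightarrow> shaped n ((rnd ^^ k) st)"
  by (induction k) (auto simp: shaped_rnd)

lemma same_graph_funpow: "shaped n st \<Longrightarrow> same_graph n st ((rnd ^^ k) st)"
proof (induction k)
  case (Suc k)
  show ?case
    using same_graph_trans[OF Suc.IH[OF Suc.prems] same_graph_rnd[OF shaped_propagate[OF Suc.prems]]] by simp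
qed (simp add: same_graph_refl)

text \<open>A round without effect reveals a closed state, which stays closed; every other round
  removes a colour.\<close>

lemma rnd_progress:
  assumes "shaped n st"
  shows "closed n ((rnd ^^ k) st) \<or> meas ((rnd ^^ k) st) + k \<le> meas st"
proof (induction k)
  case (Suc k)
  let ?s = "(rnd ^^ k) st"
  have s: "shaped n ?s" by (rule shaped_propagate[OF assms])
  show ?case
  proof (cases "closed n ?s")
    case True
    then have "colours (rnd ?s) i = colours ?s i" if "i < n" for i
      using that closed_iff_rnd[OF s] by blast
    then have "closed n (rnd ?s)" using True adj_rnd[OF s] unfolding closed_def by simp
    then show ?thesis by simp
  next
    case False
    then obtain i where "i < n" "colours (rnd ?s) i \<noteq> colours ?s i" using closed_iff_rnd[OF s] by blast
    then have "meas (rnd ?s) < meas ?s"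
      using same_graph_meas_less[OF s shaped_rnd[OF s] same_graph_rnd[OF s]] by blast
    with Suc False show ?thesis by simp
  qed
qed simp

lemma meas_le: "shaped n st \<Longrightarrow> meas st \<le> 3 * n"
proof -
  assume "shaped n st"
  then have "meas st \<le> (\<Sum>i<n. 3)" unfolding meas_eq[OF \<open>shaped n st\<close>] by (intro sum_mono card_colours)
  then show ?thesis by simp
qed

lemma propagate:
  assumes "shaped n st"
  shows "shaped n (propagate st)" "same_graph n st (propagate st)" "closed n (propagate st)"
    "coloured n st f \<Longrightarrow> coloured n (propagate st) f"
proof -
  have len: "length st = n" using assms by (simp add: shaped_length)
  show s: "shaped n (propagate st)" unfolding propagate_def by (rule shaped_propagate[OF assms])
  show "same_graph n st (propagate st)" unfolding propagate_def by (rule same_graph_funpow[OF assms])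
  show "closed n (propagate st)"
  proof (cases "meas (propagate st) + 3 * n \<le> meas st")
    \<comment> \<open>All of the at most \<open>3 * n\<close> colours are gone, and a state with
      only empty lists is closed.\<close>
    case True
    with meas_le[OF assms] have "meas (propagate st) = 0" by linarith
    then have "colours (propagate st) i = {}" if "i < n" for i
      using that by (simp add: meas_eq[OF s])
    then show ?thesis by (simp add: closed_def)
  next
    case False
    then show ?thesis using rnd_progress[OF assms, of "3 * n"] by (simp add: propagate_def len)
  qed
  have "coloured n ((rnd ^^ k) st) f" if "coloured n st f" for k
    using that by (induction k) (auto intro: coloured_rnd[OF shaped_propagate[OF assms]])
  then show "coloured n st f \<Longrightarrow> coloured n (propagate st) f" by (simp add: propagate_def)
qed

lemma wf_propagate: "wf_state n st \<Longrightarrow> wf_state n (propagate st)"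
  using same_graph_wf propagate(1,2) unfolding wf_state_def by blast

lemma wf_shaped: "wf_state n st \<Longrightarrow> shaped n st" by (simp add: wf_state_def)

section \<open>Assigning and excluding one colour\<close>

definition mask :: "nat \<Rightarrow> bool list" where
  "mask c = [c = 0, c = 1, c = 2]"

text \<open>A zipper: \<open>pre\<close> holds the entries already passed in reverse order, so the
  whole state is \<open>rev pre @ e # post\<close>. A pair is produced only if both alternatives
  keep a nonempty list at \<open>e\<close>; hence both are proper restrictions.\<close>

definition cand :: "state \<Rightarrow> bool list \<times> bool list \<Rightarrow> state \<Rightarrow> bool list \<Rightarrow> (state \<times> state) list" where
  "cand pre e post m = (if vany (vand (fst e) m) \<and> vany (vdiff (fst e) m)
     then [(rev pre @ (vand (fst e) m, snd e) # post, rev pre @ (vdiff (fst e) m, snd e) # post)] else [])"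

fun variants :: "state \<Rightarrow> state \<Rightarrow> (state \<times> state) list" where
  "variants pre [] = []"
| "variants pre (e # es) = cand pre e es (mask 0) @ cand pre e es (mask 1) @ cand pre e es (mask 2) @
     variants (e # pre) es"

definition assign :: "state \<Rightarrow> nat \<Rightarrow> nat \<Rightarrow> state" where
  "assign st i c = st[i := (vand (fst (st ! i)) (mask c), snd (st ! i))]"

definition exclude :: "state \<Rightarrow> nat \<Rightarrow> nat \<Rightarrow> state" where
  "exclude st i c = st[i := (vdiff (fst (st ! i)) (mask c), snd (st ! i))]"

definition open_choice :: "state \<Rightarrow> nat \<Rightarrow> nat \<Rightarrow> bool" where
  "open_choice st i c \<longleftrightarrow> vany (vand (fst (st ! i)) (mask c)) \<and> vany (vdiff (fst (st ! i)) (mask c))"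

lemma set_variants_aux:
  "set (variants pre es) = {(assign (rev pre @ es) i c, exclude (rev pre @ es) i c) |i c.
     length pre \<le> i \<and> i < length pre + length es \<and> c < 3 \<and> open_choice (rev pre @ es) i c}"
proof (induction pre es rule: variants.induct)
  case (2 pre e es)
  let ?s = "rev pre @ e # es"
  let ?P = "\<lambda>i. {(assign ?s i c, exclude ?s i c) |c. c < 3 \<and> open_choice ?s i c}"
  have e: "set (cand pre e es (mask 0)) \<union> set (cand pre e es (mask 1)) \<union> set (cand pre e es (mask 2)) =
     ?P (length pre)"
    unfolding less_3 by (auto simp: cand_def assign_def exclude_def open_choice_def nth_append list_update_append)
  have "set (variants pre (e # es)) = ?P (length pre) \<union> set (variants (e # pre) es)"
    using e by auto
  also have "\<dots> = {(assign ?s i c, exclude ?s i c) |i c.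
     length pre \<le> i \<and> i < length pre + length (e # es) \<and> c < 3 \<and> open_choice ?s i c}" (is "?l = ?r")
    unfolding 2
  proof (intro equalityI subsetI)
    fix x assume "x \<in> ?r"
    then obtain i c where x: "x = (assign ?s i c, exclude ?s i c)" "length pre \<le> i"
      "i < length pre + length (e # es)" "c < 3" "open_choice ?s i c" by blast
    show "x \<in> ?P (length pre) \<union> {(assign (rev (e # pre) @ es) i c, exclude (rev (e # pre) @ es) i c) |i c.
       length (e # pre) \<le> i \<and> i < length (e # pre) + length es \<and> c < 3 \<and> open_choice (rev (e # pre) @ es) i c}"
    proof (cases "i = length pre")
      case True then show ?thesis using x by auto
    next
      case False
      then have "length (e # pre) \<le> i" using x(2) by simp
      then show ?thesis using x by (intro UnI2 CollectI exI[of _ i] exI[of _ c]) simp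
    qed
  next
    fix x assume "x \<in> ?P (length pre) \<union> {(assign (rev (e # pre) @ es) i c, exclude (rev (e # pre) @ es) i c) |i c.
       length (e # pre) \<le> i \<and> i < length (e # pre) + length es \<and> c < 3 \<and> open_choice (rev (e # pre) @ es) i c}"
    then consider c where "x = (assign ?s (length pre) c, exclude ?s (length pre) c)" "c < 3"
        "open_choice ?s (length pre) c"
      | i c where "x = (assign ?s i c, exclude ?s i c)" "length pre < i"
        "i < length pre + length (e # es)" "c < 3" "open_choice ?s i c"
      by auto
    then show "x \<in> ?r"
    proof cases
      case (1 c) then show ?thesis by (intro CollectI exI[of _ "length pre"] exI[of _ c]) simp
    next
      case (2 i c) then show ?thesis by (intro CollectI exI[of _ i] exI[of _ c]) simp
    qed
  qed
  finally show ?case .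
qed simp

lemma length_3: 
  assumes "length l = 3" obtains x y z where "l = [x, y, z]"
proof -
  obtain x l1 where "l = x # l1" "length l1 = 2" using assms by (cases l) auto
  moreover then obtain y l2 where "l1 = y # l2" "length l2 = 1" by (cases l1) auto
  moreover then obtain z where "l2 = [z]" by (cases l2) auto
  ultimately show ?thesis using that[of x y z] by simp
qed

lemma less_3_cases:
  assumes "(c::nat) < 3" obtains "c = 0" | "c = 1" | "c = 2"
  using less_3[THEN iffD1, OF assms] by blast

lemma vand_mask_nth: 
  assumes "length l = 3" "c < 3" "x < 3" shows "vand l (mask c) ! x \<longleftrightarrow> l ! x \<and> x = c"
  by (rule length_3[OF assms(1)], rule less_3_cases[OF assms(2)]; rule less_3_cases[OF assms(3)])
    (simp_all add: vand_def mask_def)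

lemma vdiff_mask_nth:
  assumes "length l = 3" "c < 3" "x < 3" shows "vdiff l (mask c) ! x \<longleftrightarrow> l ! x \<and> x \<noteq> c"
  by (rule length_3[OF assms(1)], rule less_3_cases[OF assms(2)]; rule less_3_cases[OF assms(3)])
    (simp_all add: vdiff_def mask_def)

lemma vany_vand_mask:
  assumes "length l = 3" "c < 3" shows "vany (vand l (mask c)) \<longleftrightarrow> l ! c"
  by (rule length_3[OF assms(1)]; rule less_3_cases[OF assms(2)])
    (simp_all add: vand_def mask_def vany_def)

lemma vany_vdiff_mask: 
  assumes "length l = 3" "c < 3" shows "vany (vdiff l (mask c)) \<longleftrightarrow> (\<exists>x<3. x \<noteq> c \<and> l ! x)"
  unfolding ex_less_3
  by (rule length_3[OF assms(1)]; rule less_3_cases[OF assms(2)])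
    (simp_all add: vdiff_def mask_def vany_def)

lemma open_choice: 
  assumes "shaped n st" "i < n" "c < 3"
  shows "open_choice st i c \<longleftrightarrow> c \<in> colours st i \<and> colours st i \<noteq> {c}"
proof -
  have l: "length (fst (st ! i)) = 3" using shaped_nth[OF assms(1,2)] by simp
  have "open_choice st i c \<longleftrightarrow> c \<in> colours st i \<and> (\<exists>x. x \<noteq> c \<and> x \<in> colours st i)"
    unfolding open_choice_def vany_vand_mask[OF l assms(3)] vany_vdiff_mask[OF l assms(3)] colours_def
    using assms(3) by auto
  then show ?thesis by blast
qed

lemma set_variants:
  assumes "shaped n st"
  shows "set (variants [] st) =
    {(assign st i c, exclude st i c) |i c. i < n \<and> c \<in> colours st i \<and> colours st i \<noteq> {c}}"
proof -
  have "set (variants [] st) = {(assign st i c, exclude st i c) |i c. i < n \<and> c < 3 \<and> open_choice st i c}"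
    using set_variants_aux[of "[]" st] shaped_length[OF assms] by simp
  moreover have "i < n \<and> c < 3 \<and> open_choice st i c \<longleftrightarrow> i < n \<and> c \<in> colours st i \<and> colours st i \<noteq> {c}" for i c
    using open_choice[OF assms] colours_less by metis
  ultimately show ?thesis by simp
qed

lemma assign:
  assumes "shaped n st" "i < n" "c < 3"
  shows "shaped n (assign st i c)"
    "\<And>j. colours (assign st i c) j = (if j = i then colours st i \<inter> {c} else colours st j)"
    "\<And>j k. adj (assign st i c) j k = adj st j k"
    "same_graph n st (assign st i c)"
proof -
  have len: "length st = n" using assms by (simp add: shaped_length)
  show "shaped n (assign st i c)"
    by (rule shapedI) (use shaped_nth[OF assms(1)] assms len in
      \<open>auto simp: assign_def nth_list_update vand_def mask_def\<close>)
  show c: "colours (assign st i c) j = (if j = i then colours st i \<inter> {c} else colours st j)" for j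
  proof (cases "j = i")
    case True
    have "vand (fst (st ! i)) (mask c) ! x \<longleftrightarrow> fst (st ! i) ! x \<and> x = c" if "x < 3" for x
      using vand_mask_nth shaped_nth[OF assms(1,2)] assms(3) that by blast
    then show ?thesis using True assms(2) len by (auto simp: colours_def assign_def)
  qed (simp add: colours_def assign_def)
  show a: "adj (assign st i c) j k = adj st j k" for j k
    using assms len by (cases "j = i") (auto simp: adj_def assign_def)
  show "same_graph n st (assign st i c)"
    unfolding same_graph_def by (auto simp: a c)
qed

lemma exclude:
  assumes "shaped n st" "i < n" "c < 3"
  shows "shaped n (exclude st i c)"
    "\<And>j. colours (exclude st i c) j = (if j = i then colours st i - {c} else colours st j)"
    "\<And>j k. adj (exclude st i c) j k = adj st j k"
    "same_graph n st (exclude st i c)"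
proof -
  have len: "length st = n" using assms by (simp add: shaped_length)
  show "shaped n (exclude st i c)"
    by (rule shapedI) (use shaped_nth[OF assms(1)] assms len in
      \<open>auto simp: exclude_def nth_list_update vdiff_def mask_def\<close>)
  show c: "colours (exclude st i c) j = (if j = i then colours st i - {c} else colours st j)" for j
  proof (cases "j = i")
    case True
    have "vdiff (fst (st ! i)) (mask c) ! x \<longleftrightarrow> fst (st ! i) ! x \<and> x \<noteq> c" if "x < 3" for x
      using vdiff_mask_nth shaped_nth[OF assms(1,2)] assms(3) that by blast
    then show ?thesis using True assms(2) len by (auto simp: colours_def exclude_def)
  qed (simp add: colours_def exclude_def)
  show a: "adj (exclude st i c) j k = adj st j k" for j k
    using assms len by (cases "j = i") (auto simp: adj_def exclude_def)
  show "same_graph n st (exclude st i c)"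
    unfolding same_graph_def by (auto simp: a c)
qed

section \<open>The algorithm\<close>

definition ok :: "state \<Rightarrow> bool" where
  "ok st \<longleftrightarrow> (\<forall>e \<in> set st. vany (fst e))"

text \<open>The 2-SAT stage: the first assignment whose propagation empties no list is kept for
  good, without backtracking. \<open>autark\<close> justifies this for lists of at most two
  colours.\<close>

fun fin :: "nat \<Rightarrow> state \<Rightarrow> bool" where
  "fin 0 st = False"
| "fin (Suc k) st = (case find (\<lambda>q. ok (propagate (fst q))) (variants [] st) of
      Some q \<Rightarrow> fin k (propagate (fst q))
    | None \<Rightarrow> variants [] st = [] \<and> ok st)"

definition heavy :: "nat \<Rightarrow> state \<Rightarrow> state option" where
  "heavy d st = map_option snd
     (find (\<lambda>q. meas (propagate (fst q)) + d \<le> meas st) (variants [] st))"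

text \<open>Counts the vertices that lose a colour when the vertices with rows \<open>r\<close> and
  \<open>r'\<close> get different colours: each common neighbour with a full list is then forced to
  the third colour, which its own neighbours lose.\<close>

definition touched :: "state \<Rightarrow> bool list \<Rightarrow> bool list \<Rightarrow> nat" where
  "touched st r r' = length (filter (\<lambda>e. full (fst e) \<and>
     vany (vand (snd e) (vand (vand r r') (map (\<lambda>e. full (fst e)) st)))) st)"

definition similar :: "nat \<Rightarrow> state \<Rightarrow> nat \<Rightarrow> nat \<Rightarrow> bool" where
  "similar d st i j \<longleftrightarrow> full (fst (st ! i)) \<and> full (fst (st ! j)) \<and> i \<noteq> j \<and> \<not> adj st i j \<and>
     d \<le> touched st (snd (st ! i)) (snd (st ! j))"

definition unit :: "nat \<Rightarrow> nat \<Rightarrow> bool list" where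
  "unit n i = map (\<lambda>k. k = i) [0..<n]"

text \<open>Vertex \<open>j\<close> is contracted into \<open>i\<close>. It stays as an isolated vertex with a list of length one, so
  that the number of vertices does not change.\<close>

definition merge :: "state \<Rightarrow> nat \<Rightarrow> nat \<Rightarrow> state" where
  "merge st i j = map (\<lambda>w.
     if w = j then (mask 0, replicate (length st) False)
     else if w = i then (fst (st ! i), vor (snd (st ! i)) (snd (st ! j)))
     else (fst (st ! w), if snd (st ! w) ! j
       then vdiff (vor (snd (st ! w)) (unit (length st) i)) (unit (length st) j)
       else snd (st ! w))) [0..<length st]"

definition dflt :: "nat \<Rightarrow> state \<Rightarrow> state option" where
  "dflt d st = (case heavy d st of Some s \<Rightarrow> Some s
     | None \<Rightarrow> map_option (\<lambda>p. merge st (fst p) (snd p))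
         (find (\<lambda>p. similar d st (fst p) (snd p)) (List.product [0..<length st] [0..<length st])))"

text \<open>\<open>F\<close> bounds the depth of the recursion, \<open>k\<close> is the number of guesses that are left.\<close>

fun solve :: "nat \<Rightarrow> nat \<Rightarrow> nat \<Rightarrow> state \<Rightarrow> bool" where
  "solve d 0 k st = False"
| "solve d (Suc F) k st =
     (fin (Suc (meas (propagate st))) (propagate st) \<or>
      k > 0 \<and> (\<exists>q \<in> set (variants [] (propagate st)). solve d F (k - 1) (fst q)) \<or>
      (case dflt d (propagate st) of None \<Rightarrow> False | Some s \<Rightarrow> solve d F k s))"

section \<open>Correctness of the two-colour stage\<close>

lemma ok_iff: "shaped n st \<Longrightarrow> ok st \<longleftrightarrow> (\<forall>i<n. colours st i \<noteq> {})"
proof -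
  assume s: "shaped n st"
  have "vany (fst (st ! i)) \<longleftrightarrow> colours st i \<noteq> {}" if "i < n" for i
    using shaped_nth[OF s that] unfolding vany_def in_set_conv_nth colours_def by auto
  then show ?thesis
    unfolding ok_def all_set_conv_all_nth shaped_length[OF s] by blast
qed

lemma full_iff: "full (fst (st ! i)) \<longleftrightarrow> colours st i = {..<3}"
proof -
  have "colours st i = {..<3} \<longleftrightarrow> (\<forall>c<3. fst (st ! i) ! c)" by (auto simp: colours_def)
  also have "\<dots> \<longleftrightarrow> full (fst (st ! i))"
    using ex_less_3[of "\<lambda>c. \<not> fst (st ! i) ! c"] unfolding full_def by blast
  finally show ?thesis by simp
qed

lemma closedD:
  "closed n st \<Longrightarrow> i < n \<Longrightarrow> j < n \<Longrightarrow> adj st i j \<Longrightarrow> colours st j \<subseteq> {c} \<Longrightarrow> c \<notin> colours st i"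
  by (simp add: closed_def)

definition Full :: "nat \<Rightarrow> state \<Rightarrow> nat set" where
  "Full n st = {i. i < n \<and> colours st i = {..<3}}"

lemma variant_assign:
  assumes "shaped n st" "q \<in> set (variants [] st)"
  obtains i c where "i < n" "c \<in> colours st i" "colours st i \<noteq> {c}" "q = (assign st i c, exclude st i c)"
  using assms(2) unfolding set_variants[OF assms(1)] by blast

lemma variant_state:
  assumes wf_state: "wf_state n st" and q: "q \<in> set (variants [] st)"
  shows "wf_state n (fst q)" "same_graph n st (fst q)" "wf_state n (snd q)" "same_graph n st (snd q)"
    "wf_state n (propagate (fst q))" "same_graph n st (propagate (fst q))" "closed n (propagate (fst q))"
    "meas (propagate (fst q)) < meas st" "meas (snd q) < meas st"
proof -
  have s: "shaped n st" using wf_state by (rule wf_shaped)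
  obtain i c where i: "i < n" "c \<in> colours st i" "colours st i \<noteq> {c}"
    and q: "q = (assign st i c, exclude st i c)" using variant_assign[OF s q] .
  have c: "c < 3" using i colours_less by blast
  note A = assign[OF s i(1) c] and E = exclude[OF s i(1) c]
  show g: "same_graph n st (fst q)" "same_graph n st (snd q)" using A(4) E(4) q by auto
  show w: "wf_state n (fst q)" "wf_state n (snd q)"
    using same_graph_wf[OF wf_state A(1,4)] same_graph_wf[OF wf_state E(1,4)] q by auto
  show "wf_state n (propagate (fst q))" by (rule wf_propagate[OF w(1)])
  show "same_graph n st (propagate (fst q))"
    by (rule same_graph_trans[OF g(1) propagate(2)[OF wf_shaped[OF w(1)]]])
  show "closed n (propagate (fst q))" by (rule propagate(3)[OF wf_shaped[OF w(1)]])
  have "colours (fst q) i \<noteq> colours st i" using A(2)[of i] i q by auto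
  then have "meas (fst q) < meas st"
    using same_graph_meas_less[OF s wf_shaped[OF w(1)] g(1) i(1)] by blast
  then show "meas (propagate (fst q)) < meas st"
    using same_graph_meas[OF wf_shaped[OF w(1)] propagate(1)[OF wf_shaped[OF w(1)]] propagate(2)[OF wf_shaped[OF w(1)]]]
    by linarith
  have "colours (snd q) i \<noteq> colours st i" using E(2)[of i] i q by auto
  then show "meas (snd q) < meas st"
    using same_graph_meas_less[OF s wf_shaped[OF w(2)] g(2) i(1)] by blast
qed

text \<open>Once all lists have at most two colours, a consistent propagation is autark: the vertices
  that it does not touch keep their lists.\<close>

lemma autark:
  assumes wf_state: "wf_state n st" "wf_state n st'" and g: "same_graph n st st'" and closed: "closed n st'"
    and two: "\<And>i. i < n \<Longrightarrow> card (colours st i) \<le> 2"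
    and f: "coloured n st f" and "ok st'"
  shows "\<exists>f'. coloured n st' f'"
proof -
  have ne: "colours st' i \<noteq> {}" if "i < n" for i
    using \<open>ok st'\<close> ok_iff[OF wf_shaped[OF wf_state(2)]] that by blast
  \<comment> \<open>A list that changed went from at most two colours to exactly one, so the choice
    there is forced; \<open>closed\<close> keeps that colour out of the lists of untouched
    neighbours, where \<open>f\<close> is retained.\<close>
  define f' where "f' i = (if colours st' i = colours st i then f i else SOME c. c \<in> colours st' i)" for i
  have mem: "f' i \<in> colours st' i" if "i < n" for i
    using f ne[OF that] that some_in_eq[of "colours st' i"] unfolding f'_def coloured_def by simp
  have single: "colours st' i = {f' i}" if "i < n" "colours st' i \<noteq> colours st i" for i
  proof -
    have "colours st' i \<subset> colours st i" using g that unfolding same_graph_def by blast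
    then have "card (colours st' i) < card (colours st i)" by (intro psubset_card_mono) auto
    with two[OF that(1)] have "card (colours st' i) \<le> 1" by linarith
    moreover have "card (colours st' i) \<noteq> 0" using ne[OF that(1)] by simp
    ultimately have "card (colours st' i) = 1" by linarith
    then show ?thesis using mem[OF that(1)] by (metis card_1_singletonE singletonD)
  qed
  have sym: "adj st' j i" if "adj st' i j" "i < n" "j < n" for i j
    using wf_state(2) that unfolding wf_state_def by blast
  have "f' i \<noteq> f' j" if "i < n" "j < n" "adj st' i j" for i j
  proof (cases "colours st' i = colours st i")
    case True
    show ?thesis
    proof (cases "colours st' j = colours st j")
      case True': True
      then show ?thesis using True that f g unfolding f'_def coloured_def same_graph_def by auto
    next
      case False
      then have "f' j \<notin> colours st' i"
        using closedD[OF closed that] single[OF that(2)] by simp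
      then show ?thesis using mem[OF that(1)] by auto
    qed
  next
    case False
    then have "f' i \<notin> colours st' j"
      using closedD[OF closed that(2,1) sym[OF that(3,1,2)]] single[OF that(1)] False by simp
    then show ?thesis using mem[OF that(2)] by auto
  qed
  with mem show ?thesis unfolding coloured_def by blast
qed

lemma fin_sound:
  assumes "wf_state n st" "closed n st" "fin k st"
  shows "\<exists>f. coloured n st f"
  using assms
proof (induction k arbitrary: st)
  case (Suc k)
  show ?case
  proof (cases "find (\<lambda>q. ok (propagate (fst q))) (variants [] st)")
    case (Some q)
    then have q: "q \<in> set (variants [] st)" by (metis find_Some_iff nth_mem)
    note V = variant_state[OF Suc.prems(1) q]
    have "fin k (propagate (fst q))" using Suc.prems(3) Some by simp
    then show ?thesis using Suc.IH[OF V(5,7)] same_graph_coloured[OF V(6)] by blast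
  next
    case None
    have s: "shaped n st" using Suc.prems wf_shaped by blast
    have v: "variants [] st = []" "ok st" using Suc.prems(3) None by auto
    have "\<exists>c. colours st i = {c}" if "i < n" for i
    proof -
      obtain c where "c \<in> colours st i" using v(2) ok_iff[OF s] \<open>i < n\<close> by blast
      moreover have "set (variants [] st) = {}" using v(1) by simp
      ultimately show ?thesis unfolding set_variants[OF s] using \<open>i < n\<close> by blast
    qed
    then obtain f where f: "\<And>i. i < n \<Longrightarrow> colours st i = {f i}" by metis
    have "f i \<noteq> f j" if "i < n" "j < n" "adj st i j" for i j
      using closedD[OF Suc.prems(2) that, of "f j"] f[OF that(1)] f[OF that(2)] by simp
    then show ?thesis using f unfolding coloured_def by blast
  qed
qed simp

lemma coloured_assign:
  assumes "shaped n st" "coloured n st f" "i < n"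
  shows "coloured n (assign st i (f i)) f"
proof -
  have fi: "f i \<in> colours st i" using assms by (simp add: coloured_def)
  note A = assign[OF assms(1,3) colours_less[OF fi]]
  show ?thesis using assms(2) fi unfolding coloured_def A(2,3) by auto
qed

lemma coloured_exclude:
  assumes "shaped n st" "coloured n st f" "i < n" "c < 3" "f i \<noteq> c"
  shows "coloured n (exclude st i c) f"
  using assms(2,5) unfolding coloured_def exclude(2,3)[OF assms(1,3,4)] by auto

text \<open>\<open>autark\<close> supplies a new colouring after each commitment, so
  \<open>f\<close> varies in the induction. As long as a choice is open, the assignment read off
  from \<open>f\<close> passes the test, so \<open>find\<close> cannot fail.\<close>

lemma fin_complete:
  assumes "wf_state n st" "coloured n st f" "\<And>i. i < n \<Longrightarrow> card (colours st i) \<le> 2" "meas st < k"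
  shows "fin k st"
  using assms
proof (induction k arbitrary: st f)
  case (Suc k)
  have s: "shaped n st" using Suc.prems wf_shaped by blast
  show ?case
  proof (cases "find (\<lambda>q. ok (propagate (fst q))) (variants [] st)")
    case (Some q)
    then have q: "q \<in> set (variants [] st)" "ok (propagate (fst q))"
      by (metis find_Some_iff nth_mem)+
    note V = variant_state[OF Suc.prems(1) q(1)]
    obtain f' where "coloured n (propagate (fst q)) f'"
      using autark[OF Suc.prems(1) V(5,6,7) Suc.prems(3,2) q(2)] by blast
    moreover have "card (colours (propagate (fst q)) i) \<le> 2" if "i < n" for i
    proof -
      have "colours (propagate (fst q)) i \<subseteq> colours st i" using V(6) that unfolding same_graph_def by blast
      then show ?thesis using Suc.prems(3)[OF that] card_mono[OF finite_colours] by (meson le_trans)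
    qed
    moreover have "meas (propagate (fst q)) < k" using V(8) Suc.prems(4) by linarith
    ultimately have "fin k (propagate (fst q))" using Suc.IH[OF V(5)] by blast
    then show ?thesis using Some by simp
  next
    case None
    then have none: "\<not> ok (propagate (fst q))" if "q \<in> set (variants [] st)" for q
      using that unfolding find_None_iff by blast
    have f: "f i \<in> colours st i" if "i < n" for i using Suc.prems(2) that by (simp add: coloured_def)
    have "q \<notin> set (variants [] st)" for q
    proof
      assume "q \<in> set (variants [] st)"
      then obtain i c where i: "i < n" "c \<in> colours st i" "colours st i \<noteq> {c}"
        using variant_assign[OF s] by metis
      then have "colours st i \<noteq> {f i}" by auto
      then have "(assign st i (f i), exclude st i (f i)) \<in> set (variants [] st)"
        unfolding set_variants[OF s] using f[OF i(1)] i(1) by blast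
      then have n: "\<not> ok (propagate (assign st i (f i)))" using none by fastforce
      have "shaped n (assign st i (f i))"
        by (rule assign(1)[OF s i(1) colours_less[OF f[OF i(1)]]])
      then have "shaped n (propagate (assign st i (f i)))" "coloured n (propagate (assign st i (f i))) f"
        using propagate(1,4) coloured_assign[OF s Suc.prems(2) i(1)] by blast+
      then show False using n ok_iff unfolding coloured_def by blast
    qed
    then have "variants [] st = []" by (metis list.set_intros(1) neq_Nil_conv)
    moreover have "ok st" using f ok_iff[OF s] by blast
    ultimately show ?thesis using None by simp
  qed
qed simp

section \<open>Contracting two vertices\<close>

lemma unit_nth [simp]: "k < n \<Longrightarrow> unit n i ! k \<longleftrightarrow> k = i"
  by (simp add: unit_def)

lemma length_unit [simp]: "length (unit n i) = n"
  by (simp add: unit_def)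

locale merging =
  fixes n :: nat and st :: state and i j :: nat
  assumes wf_state: "wf_state n st" and ij: "i < n" "j < n" "i \<noteq> j" "\<not> adj st i j"
    and full: "colours st i = {..<3}" "colours st j = {..<3}"
begin

lemma s: "shaped n st" using wf_state by (rule wf_shaped)

lemma sym: "u < n \<Longrightarrow> w < n \<Longrightarrow> adj st u w \<Longrightarrow> adj st w u"
  using wf_state unfolding wf_state_def by blast

lemma irrefl: "u < n \<Longrightarrow> \<not> adj st u u"
  using wf_state unfolding wf_state_def by blast

lemma shaped_merge: "shaped n (merge st i j)"
  by (rule shapedI)
    (simp_all add: shaped_nth[OF s] shaped_length[OF s] ij(1,2) merge_def mask_def vor_def vdiff_def)

lemma colours_merge: "u < n \<Longrightarrow> colours (merge st i j) u = (if u = j then {0} else colours st u)"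
proof -
  assume u: "u < n"
  have "mask 0 ! c \<longleftrightarrow> c = 0" if "c < 3" for c
    by (rule less_3_cases[OF that]) (simp_all add: mask_def)
  then show ?thesis using u ij shaped_length[OF s] by (auto simp: merge_def colours_def)
qed

lemma adj_merge:
  assumes "u < n" "w < n"
  shows "adj (merge st i j) u w \<longleftrightarrow> u \<noteq> j \<and> w \<noteq> j \<and>
    (if u = i then adj st i w \<or> adj st j w else if w = i then adj st u i \<or> adj st u j else adj st u w)"
proof -
  have len: "length st = n" "\<And>u. u < n \<Longrightarrow> length (snd (st ! u)) = n"
    using shaped_length[OF s] shaped_nth[OF s] by auto
  consider "u = j" | "u = i" | "u \<noteq> i" "u \<noteq> j" by blast
  then show ?thesis
  proof cases
    case 1 then show ?thesis using assms len by (simp add: merge_def adj_def)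
  next
    case 2 then show ?thesis using assms len ij irrefl[OF ij(2)]
      by (auto simp: merge_def adj_def vor_def)
  next
    case 3 then show ?thesis using assms len ij
      by (auto simp: merge_def adj_def vor_def vdiff_def)
  qed
qed

lemma wf_merge: "wf_state n (merge st i j)"
  unfolding wf_state_def
proof (intro conjI allI impI shaped_merge)
  fix u assume u: "u < n"
  then show "\<not> adj (merge st i j) u u"
    using irrefl[OF u] sym[of j i] ij by (auto simp: adj_merge)
  fix w assume w: "w < n" and "adj (merge st i j) u w"
  then show "adj (merge st i j) w u"
    using sym[OF u w] sym[OF ij(1) w] sym[OF ij(2) w] sym[OF u ij(1)] sym[OF u ij(2)]
    by (auto simp: adj_merge[OF u w] adj_merge[OF w u] split: if_splits)
qed

lemma coloured_unmerge:
  assumes "coloured n (merge st i j) f" shows "coloured n st (f(j := f i))"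
proof -
  let ?f = "f(j := f i)"
  have f: "f u \<in> colours (merge st i j) u" if "u < n" for u
    using assms that by (simp add: coloured_def)
  have p: "f u \<noteq> f w" if "u < n" "w < n" "adj (merge st i j) u w" for u w
    using assms that by (simp add: coloured_def)
  have "f i < 3" using f[OF ij(1)] colours_less by blast
  then have "?f u \<in> colours st u" if "u < n" for u
    using f[OF that] that full ij by (auto simp: colours_merge split: if_splits)
  moreover have "?f u \<noteq> ?f w" if u: "u < n" and w: "w < n" and a: "adj st u w" for u w
  proof -
    \<comment> \<open>\<open>r\<close> is the contraction map. It sends edges to edges because
      \<open>i\<close> and \<open>j\<close> are not adjacent.\<close>
    define r where "r x = (if x = j then i else x)" for x
    have r: "?f u = f (r u)" "?f w = f (r w)" "r u < n" "r w < n" using u w ij by (auto simp: r_def)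
    have "adj (merge st i j) (r u) (r w)"
      unfolding adj_merge[OF r(3,4)]
      using a ij irrefl[OF u] sym[OF u w] by (auto simp: r_def)
    then show ?thesis using p[OF r(3,4)] r by simp
  qed
  ultimately show ?thesis unfolding coloured_def by blast
qed

lemma coloured_merge:
  assumes "coloured n st f" "f i = f j" shows "coloured n (merge st i j) (f(j := 0))"
proof -
  have f: "f u \<in> colours st u" if "u < n" for u
    using assms that by (simp add: coloured_def)
  have p: "f u \<noteq> f w" if "u < n" "w < n" "adj st u w" for u w
    using assms that by (simp add: coloured_def)
  have "(f(j := 0)) u \<in> colours (merge st i j) u" if "u < n" for u
    using f[OF that] colours_merge[OF that] by auto
  moreover have "(f(j := 0)) u \<noteq> (f(j := 0)) w"
    if "u < n" "w < n" "adj (merge st i j) u w" for u w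
    using that(3) p[OF that(1,2)] p[OF ij(1) that(2)] p[OF ij(2) that(2)] p[OF that(1) ij(1)] p[OF that(1) ij(2)]
      assms(2) unfolding adj_merge[OF that(1,2)] by (auto split: if_splits)
  ultimately show ?thesis unfolding coloured_def by blast
qed

lemma meas_merge: "meas (merge st i j) < meas st"
  unfolding meas_eq[OF s] meas_eq[OF shaped_merge]
proof (rule sum_strict_mono_ex1)
  show "\<forall>u\<in>{..<n}. card (colours (merge st i j) u) \<le> card (colours st u)"
    using full by (simp add: colours_merge)
  show "\<exists>u\<in>{..<n}. card (colours (merge st i j) u) < card (colours st u)"
    using full ij by (intro bexI[of _ j]) (simp_all add: colours_merge)
qed simp

lemma Full_merge: "Full n (merge st i j) = Full n st - {j}"
proof -
  have "1 \<in> {..<3::nat}" "1 \<notin> {0::nat}" by simp_all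
  then have "{0} \<noteq> {..<3::nat}" by blast
  then have "u \<in> Full n (merge st i j) \<longleftrightarrow> u \<in> Full n st - {j}" for u
    unfolding Full_def by (cases "u < n"; cases "u = j") (simp_all add: colours_merge)
  then show ?thesis by blast
qed

end

text \<open>Distance at most three between vertices with full lists, by paths through arbitrary
  vertices; the equalities admit shorter paths. The diameter itself is destroyed when contraction
  isolates \<open>j\<close>, but then \<open>j\<close> has also left \<open>Full\<close>.\<close>

definition near :: "nat \<Rightarrow> state \<Rightarrow> bool" where
  "near n st \<longleftrightarrow> (\<forall>x \<in> Full n st. \<forall>z \<in> Full n st. \<exists>a<n. \<exists>b<n.
     (x = a \<or> adj st x a) \<and> (a = b \<or> adj st a b) \<and> (b = z \<or> adj st b z))"

definition Nb :: "nat \<Rightarrow> state \<Rightarrow> nat \<Rightarrow> nat set" where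
  "Nb n st x = {y \<in> Full n st. adj st x y}"

definition full_arcs :: "nat \<Rightarrow> state \<Rightarrow> (nat \<times> nat) set" where
  "full_arcs n st = (SIGMA x:Full n st. Nb n st x)"

lemma finite_Full [simp]: "finite (Full n st)"
  by (simp add: Full_def)

lemma finite_Nb [simp]: "finite (Nb n st x)"
  by (simp add: Nb_def)

lemma finite_arcs [simp]: "finite (full_arcs n st)"
  by (simp add: full_arcs_def)

lemma Full_less: "x \<in> Full n st \<Longrightarrow> x < n"
  by (simp add: Full_def)

lemma same_graph_Full:
  assumes "same_graph n st st'" shows "Full n st' \<subseteq> Full n st"
proof
  fix x assume "x \<in> Full n st'"
  then have "x < n" "colours st' x = {..<3}" by (auto simp: Full_def)
  moreover then have "colours st' x \<subseteq> colours st x" using assms unfolding same_graph_def by blast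
  ultimately show "x \<in> Full n st" using colours_sub[of st x] by (auto simp: Full_def)
qed

lemma same_graph_near:
  assumes g: "same_graph n st st'" and near: "near n st" shows "near n st'"
  unfolding near_def
proof (intro ballI)
  fix x z assume "x \<in> Full n st'" "z \<in> Full n st'"
  then have xz: "x \<in> Full n st" "z \<in> Full n st" "x < n" "z < n"
    using same_graph_Full[OF g] by (auto simp: Full_less)
  then obtain a b where "a < n" "b < n" "x = a \<or> adj st x a" "a = b \<or> adj st a b" "b = z \<or> adj st b z"
    using near unfolding near_def by blast
  then show "\<exists>a<n. \<exists>b<n. (x = a \<or> adj st' x a) \<and> (a = b \<or> adj st' a b) \<and> (b = z \<or> adj st' b z)"
    using g xz by (intro exI[of _ a] conjI exI[of _ b]) (simp_all add: same_graph_def)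
qed

lemma same_graph_Nb:
  assumes "same_graph n st st'" "x < n" shows "Nb n st' x \<subseteq> Nb n st x"
  using same_graph_Full[OF assms(1)] assms by (auto simp: Nb_def same_graph_def Full_less)

lemma same_graph_arcs: "same_graph n st st' \<Longrightarrow> full_arcs n st' \<subseteq> full_arcs n st"
  unfolding full_arcs_def using same_graph_Full same_graph_Nb Full_less by blast

text \<open>The contraction map sends walks to walks; steps that collapse become equalities in
  \<open>near\<close>.\<close>

lemma (in merging) near_merge:
  assumes "near n st" shows "near n (merge st i j)"
  unfolding near_def
proof (intro ballI)
  fix x z assume x: "x \<in> Full n (merge st i j)" and z: "z \<in> Full n (merge st i j)"
  then have xz: "x \<in> Full n st" "z \<in> Full n st" "x \<noteq> j" "z \<noteq> j" unfolding Full_merge by auto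
  define r where "r v = (if v = j then i else v)" for v
  have r: "r v < n" if "v < n" for v using that ij by (simp add: r_def)
  have step: "r u = r w \<or> adj (merge st i j) (r u) (r w)"
    if "u < n" "w < n" "u = w \<or> adj st u w" for u w
    using that ij sym[of u w] unfolding adj_merge[OF r[OF that(1)] r[OF that(2)]]
    by (auto simp: r_def)
  obtain a b where ab: "a < n" "b < n" "x = a \<or> adj st x a" "a = b \<or> adj st a b" "b = z \<or> adj st b z"
    using assms xz unfolding near_def by blast
  have "r x = x" "r z = z" using xz by (auto simp: r_def)
  then show "\<exists>a<n. \<exists>b<n. (x = a \<or> adj (merge st i j) x a) \<and> (a = b \<or> adj (merge st i j) a b) \<and>
      (b = z \<or> adj (merge st i j) b z)"
    using step[OF _ ab(1) ab(3)] step[OF ab(1,2,4)] step[OF ab(2) _ ab(5)] Full_less[OF xz(1)] Full_less[OF xz(2)]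
    by (intro exI[of _ "r a"] conjI exI[of _ "r b"] r ab) simp_all
qed

text \<open>Every arc of the contracted graph is the image of an old one, so the edge term of the
  potential does not grow.\<close>

lemma (in merging) card_arcs_merge: "card (full_arcs n (merge st i j)) \<le> card (full_arcs n st)"
proof -
  define r where "r v = (if v = j then i else v)" for v
  have iF: "i \<in> Full n st" "j \<in> Full n st" using ij full by (auto simp: Full_def)
  have "full_arcs n (merge st i j) \<subseteq> (\<lambda>p. (r (fst p), r (snd p))) ` full_arcs n st"
  proof
    fix p assume "p \<in> full_arcs n (merge st i j)"
    then obtain x y where p: "p = (x, y)" "x \<in> Full n st" "x \<noteq> j" "y \<in> Full n st" "y \<noteq> j"
      "adj (merge st i j) x y"
      unfolding full_arcs_def Nb_def Full_merge by auto
    have "\<exists>x' y'. (x', y') \<in> full_arcs n st \<and> r x' = x \<and> r y' = y"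
    proof -
      have A: "(x', y') \<in> full_arcs n st \<longleftrightarrow> x' \<in> Full n st \<and> y' \<in> Full n st \<and> adj st x' y'" for x' y'
        by (auto simp: full_arcs_def Nb_def)
      have a: "if x = i then adj st i y \<or> adj st j y else if y = i then adj st x i \<or> adj st x j else adj st x y"
        using p(6) adj_merge Full_less[OF p(2)] Full_less[OF p(4)] by blast
      consider "adj st x y" | "x = i" "adj st j y" | "y = i" "adj st x j" using a by (auto split: if_splits)
      then show ?thesis
      proof cases
        case 1 then show ?thesis using p A by (intro exI[of _ x] exI[of _ y]) (simp add: r_def)
      next
        case 2 then show ?thesis using p A iF by (intro exI[of _ j] exI[of _ y]) (simp add: r_def)
      next
        case 3 then show ?thesis using p A iF by (intro exI[of _ x] exI[of _ j]) (simp add: r_def)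
      qed
    qed
    then obtain x' y' where "(x', y') \<in> full_arcs n st" "r x' = x" "r y' = y" by blast
    then show "p \<in> (\<lambda>p. (r (fst p), r (snd p))) ` full_arcs n st"
      using p(1) by (intro image_eqI[of _ _ "(x', y')"]) simp_all
  qed
  then have "card (full_arcs n (merge st i j)) \<le> card ((\<lambda>p. (r (fst p), r (snd p))) ` full_arcs n st)"
    by (rule card_mono[rotated]) simp
  also have "\<dots> \<le> card (full_arcs n st)" by (rule card_image_le) simp
  finally show ?thesis .
qed

lemma vany_vand: "length a = m \<Longrightarrow> length b = m \<Longrightarrow> vany (vand a b) \<longleftrightarrow> (\<exists>k<m. a ! k \<and> b ! k)"
  unfolding vany_def vand_def in_set_conv_nth by auto

lemma touched_eq:
  assumes "wf_state n st" "i < n" "j < n"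
  shows "touched st (snd (st ! i)) (snd (st ! j)) = card (\<Union>u\<in>Nb n st i \<inter> Nb n st j. Nb n st u)"
proof -
  have s: "shaped n st" by (rule wf_shaped[OF assms(1)])
  note len = shaped_length[OF s]
  let ?m = "vand (vand (snd (st ! i)) (snd (st ! j))) (map (\<lambda>e. full (fst e)) st)"
  have m: "length ?m = n" using shaped_nth[OF s assms(2)] shaped_nth[OF s assms(3)] len
    by (simp add: vand_def)
  have mk: "?m ! u \<longleftrightarrow> u \<in> Nb n st i \<inter> Nb n st j" if "u < n" for u
    using that shaped_nth[OF s assms(2)] shaped_nth[OF s assms(3)] len
    by (simp add: vand_def Nb_def Full_def full_iff adj_def conj_ac)
  have "touched st (snd (st ! i)) (snd (st ! j)) =
      card {z. z < n \<and> full (fst (st ! z)) \<and> vany (vand (snd (st ! z)) ?m)}"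
    unfolding touched_def length_filter_conv_card len ..
  also have "{z. z < n \<and> full (fst (st ! z)) \<and> vany (vand (snd (st ! z)) ?m)} =
     (\<Union>u\<in>Nb n st i \<inter> Nb n st j. Nb n st u)"
  proof -
    have "z < n \<and> full (fst (st ! z)) \<and> vany (vand (snd (st ! z)) ?m) \<longleftrightarrow>
       (\<exists>u\<in>Nb n st i \<inter> Nb n st j. z \<in> Nb n st u)" for z
    proof (cases "z < n")
      case True
      have "vany (vand (snd (st ! z)) ?m) \<longleftrightarrow> (\<exists>u<n. adj st z u \<and> ?m ! u)"
        using vany_vand[OF _ m] shaped_nth[OF s True] by (simp add: adj_def)
      also have "\<dots> \<longleftrightarrow> (\<exists>u\<in>Nb n st i \<inter> Nb n st j. adj st u z)"
      proof -
        have "adj st z u \<longleftrightarrow> adj st u z" if "u < n" for u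
          using assms(1) True that unfolding wf_state_def by blast
        moreover have "u < n" if "u \<in> Nb n st i \<inter> Nb n st j" for u
          using that by (auto simp: Nb_def Full_def)
        ultimately show ?thesis using mk by blast
      qed
      finally show ?thesis using True by (auto simp: full_iff Nb_def Full_def)
    qed (auto simp: Nb_def Full_def)
    then show ?thesis by blast
  qed
  finally show ?thesis .
qed

lemma similar_merging:
  assumes "wf_state n st" "i < n" "j < n" "similar d st i j"
  shows "merging n st i j" "d \<le> card (\<Union>u\<in>Nb n st i \<inter> Nb n st j. Nb n st u)"
  using assms touched_eq[OF assms(1-3)] unfolding similar_def merging_def full_iff by simp_all

lemma dflt_Some:
  assumes "shaped n st" "dflt d st = Some s"
  obtains q where "q \<in> set (variants [] st)" "s = snd q" "meas (propagate (fst q)) + d \<le> meas st"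
  | i j where "i < n" "j < n" "similar d st i j" "s = merge st i j"
proof (cases "heavy d st")
  case (Some s')
  then obtain q where q: "find (\<lambda>q. meas (propagate (fst q)) + d \<le> meas st) (variants [] st) = Some q" "s' = snd q"
    by (auto simp: heavy_def)
  then have "q \<in> set (variants [] st)" "meas (propagate (fst q)) + d \<le> meas st"
    by (metis find_Some_iff nth_mem)+
  then show ?thesis using that(1) q(2) Some assms(2) by (simp add: dflt_def)
next
  case None
  then obtain p where p: "find (\<lambda>p. similar d st (fst p) (snd p)) (List.product [0..<n] [0..<n]) = Some p"
    "s = merge st (fst p) (snd p)"
    using assms by (auto simp: dflt_def shaped_length[OF assms(1)])
  then have "p \<in> set (List.product [0..<n] [0..<n])" "similar d st (fst p) (snd p)"
    by (metis (mono_tags, lifting) find_Some_iff nth_mem)+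
  then show ?thesis using that(2)[of "fst p" "snd p"] p(2) by auto
qed

lemma dflt_None:
  assumes "shaped n st" "dflt d st = None"
  shows "q \<in> set (variants [] st) \<Longrightarrow> meas st < meas (propagate (fst q)) + d"
    "i < n \<Longrightarrow> j < n \<Longrightarrow> \<not> similar d st i j"
proof -
  have h: "heavy d st = None" using assms(2) by (auto simp: dflt_def split: option.splits)
  then have "find (\<lambda>q. meas (propagate (fst q)) + d \<le> meas st) (variants [] st) = None"
    by (simp add: heavy_def)
  then show "q \<in> set (variants [] st) \<Longrightarrow> meas st < meas (propagate (fst q)) + d"
    unfolding find_None_iff by (meson not_le)
  have "find (\<lambda>p. similar d st (fst p) (snd p)) (List.product [0..<n] [0..<n]) = None"
    using assms(2) h by (simp add: dflt_def shaped_length[OF assms(1)])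
  then show "i < n \<Longrightarrow> j < n \<Longrightarrow> \<not> similar d st i j"
    unfolding find_None_iff by fastforce
qed

section \<open>Soundness of the search, and runs that follow a colouring\<close>

lemma solve_sound:
  assumes "wf_state n st" "solve d F k st"
  shows "\<exists>f. coloured n st f"
  using assms
proof (induction F arbitrary: k st)
  case (Suc F)
  let ?p = "propagate st"
  note s = wf_shaped[OF Suc.prems(1)]
  note P = wf_propagate[OF Suc.prems(1)] propagate(3)[OF s]
  note g = propagate(2)[OF s]
  have orig: "?case" if "coloured n ?p f" for f using same_graph_coloured[OF g that] by blast
  consider "fin (Suc (meas ?p)) ?p" | q where "q \<in> set (variants [] ?p)" "solve d F (k - 1) (fst q)"
    | s where "dflt d ?p = Some s" "solve d F k s"
    using Suc.prems(2) by (auto split: option.splits)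
  then show ?case
  proof cases
    case 1 then show ?thesis using fin_sound[OF P] orig by blast
  next
    case (2 q)
    then show ?thesis
      using Suc.IH[OF variant_state(1)[OF P(1) 2(1)]] same_graph_coloured[OF variant_state(2)[OF P(1) 2(1)]] orig
      by blast
  next
    case (3 s)
    show ?thesis using wf_shaped[OF P(1)] 3(1)
    proof (cases rule: dflt_Some)
      case (1 q)
      then show ?thesis
        using Suc.IH[OF variant_state(3)[OF P(1) 1(1)]] same_graph_coloured[OF variant_state(4)[OF P(1) 1(1)]] orig 3(2)
        by blast
    next
      case (2 i j)
      then interpret merging n ?p i j using similar_merging(1)[OF P(1)] by blast
      show ?thesis using Suc.IH[OF wf_merge] 3(2) 2(4) coloured_unmerge orig by blast
    qed
  qed
qed simp

text \<open>Follows \<open>f\<close> on the vertices of \<open>S\<close> through the guessing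
  branch. A vertex that propagation has already fixed costs nothing, hence
  \<open>m \<le> length S\<close>. The last clause lets a success from \<open>st'\<close> be carried
  back to \<open>st\<close> for any remaining fuel and budget.\<close>

lemma guess:
  assumes "wf_state n st" "coloured n st f" "set S \<subseteq> {..<n}"
  shows "\<exists>st' m. m \<le> length S \<and> wf_state n st' \<and> coloured n st' f \<and> same_graph n (propagate st) (propagate st') \<and>
    (\<forall>s \<in> set S. colours (propagate st') s = {f s}) \<and>
    (\<forall>d F k. solve d F k st' \<longrightarrow> solve d (F + m) (k + m) st)"
  using assms
proof (induction S arbitrary: st)
  case Nil
  then show ?case by (intro exI[of _ st] exI[of _ 0]) (simp add: same_graph_refl)
next
  case (Cons v S)
  let ?p = "propagate st"
  note s = wf_shaped[OF Cons.prems(1)]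
  have v: "v < n" using Cons.prems by simp
  note P = propagate(1,2)[OF s] wf_propagate[OF Cons.prems(1)] propagate(4)[OF s Cons.prems(2)]
  have fv: "f v \<in> colours (propagate st') v" if "wf_state n st'" "coloured n st' f" for st'
    using propagate(4)[OF wf_shaped[OF that(1)] that(2)] v by (simp add: coloured_def)
  show ?case
  proof (cases "colours ?p v = {f v}")
    case True
    obtain st' m where st': "m \<le> length S" "wf_state n st'" "coloured n st' f" "same_graph n ?p (propagate st')"
      "\<forall>s \<in> set S. colours (propagate st') s = {f s}" "\<forall>d F k. solve d F k st' \<longrightarrow> solve d (F + m) (k + m) st"
      using Cons.IH[OF Cons.prems(1,2)] Cons.prems(3) by auto
    have "colours (propagate st') v \<subseteq> {f v}" using st'(4) v True unfolding same_graph_def by blast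
    then have "colours (propagate st') v = {f v}" using fv[OF st'(2,3)] by blast
    then show ?thesis using st' by (intro exI[of _ st'] exI[of _ m]) simp
  next
    case False
    let ?A = "assign ?p v (f v)"
    have c: "f v \<in> colours ?p v" "f v < 3" using fv[OF Cons.prems(1,2)] colours_less by blast+
    note A = assign[OF P(1) v c(2)]
    have wA: "wf_state n ?A" by (rule same_graph_wf[OF P(3) A(1,4)])
    have cA: "coloured n ?A f" by (rule coloured_assign[OF P(1,4) v])
    have mem: "(?A, exclude ?p v (f v)) \<in> set (variants [] ?p)"
      unfolding set_variants[OF P(1)] using v c False by blast
    obtain st' m where st': "m \<le> length S" "wf_state n st'" "coloured n st' f" "same_graph n (propagate ?A) (propagate st')"
      "\<forall>s \<in> set S. colours (propagate st') s = {f s}" "\<forall>d F k. solve d F k st' \<longrightarrow> solve d (F + m) (k + m) ?A"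
      using Cons.IH[OF wA cA] Cons.prems(3) by auto
    have gA: "same_graph n ?A (propagate ?A)" by (rule propagate(2)[OF A(1)])
    have "same_graph n ?p (propagate st')"
      by (rule same_graph_trans[OF A(4) same_graph_trans[OF gA st'(4)]])
    moreover have "colours (propagate st') v \<subseteq> colours ?A v"
      using same_graph_trans[OF gA st'(4)] v unfolding same_graph_def by blast
    then have "colours (propagate st') v = {f v}" using fv[OF st'(2,3)] A(2)[of v] by auto
    moreover have "solve d (F + Suc m) (k + Suc m) st" if "solve d F k st'" for d F k
    proof -
      have "solve d (F + m) (k + m) ?A" using st'(6) that by blast
      then have "\<exists>q \<in> set (variants [] ?p). solve d (F + m) (k + Suc m - 1) (fst q)"
        using mem by (intro bexI[OF _ mem]) simp
      then show ?thesis by simp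
    qed
    ultimately show ?thesis using st'(1,2,3,5)
      by (intro exI[of _ st'] exI[of _ "Suc m"]) simp
  qed
qed

section \<open>States without a free step\<close>

lemma two_colours:
  assumes "S \<subseteq> {..<3::nat}" "S \<noteq> {..<3}" "\<And>c. \<not> S \<subseteq> {c}"
  obtains a b where "a \<noteq> b" "S = {a, b}"
proof -
  have fin: "finite S" by (rule finite_subset[OF assms(1)]) simp
  have "S \<subset> {..<3}" using assms by blast
  then have "card S < card {..<3::nat}" by (intro psubset_card_mono) auto
  moreover obtain a where "a \<in> S" using assms(3)[of 0] by blast
  moreover obtain b where "b \<in> S" "b \<noteq> a" using assms(3)[of a] by blast
  ultimately have "{a, b} \<subseteq> S" "card {a, b} = 2" "card S \<le> 2" by auto
  then have "S = {a, b}" using card_seteq[OF fin] by metis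
  then show ?thesis using that \<open>b \<noteq> a\<close> by blast
qed

text \<open>Gathers what makes \<open>near_diameter_3\<close> applicable: the absence of heavy
  assignments bounds degrees and the sets \<open>D x\<close>, the absence of similar pairs bounds
  what common neighbours see, and \<open>near\<close> yields the links.\<close>

locale settled =
  fixes n :: nat and p :: state and d :: nat and f :: "nat \<Rightarrow> nat"
  assumes wf_state: "wf_state n p" and closed: "closed n p" and col: "coloured n p f" and near: "near n p"
    and no_default: "dflt d p = None" and d_pos: "0 < d"
begin

lemma s: "shaped n p" using wf_state by (rule wf_shaped)

lemma sym: "u < n \<Longrightarrow> w < n \<Longrightarrow> adj p u w \<Longrightarrow> adj p w u"
  using wf_state unfolding wf_state_def by blast

definition probe :: "nat \<Rightarrow> nat \<Rightarrow> state" where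
  "probe x c = propagate (assign p x c)"

definition reach :: "nat \<Rightarrow> nat \<Rightarrow> nat set" where
  "reach x c = {z \<in> Full n p. colours (probe x c) z \<noteq> colours p z}"

definition D :: "nat \<Rightarrow> nat set" where
  "D x = (\<Union>c<3. reach x c)"

context
  fixes x c :: nat
  assumes x: "x \<in> Full n p" and c: "c < 3"
begin

lemma xn: "x < n" and full_x: "colours p x = {..<3}"
  using x by (auto simp: Full_def)

lemmas A = assign[OF s xn c]

lemma probe: "same_graph n p (probe x c)" "closed n (probe x c)" "colours (probe x c) x \<subseteq> {c}" "shaped n (probe x c)"
proof -
  note g = propagate(2)[OF A(1)]
  show "same_graph n p (probe x c)" unfolding probe_def by (rule same_graph_trans[OF A(4) g])
  show "closed n (probe x c)" unfolding probe_def by (rule propagate(3)[OF A(1)])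
  have "colours (probe x c) x \<subseteq> colours (assign p x c) x"
    using g xn unfolding probe_def same_graph_def by blast
  then show "colours (probe x c) x \<subseteq> {c}" using A(2)[of x] by auto
  show "shaped n (probe x c)" unfolding probe_def by (rule propagate(1)[OF A(1)])
qed

lemma probe_step:
  assumes "u < n" "w < n" "adj p u w" "colours (probe x c) w \<subseteq> {e}"
  shows "e \<notin> colours (probe x c) u"
  using closedD[OF probe(2) assms(1,2) _ assms(4)] probe(1) assms unfolding same_graph_def by blast

text \<open>Otherwise \<open>heavy\<close> would have found this assignment, since each vertex of
  \<open>reach x c\<close> loses a colour.\<close>

lemma card_reach: "card (reach x c) < d"
proof -
  have "card {..<3::nat} \<noteq> card {c}" by simp
  then have "{..<3} \<noteq> {c}" by metis
  then have "c \<in> colours p x" "colours p x \<noteq> {c}" using c full_x by simp_all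
  then have "(assign p x c, exclude p x c) \<in> set (variants [] p)"
    unfolding set_variants[OF s] using xn by blast
  then have "meas p < meas (probe x c) + d" using dflt_None(1)[OF s no_default] unfolding probe_def by fastforce
  moreover have "meas (probe x c) + card {i. i < n \<and> colours (probe x c) i \<noteq> colours p i} \<le> meas p"
    by (rule same_graph_gain[OF s probe(4,1)])
  moreover have "card (reach x c) \<le> card {i. i < n \<and> colours (probe x c) i \<noteq> colours p i}"
    by (rule card_mono) (auto simp: reach_def Full_def)
  ultimately show ?thesis by linarith
qed

lemma reachI:
  assumes "z \<in> Full n p" "e < 3" "e \<notin> colours (probe x c) z"
  shows "z \<in> D x"
  using assms c unfolding D_def reach_def Full_def by blast

lemma Nb_reach: "Nb n p x \<subseteq> reach x c"
proof
  fix z assume "z \<in> Nb n p x"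
  then have z: "z \<in> Full n p" "adj p x z" "z < n" by (auto simp: Nb_def Full_def)
  then have "c \<notin> colours (probe x c) z" using probe_step[OF z(3) xn sym[OF xn z(3,2)] probe(3)] by blast
  then show "z \<in> reach x c" using z c unfolding reach_def Full_def by blast
qed

end

lemma card_Nb: "x \<in> Full n p \<Longrightarrow> card (Nb n p x) \<le> d"
  using card_mono[OF _ Nb_reach[of x 0]] card_reach[of x 0] by (simp add: reach_def)

lemma card_D: "x \<in> Full n p \<Longrightarrow> card (D x) \<le> 3 * d"
proof -
  assume x: "x \<in> Full n p"
  have "card (D x) \<le> (\<Sum>c<3. card (reach x c))" unfolding D_def by (rule card_UN_le) simp
  also have "\<dots> \<le> (\<Sum>c<(3::nat). d)" by (rule sum_mono) (use card_reach[OF x] less_imp_le in auto)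
  finally show ?thesis by simp
qed

lemma self_D: "x \<in> Full n p \<Longrightarrow> x \<in> D x"
  using reachI[of x 0 x 1] probe(3)[of x 0] by auto

lemma nbr_D: "x \<in> Full n p \<Longrightarrow> z \<in> Full n p \<Longrightarrow> adj p x z \<Longrightarrow> z \<in> D x"
  using Nb_reach[of x 0] by (auto simp: Nb_def D_def)

text \<open>If \<open>y\<close> had a single colour, closure would have struck it from the list of
  \<open>x\<close>, which is full.\<close>

lemma undecided:
  assumes "x \<in> Full n p" "y < n" "adj p x y" "y \<notin> Full n p"
  obtains a b where "a \<noteq> b" "colours p y = {a, b}" "a < 3" "b < 3"
proof -
  have x: "x < n" "colours p x = {..<3}" using assms by (auto simp: Full_def)
  have "\<not> colours p y \<subseteq> {c}" for c
  proof
    assume c: "colours p y \<subseteq> {c}"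
    have "f y \<in> colours p y" "f y < 3" using col assms(2) colours_less unfolding coloured_def by blast+
    then have "c < 3" using c by auto
    then show False using closedD[OF closed x(1) assms(2,3) c] x(2) by simp
  qed
  moreover have "colours p y \<noteq> {..<3}" using assms by (auto simp: Full_def)
  ultimately obtain a b where "a \<noteq> b" "colours p y = {a, b}"
    using two_colours[OF colours_sub] by metis
  moreover then have "a < 3" "b < 3" using colours_less by blast+
  ultimately show ?thesis using that by blast
qed

lemma forced:
  assumes x: "x \<in> Full n p" and y: "y < n" "adj p x y" and yc: "colours p y = {a, b}" "a < 3"
  shows "colours (probe x a) y \<subseteq> {b}"
proof -
  have xn: "x < n" using x by (rule Full_less)
  have "a \<notin> colours (probe x a) y"
    by (rule probe_step[OF x yc(2) y(1) xn sym[OF xn y] probe(3)[OF x yc(2)]])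
  moreover have "colours (probe x a) y \<subseteq> {a, b}"
    using probe(1)[OF x yc(2)] y(1) yc(1) unfolding same_graph_def by blast
  ultimately show ?thesis by blast
qed

text \<open>Giving \<open>x\<close> one of the two colours of \<open>y\<close> forces the other one
  on \<open>y\<close>, and \<open>z\<close> loses it.\<close>

lemma via_one:
  assumes "x \<in> Full n p" "y < n" "adj p x y" "y \<notin> Full n p" "z \<in> Full n p" "adj p y z"
  shows "z \<in> D x"
proof -
  obtain a b where ab: "a \<noteq> b" "colours p y = {a, b}" "a < 3" "b < 3"
    using undecided[OF assms(1-4)] .
  have z: "z < n" using assms(5) by (rule Full_less)
  have "b \<notin> colours (probe x a) z"
    by (rule probe_step[OF assms(1) ab(3) z assms(2) sym[OF assms(2) z assms(6)] forced[OF assms(1-3) ab(2,3)]])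
  then show ?thesis using reachI[OF assms(1) ab(3) assms(5) ab(4)] by blast
qed

text \<open>Two lists of two colours out of three share a colour \<open>v\<close>. Giving
  \<open>x\<close> the other colour \<open>u\<close> of \<open>y\<close> forces \<open>v\<close> on
  \<open>y\<close>, then \<open>v'\<close> on \<open>w\<close>, and \<open>z\<close> loses
  \<open>v'\<close>.\<close>

lemma via_two:
  assumes "x \<in> Full n p" "y < n" "adj p x y" "y \<notin> Full n p" "w < n" "adj p y w" "w \<notin> Full n p"
    "z \<in> Full n p" "adj p w z"
  shows "z \<in> D x"
proof -
  have z: "z < n" using assms(8) by (rule Full_less)
  obtain a b where ab: "a \<noteq> b" "colours p y = {a, b}" "a < 3" "b < 3"
    using undecided[OF assms(1-4)] .
  obtain a' b' where ab': "a' \<noteq> b'" "colours p w = {a', b'}" "a' < 3" "b' < 3"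
    using undecided[OF assms(8,5) sym[OF assms(5) z assms(9)] assms(7)] .
  have "\<exists>u v v'. {a, b} = {u, v} \<and> {a', b'} = {v, v'} \<and> u < 3 \<and> v' < 3"
  proof -
    have "a = a' \<or> a = b' \<or> b = a' \<or> b = b'" using ab ab' by linarith
    then show ?thesis using ab ab' by (elim disjE) (blast intro: insert_commute)+
  qed
  then obtain u v v' where uv: "colours p y = {u, v}" "colours p w = {v, v'}" "u < 3" "v' < 3"
    using ab(2) ab'(2) by auto
  note t = probe_step[OF assms(1) uv(3)]
  have "v \<notin> colours (probe x u) w"
    by (rule t[OF assms(5,2) sym[OF assms(2,5,6)] forced[OF assms(1-3) uv(1,3)]])
  moreover have "colours (probe x u) w \<subseteq> {v, v'}"
    using probe(1)[OF assms(1) uv(3)] assms(5) uv(2) unfolding same_graph_def by blast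
  ultimately have "colours (probe x u) w \<subseteq> {v'}" by blast
  then have "v' \<notin> colours (probe x u) z" by (rule t[OF z assms(5) sym[OF assms(5) z assms(9)]])
  then show ?thesis using reachI[OF assms(1) uv(3) assms(8) uv(4)] by blast
qed

text \<open>On a path \<open>x\<close>, \<open>a\<close>, \<open>b\<close>, \<open>z\<close> the
  case depends on which inner vertices are full. Both: the path stays inside \<open>Full\<close>.
  Exactly one: it lies in \<open>D\<close> of the farther end by \<open>via_one\<close> and is
  adjacent to the nearer end. None: \<open>via_two\<close>. The fact \<open>two\<close> covers
  shorter paths.\<close>

lemma links:
  assumes x: "x \<in> Full n p" and z: "z \<in> Full n p"
  shows "z \<in> D x \<or> z \<in> (\<Union>u\<in>D x. Nb n p u) \<or> x \<in> (\<Union>u\<in>D z. Nb n p u)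
    \<or> (\<exists>a \<in> Nb n p x. \<exists>b \<in> Nb n p a. z \<in> Nb n p b)"
proof -
  let ?F = "Full n p"
  have xz: "x < n" "z < n" using x z by (auto simp: Full_less)
  have NbI: "w \<in> Nb n p u" if "w \<in> ?F" "adj p u w" for u w using that by (simp add: Nb_def)
  obtain a b where ab: "a < n" "b < n" "x = a \<or> adj p x a" "a = b \<or> adj p a b" "b = z \<or> adj p b z"
    using near x z unfolding near_def by blast
  have two: "z \<in> D x \<or> z \<in> (\<Union>u\<in>D x. Nb n p u)" if "w < n" "adj p x w" "w = z \<or> adj p w z" for w
  proof (cases "w = z")
    case True then show ?thesis using nbr_D[OF x z] that by blast
  next
    case False
    then have wz: "adj p w z" using that by blast
    show ?thesis
    proof (cases "w \<in> ?F")
      case True then show ?thesis using nbr_D[OF x True that(2)] NbI[OF z wz] by blast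
    next
      case False then show ?thesis using via_one[OF x that(1,2) False z wz] by blast
    qed
  qed
  show ?thesis
  proof (cases "x = a")
    case True
    then show ?thesis using two[OF ab(2) _ ab(5)] two[OF xz(2)] self_D[OF x] ab(4,5) by blast
  next
    case False
    then have xa: "adj p x a" using ab by blast
    show ?thesis
    proof (cases "a = b \<or> b = z")
      case True then show ?thesis using two[OF ab(1) xa] ab(4,5) by blast
    next
      case False
      then have e: "adj p a b" "adj p b z" using ab by blast+
      have e': "adj p b a" "adj p z b" "adj p a x" using e xa sym ab(1,2) xz by blast+
      consider "a \<in> ?F" "b \<in> ?F" | "a \<in> ?F" "b \<notin> ?F" | "a \<notin> ?F" "b \<in> ?F" | "a \<notin> ?F" "b \<notin> ?F" by blast
      then show ?thesis
      proof cases
        case 1 then show ?thesis using NbI[OF _ xa] NbI[OF _ e(1)] NbI[OF z e(2)] by blast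
      next
        case 2
        then have "a \<in> D z" by (intro via_one[OF z ab(2) e'(2) _ _ e'(1)])
        then show ?thesis using NbI[OF x e'(3)] by blast
      next
        case 3
        then have "b \<in> D x" by (intro via_one[OF x ab(1) xa _ _ e(1)])
        then show ?thesis using NbI[OF z e(2)] by blast
      next
        case 4 then show ?thesis using via_two[OF x ab(1) xa _ ab(2) e(1) _ z e(2)] by blast
      qed
    qed
  qed
qed

lemma f_proper: "u < n \<Longrightarrow> w < n \<Longrightarrow> adj p u w \<Longrightarrow> f u \<noteq> f w"
  using col by (simp add: coloured_def)

lemma near_diameter_3:
  assumes "0 < t" "n\<^sup>2 \<le> d\<^sup>2 * t ^ 5"
  shows "near_diameter_3 (Full n p) (Nb n p) f D d t n"
proof
  show "card (Full n p) \<le> n" using card_mono[of "{..<n}" "Full n p"] by (auto simp: Full_def)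
  show "Nb n p x \<subseteq> Full n p" for x by (auto simp: Nb_def)
  show "x \<in> Nb n p y" if "x \<in> Full n p" "y \<in> Nb n p x" for x y
    using that sym[of x y] by (auto simp: Nb_def Full_def)
  show "f x \<noteq> f y" if "x \<in> Full n p" "y \<in> Nb n p x" for x y
    using that f_proper[of x y] by (auto simp: Nb_def Full_def)
  show "f x < 3" if "x \<in> Full n p" for x
    using that col colours_less unfolding coloured_def Full_def by blast
  show "D x \<subseteq> Full n p" for x by (auto simp: D_def reach_def)
  \<comment> \<open>Equal colours exclude an edge, so the pair can fail \<open>similar\<close> only
    by touching fewer than \<open>d\<close> vertices.\<close>
  show "card (\<Union>u\<in>Nb n p x \<inter> Nb n p y. Nb n p u) \<le> d"
    if "x \<in> Full n p" "y \<in> Full n p" "x \<noteq> y" "f x = f y" for x y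
  proof -
    have xy: "x < n" "y < n" using that by (auto simp: Full_def)
    have "\<not> similar d p x y" by (rule dflt_None(2)[OF s no_default xy])
    moreover have "\<not> adj p x y" using f_proper[OF xy] that by blast
    ultimately show ?thesis
      using that unfolding similar_def full_iff touched_eq[OF wf_state xy] by (auto simp: Full_def)
  qed
qed (use assms d_pos card_Nb card_D links in auto)

end

section \<open>Completeness of the search\<close>

text \<open>Bounds the guesses still to be made. The first term grants two guesses per
  \<open>d\<close> lost colours, the price of a free step that contradicts the colouring;
  \<open>3 * d\<close> pays for guessing all of \<open>X\<close> once it has no edges; the last term
  pays for the killing sets.\<close>

definition pot :: "nat \<Rightarrow> nat \<Rightarrow> nat \<Rightarrow> state \<Rightarrow> real" where
  "pot d t n p = 2 * meas p / d + 3 * d +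
     (if full_arcs n p = {} then 0 else 1440 * d * t * (1 + ln (card (full_arcs n p))))"

lemma pot_mono:
  assumes "meas p' \<le> meas p" "card (full_arcs n p') \<le> card (full_arcs n p)"
  shows "pot d t n p' + 2 * (real (meas p) - real (meas p')) / d \<le> pot d t n p"
proof -
  let ?m = "\<lambda>p. if full_arcs n p = {} then 0 else 1440 * real d * t * (1 + ln (card (full_arcs n p)))"
  have pos: "1 \<le> card (full_arcs n q)" if "full_arcs n q \<noteq> {}" for q
    using that by (simp add: Suc_le_eq card_gt_0_iff)
  have "?m p' \<le> ?m p"
  proof (cases "full_arcs n p' = {}")
    case True
    then show ?thesis using pos[of p] by (auto intro!: mult_nonneg_nonneg add_nonneg_nonneg)
  next
    case False
    then have "full_arcs n p \<noteq> {}" using assms(2) pos[of p'] by auto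
    moreover have "ln (real (card (full_arcs n p'))) \<le> ln (real (card (full_arcs n p)))"
      using pos[OF False] assms(2) by (subst ln_le_cancel_iff) auto
    ultimately show ?thesis using False by (auto intro!: mult_left_mono)
  qed
  then show ?thesis unfolding pot_def by (simp add: diff_divide_distrib right_diff_distrib)
qed

lemma pot_ge: "2 * meas p / d + 3 * d \<le> pot d t n p"
proof -
  have "0 \<le> 1440 * real d * t * (1 + ln (card (full_arcs n p)))" if "full_arcs n p \<noteq> {}"
  proof -
    have "1 \<le> card (full_arcs n p)" using that by (simp add: Suc_le_eq card_gt_0_iff)
    then show ?thesis by (auto intro!: mult_nonneg_nonneg add_nonneg_nonneg)
  qed
  then show ?thesis by (simp add: pot_def)
qed

lemma pot_nonneg: "0 \<le> pot d t n p"
  by (rule order_trans[OF _ pot_ge]) simp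

text \<open>By \<open>ln x \<le> x - 1\<close>, removing a fraction \<open>c / w\<close> of the
  \<open>w\<close> arcs lowers \<open>M * ln w\<close> by at least \<open>M * c / w\<close>, which
  is at least \<open>j\<close>. When no arcs remain, the summand \<open>1\<close> beside the
  logarithm pays.\<close>

lemma pot_drop:
  assumes "meas p' \<le> meas p" "full_arcs n p \<noteq> {}" "j * card (full_arcs n p) \<le> 1440 * d * t * c"
    "card (full_arcs n p') + c \<le> card (full_arcs n p)"
  shows "pot d t n p' + j \<le> pot d t n p"
proof -
  define M where "M = 1440 * real d * t"
  define w where "w = real (card (full_arcs n p))"
  have w: "w \<ge> 1" using assms(2) by (simp add: w_def Suc_le_eq card_gt_0_iff)
  have M: "0 \<le> M" by (simp add: M_def)
  have "real (j * card (full_arcs n p)) \<le> real (1440 * d * t * c)" using assms(3) by (rule of_nat_mono)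
  then have jw: "j * w \<le> M * c" by (simp add: M_def w_def)
  have c: "real (card (full_arcs n p')) + c \<le> w" using assms(4) unfolding w_def by linarith
  have m: "2 * meas p' / d \<le> 2 * meas p / d" using assms(1) by (intro divide_right_mono) auto
  have "(if full_arcs n p' = {} then 0 else M * (1 + ln (card (full_arcs n p')))) + j \<le> M * (1 + ln w)"
  proof (cases "full_arcs n p' = {}")
    case True
    have "j * w \<le> M * w" using jw c M mult_left_mono[of "real c" w M] by auto
    then have "j \<le> M" using w by simp
    also have "M \<le> M * (1 + ln w)" using M w by (simp add: mult_le_cancel_left1)
    finally show ?thesis using True by simp
  next
    case False
    define w' where "w' = real (card (full_arcs n p'))"
    have w': "w' \<ge> 1" using False by (simp add: w'_def Suc_le_eq card_gt_0_iff)
    have "ln w' \<le> ln w + (w' / w - 1)"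
    proof -
      have "ln (w' / w) \<le> w' / w - 1" using w w' by (intro ln_le_minus_one) auto
      then show ?thesis using w w' by (simp add: ln_div)
    qed
    then have "M * (1 + ln w') \<le> M * (1 + (ln w + (w' / w - 1)))" using M by (intro mult_left_mono) auto
    moreover have "j \<le> M * (1 - w' / w)"
    proof -
      have "j * w \<le> M * (w - w')" using jw c mult_left_mono[of "real c" "w - w'" M] M by (simp add: w'_def)
      then show ?thesis using w by (simp add: field_simps)
    qed
    ultimately show ?thesis using False by (simp add: w'_def algebra_simps)
  qed
  then show ?thesis using m assms(2) unfolding pot_def M_def w_def by auto
qed

text \<open>In every case some path of the search agrees with a colouring and spends no more guesses
  than the potential drops. The colouring varies in the induction because contraction changes it at
  \<open>j\<close>.\<close>

lemma solve_complete:
  assumes d: "0 < d" and t: "0 < t" and n: "n\<^sup>2 \<le> d\<^sup>2 * t ^ 5"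
    and "wf_state n st" "coloured n st f" "near n (propagate st)" "pot d t n (propagate st) \<le> k" "meas (propagate st) + k < F"
  shows "solve d F k st"
  using assms(4-8)
proof (induction "meas (propagate st)" arbitrary: st f k F rule: less_induct)
  case less
  define p where "p = propagate st"
  note s = wf_shaped[OF less.prems(1)]
  have wfp: "wf_state n p" and cl: "closed n p" and col: "coloured n p f" and sp: "shaped n p"
    and near: "near n p"
    using wf_propagate[OF less.prems(1)] propagate[OF s] less.prems(2,3) by (simp_all add: p_def)
  have pot: "pot d t n p \<le> k" and F: "meas p + k < F" using less.prems by (simp_all add: p_def)
  obtain F' where F': "F = Suc F'" using F by (cases F) auto
  have dr: "real d > 0" using d by simp
  text \<open>Enough to show that some later state is solved with what is left of the budget.\<close>
  have step: "solve d F1 k1 st'"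
    if "wf_state n st'" "coloured n st' f'" "near n (propagate st')" "meas (propagate st') < meas p"
      "pot d t n (propagate st') \<le> k1" "meas (propagate st') + k1 < F1" for st' f' k1 F1
    using less.hyps[of st' f' k1 F1] that by (simp add: p_def)
  have after: "solve d F k st"
    if "wf_state n st'" "coloured n st' f" "same_graph n p (propagate st')" "meas (propagate st') < meas p"
      "\<forall>d F k. solve d F k st' \<longrightarrow> solve d (F + m) (k + m) st" "pot d t n (propagate st') + m \<le> pot d t n p"
    for st' m
  proof -
    have m: "m \<le> k" using pot that(6) pot_nonneg[of d t n "propagate st'"] by linarith
    have "pot d t n (propagate st') \<le> real (k - m)" using that(6) pot m by (simp add: of_nat_diff)
    moreover have "meas (propagate st') + (k - m) < F - m" using that(4) F m by linarith
    ultimately have "solve d (F - m) (k - m) st'"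
      by (intro step[OF that(1,2) same_graph_near[OF that(3) near] that(4)])
    then have "solve d (F - m + m) (k - m + m) st" using that(5) by blast
    then show ?thesis using m F by simp
  qed
  show ?case
  proof (cases "dflt d p")
    case (Some q)
    have via: "solve d F k st" if "solve d F' k q" using that Some by (simp add: F' p_def)
    show ?thesis using sp Some
    proof (cases rule: dflt_Some)
      case (1 v)
      obtain i c where i: "i < n" "c \<in> colours p i" "colours p i \<noteq> {c}" and v: "v = (assign p i c, exclude p i c)"
        using variant_assign[OF sp 1(1)] .
      note V = variant_state[OF wfp 1(1)]
      show ?thesis
      proof (cases "f i = c")
        case True
        \<comment> \<open>The colouring contradicts the exclusion, so the assignment itself is
          guessed. Its progress of \<open>d\<close> releases two units of potential for the one
          guess.\<close>
        let ?q = "propagate (fst v)"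
        have colv: "coloured n (fst v) f" using coloured_assign[OF sp col i(1)] True v by simp
        have nv: "near n ?q" by (rule same_graph_near[OF V(6) near])
        have "card (full_arcs n ?q) \<le> card (full_arcs n p)" by (intro card_mono same_graph_arcs V(6)) simp
        then have "pot d t n ?q + 2 * (real (meas p) - real (meas ?q)) / d \<le> pot d t n p"
          using V(8) by (intro pot_mono) auto
        moreover have "2 \<le> 2 * (real (meas p) - real (meas ?q)) / d" using 1(3) dr by (simp add: field_simps)
        ultimately have drop: "pot d t n ?q + 2 \<le> k" using pot by linarith
        with pot_nonneg[of d t n ?q] have k: "2 \<le> k" by linarith
        have "solve d F' (k - 1) (fst v)"
          by (rule step[OF V(1) colv nv V(8)]) (use drop k F F' V(8) in \<open>auto simp: of_nat_diff\<close>)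
        then have "\<exists>q \<in> set (variants [] p). solve d F' (k - 1) (fst q)" using 1(1) by blast
        then show ?thesis using k by (simp add: F' p_def)
      next
        case False
        have colv: "coloured n q f"
          using coloured_exclude[OF sp col i(1) colours_less[OF i(2)] False] v 1(2) by simp
        have wq: "wf_state n q" and gq: "same_graph n p q" and mq: "meas q < meas p" using V(3,4,9) 1(2) by simp_all
        note sq = wf_shaped[OF wq]
        have g: "same_graph n p (propagate q)" by (rule same_graph_trans[OF gq propagate(2)[OF sq]])
        have m: "meas (propagate q) < meas p"
          using same_graph_meas[OF sq propagate(1,2)[OF sq]] mq by linarith
        have "card (full_arcs n (propagate q)) \<le> card (full_arcs n p)" by (intro card_mono same_graph_arcs g) simp
        then have "pot d t n (propagate q) + 2 * (real (meas p) - real (meas (propagate q))) / d \<le> pot d t n p"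
          using m by (intro pot_mono) auto
        moreover have "0 \<le> 2 * (real (meas p) - real (meas (propagate q))) / d" using m by simp
        ultimately have "pot d t n (propagate q) \<le> k" using pot by linarith
        then show ?thesis
          by (intro via step[OF wq colv same_graph_near[OF g near] m]) (use m F F' in auto)
      qed
    next
      case (2 i j)
      interpret merging n p i j by (rule similar_merging(1)[OF wfp 2(1,2,3)])
      show ?thesis
      proof (cases "f i = f j")
        case True
        have wq: "wf_state n q" and nq: "near n q" and mq: "meas q < meas p" and colq: "coloured n q (f(j := 0))"
          and aq: "card (full_arcs n q) \<le> card (full_arcs n p)"
          using wf_merge near_merge[OF near] meas_merge coloured_merge[OF col True] card_arcs_merge 2(4) by simp_all
        note sq = wf_shaped[OF wq]
        have m: "meas (propagate q) < meas p"
          using same_graph_meas[OF sq propagate(1,2)[OF sq]] mq by linarith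
        have "card (full_arcs n (propagate q)) \<le> card (full_arcs n q)"
          by (intro card_mono same_graph_arcs propagate(2)[OF sq]) simp
        then have "pot d t n (propagate q) + 2 * (real (meas p) - real (meas (propagate q))) / d \<le> pot d t n p"
          using m aq by (intro pot_mono) auto
        moreover have "0 \<le> 2 * (real (meas p) - real (meas (propagate q))) / d" using m by simp
        ultimately have "pot d t n (propagate q) \<le> k" using pot by linarith
        then show ?thesis
          by (intro via step[OF wq colq same_graph_near[OF propagate(2)[OF sq] nq] m]) (use m F F' in auto)
      next
        case False
        \<comment> \<open>The colouring contradicts the identification, so both vertices are
          guessed. Their common neighbours are forced to the third colour, and the touched vertices,
          at least \<open>d\<close> of them, lose it; this progress pays for two guesses.\<close>
        have "set [i, j] \<subseteq> {..<n}" using ij by simp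
        then obtain st' m where st': "m \<le> length [i, j]" "wf_state n st'" "coloured n st' f"
          "same_graph n p (propagate st')" "\<forall>s \<in> set [i, j]. colours (propagate st') s = {f s}"
          "\<forall>d F k. solve d F k st' \<longrightarrow> solve d (F + m) (k + m) st"
          using guess[OF less.prems(1,2), folded p_def] by blast
        let ?q = "propagate st'"
        note s' = wf_shaped[OF st'(2)]
        have fij: "f i < 3" "f j < 3" using col ij(1,2) colours_less unfolding coloured_def by blast+
        have clq: "closed n ?q" by (rule propagate(3)[OF s'])
        \<comment> \<open>The third colour, because \<open>0\<close>, \<open>1\<close> and
          \<open>2\<close> have sum \<open>3\<close>.\<close>
        define e where "e = 3 - f i - f j"
        have e: "{..<3} = {f i, f j, e}" using fij False unfolding e_def by auto
        have adjq: "adj ?q u w \<longleftrightarrow> adj p u w" if "u < n" "w < n" for u w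
          using st'(4) that unfolding same_graph_def by blast
        have "(\<Union>u\<in>Nb n p i \<inter> Nb n p j. Nb n p u) \<subseteq> {z. z < n \<and> colours ?q z \<noteq> colours p z}"
        proof
          fix z assume "z \<in> (\<Union>u\<in>Nb n p i \<inter> Nb n p j. Nb n p u)"
          then obtain u where u: "u < n" "adj p i u" "adj p j u" "z < n" "adj p u z" "colours p z = {..<3}"
            by (auto simp: Nb_def Full_def)
          have "f i \<notin> colours ?q u"
            by (rule closedD[OF clq u(1) ij(1)]) (use adjq[OF u(1) ij(1)] sym[OF ij(1) u(1,2)] st'(5) in auto)
          moreover have "f j \<notin> colours ?q u"
            by (rule closedD[OF clq u(1) ij(2)]) (use adjq[OF u(1) ij(2)] sym[OF ij(2) u(1,3)] st'(5) in auto)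
          ultimately have "colours ?q u \<subseteq> {e}" using colours_sub[of ?q u] e by auto
          then have "e \<notin> colours ?q z"
            by (intro closedD[OF clq u(4,1)]) (use adjq[OF u(4,1)] sym[OF u(1,4,5)] in auto)
          then show "z \<in> {z. z < n \<and> colours ?q z \<noteq> colours p z}" using u(4,6) e by auto
        qed
        then have "card (\<Union>u\<in>Nb n p i \<inter> Nb n p j. Nb n p u) \<le> card {z. z < n \<and> colours ?q z \<noteq> colours p z}"
          by (rule card_mono[rotated]) simp
        with similar_merging(2)[OF wfp 2(1,2,3)]
        have mq: "meas ?q + d \<le> meas p"
          using same_graph_gain[OF sp propagate(1)[OF s'] st'(4)] by linarith
        have "card (full_arcs n ?q) \<le> card (full_arcs n p)" by (intro card_mono same_graph_arcs st'(4)) simp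
        then have "pot d t n ?q + 2 * (real (meas p) - real (meas ?q)) / d \<le> pot d t n p"
          using mq by (intro pot_mono) auto
        moreover have "2 \<le> 2 * (real (meas p) - real (meas ?q)) / d" using mq dr by (simp add: field_simps)
        moreover have "m \<le> 2" using st'(1) by simp
        ultimately have "pot d t n ?q + m \<le> pot d t n p" by linarith
        then show ?thesis using mq d by (intro after[OF st'(2,3,4) _ st'(6)]) simp
      qed
    qed
  next
    case None
    interpret settled n p d f
      by unfold_locales (use wfp cl col near None d in auto)
    let ?X = "Full n p"
    show ?thesis
    proof (cases "full_arcs n p = {}")
      case True
      \<comment> \<open>Without edges inside \<open>X\<close> the only alternative left in
        \<open>links\<close> is \<open>z \<in> D x\<close>. So one set \<open>D x\<close> covers
        \<open>X\<close>, and the term \<open>3 * d\<close> of the potential pays for guessing all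
        of it.\<close>
      have nb: "Nb n p x = {}" if "x \<in> ?X" for x using True that by (auto simp: full_arcs_def)
      have Dnb: "(\<Union>u\<in>D x. Nb n p u) = {}" for x using nb by (auto simp: D_def reach_def)
      have XD: "?X \<subseteq> D x" if x: "x \<in> ?X" for x
      proof
        fix z assume "z \<in> ?X"
        then show "z \<in> D x" using links[OF x, of z] nb[OF x] by (simp only: Dnb) simp
      qed
      have cX: "card ?X \<le> 3 * d"
      proof (cases "?X = {}")
        case False
        then obtain x where "x \<in> ?X" by blast
        moreover have "finite (D x)" by (simp add: D_def reach_def)
        ultimately show ?thesis using card_mono[OF _ XD] card_D by (meson le_trans)
      qed simp
      obtain S where S: "set S = ?X" "length S = card ?X"
        using finite_distinct_list[OF finite_Full, of n p] distinct_card by metis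
      have "set S \<subseteq> {..<n}" using S(1) by (auto simp: Full_def)
      then obtain st' m where st': "m \<le> length S" "wf_state n st'" "coloured n st' f" "same_graph n p (propagate st')"
        "\<forall>s \<in> set S. colours (propagate st') s = {f s}"
        "\<forall>d F k. solve d F k st' \<longrightarrow> solve d (F + m) (k + m) st"
        using guess[OF less.prems(1,2), folded p_def] by blast
      let ?q = "propagate st'"
      note s' = wf_shaped[OF st'(2)]
      have "card {f x} \<noteq> card {..<3::nat}" for x by simp
      then have ne: "{f x} \<noteq> {..<3}" for x by metis
      have "Full n ?q = {}"
      proof (rule equals0I)
        fix x assume "x \<in> Full n ?q"
        then have "x \<in> set S" "colours ?q x = {..<3}"
          using same_graph_Full[OF st'(4)] S(1) by (auto simp: Full_def)
        then show False using st'(5) ne by force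
      qed
      have "card (colours ?q i) \<le> 2" if "i < n" for i
      proof -
        have "colours ?q i \<noteq> {..<3}" using \<open>Full n ?q = {}\<close> that by (auto simp: Full_def)
        then have "colours ?q i \<subset> {..<3}" using colours_sub[of ?q i] by blast
        then have "card (colours ?q i) < card {..<3::nat}" by (intro psubset_card_mono) auto
        then show ?thesis by simp
      qed
      then have fin: "fin (Suc (meas ?q)) ?q"
        by (intro fin_complete[OF wf_propagate[OF st'(2)] propagate(4)[OF s' st'(3)]]) auto
      have "0 \<le> real (2 * meas p) / real d" by simp
      then have "3 * d \<le> pot d t n p" using pot_ge[of p d t n] by linarith
      then have "real m \<le> real k" using pot cX S(2) st'(1) by linarith
      then have m: "m \<le> k" by simp
      obtain F1 where "F - m = Suc F1" using F m by (cases "F - m") auto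
      then have "solve d (F - m) (k - m) st'" using fin by simp
      then have "solve d (F - m + m) (k - m + m) st" using st'(6) by blast
      then show ?thesis using m F by simp
    next
      case False
      interpret G: near_diameter_3 ?X "Nb n p" f D d t n by (rule near_diameter_3[OF t n])
      have wX: "G.wgt Z = card (SIGMA x:Z. Nb n p x)" if "finite Z" for Z
        using that by (simp add: G.wgt_def)
      have full_arcs: "card (full_arcs n p) = G.wgt ?X" by (simp add: wX full_arcs_def)
      have "card (full_arcs n p) > 0" using False by (simp add: card_gt_0_iff)
      then obtain T where T: "T \<subseteq> ?X" "T \<noteq> {}"
        "card T * G.wgt ?X \<le> 1440 * d * t * G.wgt (kill_set ?X (Nb n p) f T)"
        using G.exists_killing_set full_arcs by auto
      have finT: "finite T" using T(1) finite_subset finite_Full by blast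
      obtain S where S: "set S = T" "length S = card T"
        using finite_distinct_list[OF finT] distinct_card by metis
      have "set S \<subseteq> {..<n}" using S(1) T(1) by (auto simp: Full_def)
      then obtain st' m where st': "m \<le> length S" "wf_state n st'" "coloured n st' f" "same_graph n p (propagate st')"
        "\<forall>s \<in> set S. colours (propagate st') s = {f s}"
        "\<forall>d F k. solve d F k st' \<longrightarrow> solve d (F + m) (k + m) st"
        using guess[OF less.prems(1,2), folded p_def] by blast
      let ?q = "propagate st'"
      let ?K = "kill_set ?X (Nb n p) f T"
      note s' = wf_shaped[OF st'(2)]
      have clq: "closed n ?q" by (rule propagate(3)[OF s'])
      have "card {c} \<noteq> card {..<3::nat}" for c :: nat by simp
      then have ne: "{c} \<noteq> {..<3}" for c :: nat by metis
      have strike: "f w \<notin> colours ?q u" if "w \<in> T" "u \<in> ?X" "w \<in> Nb n p u" for u w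
      proof (rule closedD[OF clq])
        show "u < n" "w < n" using that T(1) by (auto simp: Full_less)
        then show "adj ?q u w" using st'(4) that unfolding same_graph_def Nb_def by blast
        show "colours ?q w \<subseteq> {f w}" using st'(5) S(1) that by blast
      qed
      have f3: "f u < 3" if "u \<in> ?X" for u using that G.f_less by blast
      have killed: "z \<notin> Full n ?q" if zK: "z \<in> ?K" for z
      proof -
        have z: "z \<in> ?X" using zK by (simp add: kill_set_def)
        have "\<exists>c<3. c \<notin> colours ?q z"
        proof -
          consider "z \<in> T" | u where "u \<in> Nb n p z" "u \<in> T"
            | b w w' where "b \<in> Nb n p z" "w \<in> T" "w \<in> Nb n p b" "w' \<in> T" "w' \<in> Nb n p b" "f w \<noteq> f w'"
            using zK unfolding kill_set_def by blast
          then show ?thesis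
          proof cases
            case 1
            then have "colours ?q z = {f z}" using st'(5) S(1) by blast
            then have "{..<3} \<noteq> colours ?q z" using ne[of "f z"] by simp
            then show ?thesis using colours_sub[of ?q z] by blast
          next
            case (2 u) then show ?thesis using strike[OF 2(2) z 2(1)] f3 T(1) by blast
          next
            case (3 b w w')
            have b: "b \<in> ?X" using 3(1) by (simp add: Nb_def)
            have w: "f w < 3" "f w' < 3" using f3 T(1) 3 by blast+
            define e where "e = 3 - f w - f w'"
            have e: "{..<3} = {f w, f w', e}" using w 3(6) unfolding e_def by auto
            have "colours ?q b \<subseteq> {e}"
              using strike[OF 3(2) b 3(3)] strike[OF 3(4) b 3(5)] colours_sub[of ?q b] e by auto
            moreover have "adj ?q z b" "z < n" "b < n"
              using st'(4) 3(1) Full_less[OF z] Full_less[OF b] unfolding same_graph_def Nb_def by blast+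
            ultimately have "e \<notin> colours ?q z" using closedD[OF clq] by blast
            then show ?thesis using e by (intro exI[of _ e]) auto
          qed
        qed
        then show ?thesis by (auto simp: Full_def)
      qed
      \<comment> \<open>Arcs are charged to their tails, so every arc that starts in
        \<open>?K\<close> is gone.\<close>
      have "full_arcs n ?q \<subseteq> (SIGMA x:?X - ?K. Nb n p x)"
        using same_graph_arcs[OF st'(4)] killed unfolding full_arcs_def by blast
      then have "card (full_arcs n ?q) \<le> card (SIGMA x:?X - ?K. Nb n p x)"
        by (rule card_mono[rotated]) simp
      also have "\<dots> = G.wgt (?X - ?K)" by (simp add: wX)
      finally have aq: "card (full_arcs n ?q) + G.wgt ?K \<le> card (full_arcs n p)"
        unfolding full_arcs using sum.subset_diff[of ?K ?X "\<lambda>z. card (Nb n p z)"]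
        by (simp add: G.wgt_def kill_set_def)
      obtain v where v: "v \<in> T" "v < n" "colours p v = {..<3}" using T(1,2) by (auto simp: Full_def)
      then have "colours ?q v \<noteq> colours p v" using st'(5) S(1) ne by force
      then have mq: "meas ?q < meas p"
        by (rule same_graph_meas_less[OF sp propagate(1)[OF s'] st'(4) v(2)])
      have "pot d t n ?q + m \<le> pot d t n p"
      proof -
        have "pot d t n ?q + card T \<le> pot d t n p"
          by (rule pot_drop[OF _ False _ aq]) (use mq T(3) full_arcs in auto)
        then show ?thesis using st'(1) S(2) by linarith
      qed
      then show ?thesis by (intro after[OF st'(2,3,4) mq st'(6)])
    qed
  qed
qed

section \<open>The program\<close>

text \<open>Trees encode truth values as in \<open>enc_bool\<close>, so that \<open>IfNode\<close> tests them.\<close>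

abbreviation TrueE :: expr where "TrueE \<equiv> NodeE LeafE LeafE"
abbreviation AndE :: "expr \<Rightarrow> expr \<Rightarrow> expr" where "AndE a b \<equiv> IfNode a b LeafE"
abbreviation OrE :: "expr \<Rightarrow> expr \<Rightarrow> expr" where "OrE a b \<equiv> IfNode a TrueE b"
abbreviation NotE :: "expr \<Rightarrow> expr" where "NotE a \<equiv> IfNode a LeafE TrueE"
abbreviation P0 :: expr where "P0 \<equiv> Param 0"
abbreviation P1 :: expr where "P1 \<equiv> Param 1"
abbreviation P2 :: expr where "P2 \<equiv> Param 2"
abbreviation P3 :: expr where "P3 \<equiv> Param 3"
abbreviation P4 :: expr where "P4 \<equiv> Param 4"
abbreviation P5 :: expr where "P5 \<equiv> Param 5"
abbreviation bit0 :: "expr \<Rightarrow> expr" where "bit0 l \<equiv> LeftE l"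
abbreviation bit1 :: "expr \<Rightarrow> expr" where "bit1 l \<equiv> LeftE (RightE l)"
abbreviation bit2 :: "expr \<Rightarrow> expr" where "bit2 l \<equiv> LeftE (RightE (RightE l))"

fun lit :: "nat \<Rightarrow> expr" where
  "lit 0 = LeafE"
| "lit (Suc k) = NodeE LeafE (lit k)"

definition mask_expr :: "nat \<Rightarrow> expr" where
  "mask_expr c = NodeE (if c = 0 then TrueE else LeafE)
     (NodeE (if c = 1 then TrueE else LeafE) (NodeE (if c = 2 then TrueE else LeafE) LeafE))"

abbreviation (input) "f_main1 \<equiv> 1 :: nat"
abbreviation (input) "f_main2 \<equiv> 2 :: nat"
abbreviation (input) "f_vand \<equiv> 3 :: nat"
abbreviation (input) "f_vdiff \<equiv> 4 :: nat"
abbreviation (input) "f_vor \<equiv> 5 :: nat"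
abbreviation (input) "f_any \<equiv> 6 :: nat"
abbreviation (input) "f_upd \<equiv> 7 :: nat"
abbreviation (input) "f_rnd \<equiv> 8 :: nat"
abbreviation (input) "f_iter \<equiv> 9 :: nat"
abbreviation (input) "f_prop \<equiv> 10 :: nat"
abbreviation (input) "f_rev \<equiv> 11 :: nat"
abbreviation (input) "f_cand \<equiv> 12 :: nat"
abbreviation (input) "f_variants \<equiv> 13 :: nat"
abbreviation (input) "f_ok \<equiv> 14 :: nat"
abbreviation (input) "f_fin \<equiv> 15 :: nat"
abbreviation (input) "f_fin2 \<equiv> 16 :: nat"
abbreviation (input) "f_cnt \<equiv> 17 :: nat"
abbreviation (input) "f_meas \<equiv> 18 :: nat"
abbreviation (input) "f_leq \<equiv> 19 :: nat"
abbreviation (input) "f_heavy \<equiv> 20 :: nat"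
abbreviation (input) "f_zeros \<equiv> 21 :: nat"
abbreviation (input) "f_units \<equiv> 22 :: nat"
abbreviation (input) "f_sel \<equiv> 23 :: nat"
abbreviation (input) "f_fulls \<equiv> 24 :: nat"
abbreviation (input) "f_touched \<equiv> 25 :: nat"
abbreviation (input) "f_similar \<equiv> 26 :: nat"
abbreviation (input) "f_merge \<equiv> 27 :: nat"
abbreviation (input) "f_pair2 \<equiv> 28 :: nat"
abbreviation (input) "f_pair1 \<equiv> 29 :: nat"
abbreviation (input) "f_dflt \<equiv> 30 :: nat"
abbreviation (input) "f_solve \<equiv> 31 :: nat"
abbreviation (input) "f_node \<equiv> 32 :: nat"
abbreviation (input) "f_some \<equiv> 33 :: nat"
abbreviation (input) "f_option \<equiv> 34 :: nat"
abbreviation (input) "f_mul \<equiv> 35 :: nat"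
abbreviation (input) "f_pow \<equiv> 36 :: nat"
abbreviation (input) "f_search \<equiv> 37 :: nat"
abbreviation (input) "f_strike \<equiv> 38 :: nat"
abbreviation (input) "f_full \<equiv> 39 :: nat"

text \<open>The language has no local bindings. Additional functions such as \<open>f_main1\<close>,
  \<open>f_main2\<close> and \<open>f_node\<close> serve to name a computed value;
  \<open>b_dflt\<close> and \<open>b_pair1\<close> compute a value twice instead, at a constant
  factor.\<close>

definition "b_main = Call f_main1 [P0, Call f_search [LeafE, Call f_zeros [P0]]]"
definition "b_main1 = Call f_main2 [P0, Call f_pow [P1, lit 36], Call f_mul [lit 300000, Call f_pow [P1, lit 61]]]"
definition "b_main2 = Call f_solve [Call f_rev [P2, NodeE LeafE (Call f_meas [P0, LeafE])], P2, P0, P1]"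
definition "b_vand = IfNode P0 (NodeE (AndE (LeftE P0) (LeftE P1)) (Call f_vand [RightE P0, RightE P1])) LeafE"
definition "b_vdiff = IfNode P0 (NodeE (AndE (LeftE P0) (NotE (LeftE P1))) (Call f_vdiff [RightE P0, RightE P1])) LeafE"
definition "b_vor = IfNode P0 (NodeE (OrE (LeftE P0) (LeftE P1)) (Call f_vor [RightE P0, RightE P1])) LeafE"
definition "b_any = IfNode P0 (IfNode (LeftE P0) TrueE (Call f_any [RightE P0])) LeafE"
definition "b_strike = NodeE (AndE (bit0 P0) (OrE (bit1 P1) (bit2 P1)))
  (NodeE (AndE (bit1 P0) (OrE (bit0 P1) (bit2 P1))) (NodeE (AndE (bit2 P0) (OrE (bit0 P1) (bit1 P1))) LeafE))"
definition "b_full = AndE (bit0 P0) (AndE (bit1 P0) (bit2 P0))"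
definition "b_upd = IfNode P1 (Call f_upd [IfNode (LeftE P1) (Call f_strike [P0, LeftE (LeftE P2)]) P0,
  RightE P1, RightE P2]) P0"
definition "b_rnd = IfNode P0 (NodeE (NodeE (Call f_upd [LeftE (LeftE P0), RightE (LeftE P0), P1]) (RightE (LeftE P0)))
  (Call f_rnd [RightE P0, P1])) LeafE"
definition "b_iter = IfNode P0 (Call f_iter [RightE P0, Call f_rnd [P1, P1]]) P1"
text \<open>The state is its own loop counter: \<open>f_iter\<close> reads only the length of its
  first argument, so three runs make the \<open>3 * n\<close> rounds of
  \<open>propagate\<close>.\<close>

definition "b_prop = Call f_iter [P0, Call f_iter [P0, Call f_iter [P0, P0]]]"
definition "b_rev = IfNode P0 (Call f_rev [RightE P0, NodeE (LeftE P0) P1]) P1"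
definition "b_cand = IfNode (AndE (Call f_any [Call f_vand [LeftE P1, P3]]) (Call f_any [Call f_vdiff [LeftE P1, P3]]))
  (NodeE (NodeE (Call f_rev [P0, NodeE (NodeE (Call f_vand [LeftE P1, P3]) (RightE P1)) P2])
     (Call f_rev [P0, NodeE (NodeE (Call f_vdiff [LeftE P1, P3]) (RightE P1)) P2])) P4) P4"
definition "b_variants = IfNode P1
  (Call f_cand [P0, LeftE P1, RightE P1, mask_expr 0,
     Call f_cand [P0, LeftE P1, RightE P1, mask_expr 1,
       Call f_cand [P0, LeftE P1, RightE P1, mask_expr 2,
         Call f_variants [NodeE (LeftE P1) P0, RightE P1]]]]) LeafE"
definition "b_ok = IfNode P0 (AndE (Call f_any [LeftE (LeftE P0)]) (Call f_ok [RightE P0])) TrueE"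
definition "b_fin = IfNode P0 (Call f_fin2 [RightE P0, Call f_variants [LeafE, P1], P1]) LeafE"
definition "b_fin2 = IfNode P1 (IfNode (Call f_ok [Call f_prop [LeftE (LeftE P1)]])
    (Call f_fin [P0, Call f_prop [LeftE (LeftE P1)]]) (Call f_fin2 [P0, RightE P1, P2]))
  (IfNode (Call f_variants [LeafE, P2]) LeafE (Call f_ok [P2]))"
definition "b_cnt = IfNode P0 (Call f_cnt [RightE P0, IfNode (LeftE P0) (NodeE LeafE P1) P1]) P1"
definition "b_meas = IfNode P0 (Call f_meas [RightE P0, Call f_cnt [LeftE (LeftE P0), P1]]) P1"
definition "b_leq = IfNode P0 (IfNode P1 (Call f_leq [RightE P0, RightE P1]) LeafE) TrueE"
definition "b_heavy = IfNode P0 (IfNode (Call f_leq [Call f_meas [Call f_prop [LeftE (LeftE P0)], P2], Call f_meas [P1, LeafE]])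
  (NodeE (RightE (LeftE P0)) LeafE) (Call f_heavy [RightE P0, P1, P2])) LeafE"
definition "b_zeros = IfNode P0 (NodeE LeafE (Call f_zeros [RightE P0])) LeafE"
text \<open>Vertices are passed as unit vectors: one representation serves for lookup in the state,
  for equality tests and as a mask on adjacency rows.\<close>

definition "b_units = IfNode P1 (NodeE (Call f_rev [P0, NodeE TrueE (Call f_zeros [RightE P1])])
  (Call f_units [NodeE LeafE P0, RightE P1])) LeafE"
definition "b_sel = IfNode (LeftE P0) (LeftE P1) (Call f_sel [RightE P0, RightE P1])"
definition "b_fulls = IfNode P0 (NodeE (Call f_full [LeftE (LeftE P0)]) (Call f_fulls [RightE P0])) LeafE"
definition "b_touched = IfNode P0 (IfNode (AndE (Call f_full [LeftE (LeftE P0)]) (Call f_any [Call f_vand [RightE (LeftE P0), P1]]))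
  (NodeE LeafE (Call f_touched [RightE P0, P1])) (Call f_touched [RightE P0, P1])) LeafE"
definition "b_similar = AndE (Call f_full [LeftE P0]) (AndE (Call f_full [LeftE P1])
  (AndE (NotE (Call f_any [Call f_vand [P2, P3]])) (AndE (NotE (Call f_any [Call f_vand [RightE P0, P3]]))
  (Call f_leq [P5, Call f_touched [P4, Call f_vand [Call f_vand [RightE P0, RightE P1], Call f_fulls [P4]]]]))))"
definition "b_merge = IfNode P0 (NodeE
  (IfNode (LeftE P2) (NodeE (mask_expr 0) (Call f_zeros [RightE (LeftE P0)]))
  (IfNode (LeftE P1) (NodeE (LeftE (LeftE P0)) (Call f_vor [RightE (LeftE P0), P5]))
  (NodeE (LeftE (LeftE P0)) (IfNode (Call f_any [Call f_vand [RightE (LeftE P0), P4]])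
     (Call f_vdiff [Call f_vor [RightE (LeftE P0), P3], P4]) (RightE (LeftE P0))))))
  (Call f_merge [RightE P0, RightE P1, RightE P2, P3, P4, P5])) LeafE"
definition "b_pair2 = IfNode P0 (IfNode
    (Call f_similar [Call f_sel [P1, P2], Call f_sel [LeftE P0, P2], P1, LeftE P0, P2, P3])
    (NodeE (Call f_merge [P2, P1, LeftE P0, P1, LeftE P0, RightE (Call f_sel [LeftE P0, P2])]) LeafE)
    (Call f_pair2 [RightE P0, P1, P2, P3])) LeafE"
definition "b_pair1 = IfNode P0 (IfNode (Call f_pair2 [P1, LeftE P0, P2, P3])
    (Call f_pair2 [P1, LeftE P0, P2, P3]) (Call f_pair1 [RightE P0, P1, P2, P3])) LeafE"
definition "b_dflt = IfNode (Call f_heavy [Call f_variants [LeafE, P0], P0, P1])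
    (Call f_heavy [Call f_variants [LeafE, P0], P0, P1])
    (Call f_pair1 [Call f_units [LeafE, P0], Call f_units [LeafE, P0], P0, P1])"
definition "b_solve = IfNode P0 (Call f_node [RightE P0, P1, Call f_prop [P2], P3]) LeafE"
definition "b_node = OrE (Call f_fin [NodeE LeafE (Call f_meas [P2, LeafE]), P2])
  (OrE (AndE P1 (Call f_some [P0, RightE P1, Call f_variants [LeafE, P2], P3]))
    (Call f_option [P0, P1, Call f_dflt [P2, P3], P3]))"
definition "b_some = IfNode P2 (OrE (Call f_solve [P0, P1, LeftE (LeftE P2), P3])
  (Call f_some [P0, P1, RightE P2, P3])) LeafE"
definition "b_option = IfNode P2 (Call f_solve [P0, P1, LeftE P2, P3]) LeafE"
definition "b_mul = IfNode P0 (Call f_rev [P1, Call f_mul [RightE P0, P1]]) LeafE"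
definition "b_pow = IfNode P1 (Call f_mul [P0, Call f_pow [P0, RightE P1]]) TrueE"
definition "b_search = IfNode (Call f_leq [P1, Call f_pow [P0, lit 96]]) P0
  (Call f_search [NodeE LeafE P0, P1])"

definition prog :: program where
  "prog = [b_main, b_main1, b_main2, b_vand, b_vdiff, b_vor, b_any, b_upd, b_rnd, b_iter, b_prop, b_rev,
    b_cand, b_variants, b_ok, b_fin, b_fin2, b_cnt, b_meas, b_leq, b_heavy, b_zeros, b_units, b_sel,
    b_fulls, b_touched, b_similar, b_merge, b_pair2, b_pair1, b_dflt, b_solve, b_node, b_some, b_option,
    b_mul, b_pow, b_search, b_strike, b_full]"

lemma length_prog [simp]: "length prog = 40"
  by (simp add: prog_def)

lemma prog_nth:
  "prog ! 0 = b_main" "prog ! f_main1 = b_main1" "prog ! f_main2 = b_main2" "prog ! f_vand = b_vand" "prog ! f_vdiff = b_vdiff"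
  "prog ! f_vor = b_vor" "prog ! f_any = b_any" "prog ! f_upd = b_upd" "prog ! f_rnd = b_rnd"
  "prog ! f_iter = b_iter" "prog ! f_prop = b_prop" "prog ! f_rev = b_rev" "prog ! f_cand = b_cand"
  "prog ! f_variants = b_variants" "prog ! f_ok = b_ok" "prog ! f_fin = b_fin" "prog ! f_fin2 = b_fin2"
  "prog ! f_cnt = b_cnt" "prog ! f_meas = b_meas" "prog ! f_leq = b_leq" "prog ! f_heavy = b_heavy"
  "prog ! f_zeros = b_zeros" "prog ! f_units = b_units" "prog ! f_sel = b_sel" "prog ! f_fulls = b_fulls"
  "prog ! f_touched = b_touched" "prog ! f_similar = b_similar" "prog ! f_merge = b_merge"
  "prog ! f_pair2 = b_pair2" "prog ! f_pair1 = b_pair1" "prog ! f_dflt = b_dflt" "prog ! f_solve = b_solve"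
  "prog ! f_node = b_node" "prog ! f_some = b_some" "prog ! f_option = b_option" "prog ! f_mul = b_mul"
  "prog ! f_pow = b_pow" "prog ! f_search = b_search" "prog ! f_strike = b_strike" "prog ! f_full = b_full"
  by (simp_all add: prog_def)

section \<open>Values and running times of the functions\<close>

text \<open>A weakest precondition that also sees the cost, so that evaluating a program becomes
  rewriting with \<open>wp_simps\<close>.\<close>

definition wp :: "tree list \<Rightarrow> expr \<Rightarrow> (tree \<Rightarrow> nat \<Rightarrow> bool) \<Rightarrow> bool" where
  "wp env e Q \<longleftrightarrow> (\<exists>v t. eval prog env e v t \<and> Q v t)"

definition wps :: "tree list \<Rightarrow> expr list \<Rightarrow> (tree list \<Rightarrow> nat \<Rightarrow> bool) \<Rightarrow> bool" where
  "wps env es Q \<longleftrightarrow> (\<exists>vs t. evals prog env es vs t \<and> Q vs t)"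

definition body :: "nat \<Rightarrow> tree list \<Rightarrow> (tree \<Rightarrow> nat \<Rightarrow> bool) \<Rightarrow> bool" where
  "body f args Q \<longleftrightarrow> wp args (prog ! f) Q"

lemma eval_iff:
  "eval P env (Param i) v t \<longleftrightarrow> i < length env \<and> v = env ! i \<and> t = 1"
  "eval P env LeafE v t \<longleftrightarrow> v = Leaf \<and> t = 1"
  "eval P env (NodeE a b) v t \<longleftrightarrow>
     (\<exists>x s y s'. eval P env a x s \<and> eval P env b y s' \<and> v = Node x y \<and> t = s + s' + 1)"
  "eval P env (LeftE a) v t \<longleftrightarrow> (\<exists>x s. eval P env a x s \<and> v = left x \<and> t = s + 1)"
  "eval P env (RightE a) v t \<longleftrightarrow> (\<exists>x s. eval P env a x s \<and> v = right x \<and> t = s + 1)"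
  "eval P env (IfNode c a b) v t \<longleftrightarrow> (\<exists>x s s'. eval P env c x s \<and>
     eval P env (if x = Leaf then b else a) v s' \<and> t = s + s' + 1)"
  "eval P env (Call f es) v t \<longleftrightarrow> (\<exists>vs s s'. f < length P \<and> evals P env es vs s \<and>
     eval P vs (P ! f) v s' \<and> t = s + s' + 1)"
  "evals P env [] vs t \<longleftrightarrow> vs = [] \<and> t = 0"
  "evals P env (e # es) vs t \<longleftrightarrow> (\<exists>v s vs' s'. eval P env e v s \<and> evals P env es vs' s' \<and>
     vs = v # vs' \<and> t = s + s')"
proof -
  show "eval P env (IfNode c a b) v t \<longleftrightarrow> (\<exists>x s s'. eval P env c x s \<and>
     eval P env (if x = Leaf then b else a) v s' \<and> t = s + s' + 1)" (is "?l \<longleftrightarrow> ?r")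
  proof
    assume ?l
    then show ?r
      by cases (rule exI, rule exI, rule exI, rule conjI, assumption, simp)+
  next
    assume ?r
    then obtain x s s' where x: "eval P env c x s" "eval P env (if x = Leaf then b else a) v s'" "t = s + s' + 1"
      by blast
    show ?l
    proof (cases x)
      case Leaf then show ?thesis using x IfFalse[of P env c s b v s' a] by simp
    next
      case (Node y z) then show ?thesis using x IfTrue[of P env c y z s a v s' b] by simp
    qed
  qed
qed (force elim: eval_elims intro: eval_evals.intros[simplified])+

lemma wp_Param: "wp env (Param i) Q \<longleftrightarrow> i < length env \<and> Q (env ! i) 1"
  unfolding wp_def eval_iff by blast

lemma wp_LeafE: "wp env LeafE Q \<longleftrightarrow> Q Leaf 1"
  unfolding wp_def eval_iff by blast

lemma wp_NodeE: "wp env (NodeE a b) Q \<longleftrightarrow> wp env a (\<lambda>x s. wp env b (\<lambda>y t. Q (Node x y) (s + t + 1)))"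
  unfolding wp_def eval_iff by blast

lemma wp_LeftE: "wp env (LeftE a) Q \<longleftrightarrow> wp env a (\<lambda>x s. Q (left x) (s + 1))"
  unfolding wp_def eval_iff by blast

lemma wp_RightE: "wp env (RightE a) Q \<longleftrightarrow> wp env a (\<lambda>x s. Q (right x) (s + 1))"
  unfolding wp_def eval_iff by blast

lemma wp_IfNode: "wp env (IfNode c a b) Q \<longleftrightarrow> wp env c (\<lambda>x s. if x = Leaf
    then wp env b (\<lambda>v t. Q v (s + t + 1)) else wp env a (\<lambda>v t. Q v (s + t + 1)))"
proof -
  have "wp env (IfNode c a b) Q \<longleftrightarrow>
      wp env c (\<lambda>x s. wp env (if x = Leaf then b else a) (\<lambda>v t. Q v (s + t + 1)))"
    unfolding wp_def eval_iff by blast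
  then show ?thesis by (simp add: if_distrib[of "\<lambda>e. wp env e _"])
qed

lemma wp_Call: "wp env (Call f es) Q \<longleftrightarrow> f < 40 \<and> wps env es (\<lambda>vs s. body f vs (\<lambda>v t. Q v (s + t + 1)))"
  unfolding wp_def wps_def body_def eval_iff length_prog by blast

lemma wps_Nil: "wps env [] Q \<longleftrightarrow> Q [] 0"
  unfolding wps_def eval_iff by blast

lemma wps_Cons: "wps env (e # es) Q \<longleftrightarrow> wp env e (\<lambda>v s. wps env es (\<lambda>vs t. Q (v # vs) (s + t)))"
  unfolding wps_def wp_def eval_iff by blast

lemmas wp_simps = wp_Param wp_LeafE wp_NodeE wp_LeftE wp_RightE wp_IfNode wp_Call wps_Nil wps_Cons

definition fn :: "nat \<Rightarrow> tree list \<Rightarrow> tree \<Rightarrow> nat \<Rightarrow> bool" where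
  "fn f args v T \<longleftrightarrow> body f args (\<lambda>v' t. v' = v \<and> t \<le> T)"

text \<open>Evaluation is deterministic; the exact cost is needed to evaluate calls by rewriting, while
  only bounds on it are ever proved.\<close>

definition cst :: "nat \<Rightarrow> tree list \<Rightarrow> nat" where
  "cst f args = (THE t. \<exists>v. eval prog args (prog ! f) v t)"

text \<open>With a bound for a function, a call rewrites to its result and the opaque number
  \<open>cst f args\<close>; linear arithmetic then only needs the bound on that number.\<close>

lemma fn_body: "fn f args v T \<Longrightarrow> body f args Q \<longleftrightarrow> Q v (cst f args)"
  and fn_cst: "fn f args v T \<Longrightarrow> cst f args \<le> T"
proof -
  assume "fn f args v T"
  then obtain t where t: "eval prog args (prog ! f) v t" "t \<le> T"
    unfolding fn_def body_def wp_def by blast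
  have u: "v' = v \<and> t' = t" if "eval prog args (prog ! f) v' t'" for v' t'
    using eval_deterministic(1)[OF t(1) that] by blast
  have c: "cst f args = t" unfolding cst_def using t(1) u by (intro the_equality) blast+
  then show "cst f args \<le> T" using t by simp
  show "body f args Q \<longleftrightarrow> Q v (cst f args)" unfolding body_def wp_def c using t u by blast
qed

lemma fn_mono: "fn f args v T \<Longrightarrow> T \<le> T' \<Longrightarrow> fn f args v T'"
  using fn_body[of f args v T] fn_cst[of f args v T] unfolding fn_def by auto

lemma fnI: "wp args (prog ! f) (\<lambda>v' t. v' = v \<and> t \<le> T) \<Longrightarrow> fn f args v T"
  by (simp add: fn_def body_def)

section \<open>Encodings and operations on bit vectors\<close>

abbreviation ebl :: "bool list \<Rightarrow> tree" where "ebl l \<equiv> enc_list (map enc_bool l)"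
definition ent :: "bool list \<times> bool list \<Rightarrow> tree" where "ent e = Node (ebl (fst e)) (ebl (snd e))"
abbreviation est :: "state \<Rightarrow> tree" where "est st \<equiv> enc_list (map ent st)"
text \<open>Unary numbers as lists of leaves: \<open>f_rev\<close> then adds, and
  \<open>f_zeros\<close> turns a list into its length.\<close>

definition num :: "nat \<Rightarrow> tree" where "num k = enc_list (replicate k Leaf)"

lemma num_simps [simp]: "num 0 = Leaf" "num (Suc k) = Node Leaf (num k)"
  by (simp_all add: num_def)

lemma enc_list_Leaf [simp]: "enc_list xs = Leaf \<longleftrightarrow> xs = []"
  by (cases xs) auto

lemma ent_sel [simp]: "left (ent e) = ebl (fst e)" "right (ent e) = ebl (snd e)" "ent e \<noteq> Leaf"
  by (simp_all add: ent_def)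

lemma vec_simps [simp]:
  "vand [] [] = []" "vand (x # a) (y # b) = (x \<and> y) # vand a b"
  "vdiff [] [] = []" "vdiff (x # a) (y # b) = (x \<and> \<not> y) # vdiff a b"
  "vor [] [] = []" "vor (x # a) (y # b) = (x \<or> y) # vor a b"
  "vany [] = False" "vany (x # a) = (x \<or> vany a)"
  by (auto simp: vand_def vdiff_def vor_def vany_def)

lemma fn_vand: "length a = length b \<Longrightarrow> fn f_vand [ebl a, ebl b] (ebl (vand a b)) (20 * length a + 20)"
proof (induction a b rule: list_induct2)
  case Nil
  show ?case by (rule fnI) (simp add: prog_nth b_vand_def wp_simps)
next
  case (Cons x a y b)
  note IH = fn_body[OF Cons.IH] fn_cst[OF Cons.IH]
  show ?case
    using IH(2) by (cases x; cases y; intro fnI) (simp_all add: prog_nth b_vand_def wp_simps IH(1))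
qed

lemma fn_vdiff: "length a = length b \<Longrightarrow> fn f_vdiff [ebl a, ebl b] (ebl (vdiff a b)) (20 * length a + 20)"
proof (induction a b rule: list_induct2)
  case Nil
  show ?case by (rule fnI) (simp add: prog_nth b_vdiff_def wp_simps)
next
  case (Cons x a y b)
  note IH = fn_body[OF Cons.IH] fn_cst[OF Cons.IH]
  show ?case
    using IH(2) by (cases x; cases y; intro fnI) (simp_all add: prog_nth b_vdiff_def wp_simps IH(1))
qed

lemma fn_vor: "length a = length b \<Longrightarrow> fn f_vor [ebl a, ebl b] (ebl (vor a b)) (20 * length a + 20)"
proof (induction a b rule: list_induct2)
  case Nil
  show ?case by (rule fnI) (simp add: prog_nth b_vor_def wp_simps)
next
  case (Cons x a y b)
  note IH = fn_body[OF Cons.IH] fn_cst[OF Cons.IH]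
  show ?case
    using IH(2) by (cases x; cases y; intro fnI) (simp_all add: prog_nth b_vor_def wp_simps IH(1))
qed

lemma fn_any: "fn f_any [ebl a] (enc_bool (vany a)) (20 * length a + 20)"
proof (induction a)
  case Nil
  show ?case by (rule fnI) (simp add: prog_nth b_any_def wp_simps)
next
  case (Cons x a)
  note IH = fn_body[OF Cons.IH] fn_cst[OF Cons.IH]
  show ?case
    using IH(2) by (cases x; intro fnI) (simp_all add: prog_nth b_any_def wp_simps IH(1))
qed

lemma ent_Pair [simp]: "ent (a, b) = Node (ebl a) (ebl b)"
  by (simp add: ent_def)

definition rows :: "nat \<Rightarrow> state \<Rightarrow> bool" where
  "rows n st \<longleftrightarrow> (\<forall>e \<in> set st. length (fst e) = 3 \<and> length (snd e) = n)"

lemma rows_simps [simp]: "rows n []" "rows n (e # st) \<longleftrightarrow> length (fst e) = 3 \<and> length (snd e) = n \<and> rows n st"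
  by (auto simp: rows_def)

lemma rows_shaped: "shaped n st \<Longrightarrow> rows n st"
  unfolding rows_def using shaped_nth shaped_length by (metis in_set_conv_nth)

lemma wp_mask: "c < 3 \<Longrightarrow> wp env (mask_expr c) Q \<longleftrightarrow> Q (ebl (mask c)) 9"
  by (erule less_3_cases) (simp_all add: mask_expr_def wp_simps mask_def eval_nat_numeral)

lemma fn_strike:
  assumes "length b = 3" "length l = 3"
  shows "fn f_strike [ebl b, ebl l] (ebl (strike b l)) 60"
proof -
  obtain x y z where b: "b = [x, y, z]" using length_3[OF assms(1)] .
  obtain u v w where l: "l = [u, v, w]" using length_3[OF assms(2)] .
  show ?thesis unfolding b l
    by (rule fnI, cases x; cases y; cases z; cases u; cases v; cases w)
      (simp_all add: prog_nth b_strike_def wp_simps strike_def)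
qed

lemma fn_full:
  assumes "length l = 3"
  shows "fn f_full [ebl l] (enc_bool (full l)) 40"
proof -
  obtain u v w where l: "l = [u, v, w]" using length_3[OF assms] .
  show ?thesis unfolding l
    by (rule fnI, cases u; cases v; cases w)
      (simp_all add: prog_nth b_full_def wp_simps full_def)
qed

lemma fn_rev: "fn f_rev [enc_list a, enc_list b] (enc_list (rev a @ b)) (20 * length a + 20)"
proof (induction a arbitrary: b)
  case Nil
  show ?case by (rule fnI) (simp add: prog_nth b_rev_def wp_simps)
next
  case (Cons x a)
  note IH = fn_body[OF Cons.IH[of "x # b"], simplified] fn_cst[OF Cons.IH[of "x # b"], simplified]
  show ?case using IH(2) by (intro fnI) (simp add: prog_nth b_rev_def wp_simps IH(1))
qed

lemma fn_zeros: "fn f_zeros [enc_list xs] (enc_list (replicate (length xs) Leaf)) (20 * length xs + 20)"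
proof (induction xs)
  case Nil
  show ?case by (rule fnI) (simp add: prog_nth b_zeros_def wp_simps)
next
  case (Cons x a)
  note IH = fn_body[OF Cons.IH] fn_cst[OF Cons.IH]
  show ?case using IH(2) by (intro fnI) (simp add: prog_nth b_zeros_def wp_simps IH(1))
qed

lemma fn_cnt: "fn f_cnt [ebl l, num a] (num (a + length (filter id l))) (20 * length l + 20)"
proof (induction l arbitrary: a)
  case Nil
  show ?case by (rule fnI) (simp add: prog_nth b_cnt_def wp_simps)
next
  case (Cons x l)
  note IH = fn_body[OF Cons.IH] fn_cst[OF Cons.IH]
  note IH' = fn_body[OF Cons.IH[of "Suc a"], simplified] fn_cst[OF Cons.IH[of "Suc a"], simplified]
  show ?case using IH(2)[of a] IH'(2)
    by (cases x; intro fnI) (simp_all add: prog_nth b_cnt_def wp_simps IH(1) IH'(1))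
qed

lemma meas_simps [simp]: "meas [] = 0" "meas (e # st) = length (filter id (fst e)) + meas st"
  by (simp_all add: meas_def)

lemma fn_meas: "rows n st \<Longrightarrow> fn f_meas [est st, num a] (num (a + meas st)) (100 * length st + 20)"
proof (induction st arbitrary: a)
  case Nil
  show ?case by (rule fnI) (simp add: prog_nth b_meas_def wp_simps)
next
  case (Cons e st)
  have r: "rows n st" "length (fst e) = 3" using Cons.prems by auto
  note C = fn_body[OF fn_cnt] fn_cst[OF fn_cnt]
  note IH = fn_body[OF Cons.IH[OF r(1)]] fn_cst[OF Cons.IH[OF r(1)]]
  show ?case using IH(2)[of "a + length (filter id (fst e))"] C(2)[of "fst e" a] r(2)
    by (intro fnI) (simp add: prog_nth b_meas_def wp_simps IH(1) C(1) add.assoc)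
qed

lemma fn_leq: "fn f_leq [num a, num b] (enc_bool (a \<le> b)) (20 * b + 20)"
proof (induction a arbitrary: b)
  case 0
  show ?case by (rule fnI) (simp add: prog_nth b_leq_def wp_simps)
next
  case (Suc a)
  note IH = fn_body[OF Suc.IH] fn_cst[OF Suc.IH]
  show ?case
  proof (cases b)
    case 0
    then show ?thesis by (intro fnI) (simp add: prog_nth b_leq_def wp_simps)
  next
    case (Suc c)
    show ?thesis using IH(2)[of c] unfolding Suc by (intro fnI) (simp add: prog_nth b_leq_def wp_simps IH(1))
  qed
qed

lemma fn_ok: "rows n st \<Longrightarrow> fn f_ok [est st] (enc_bool (ok st)) (200 * length st + 20)"
proof (induction st)
  case Nil
  show ?case by (rule fnI) (simp add: prog_nth b_ok_def wp_simps ok_def)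
next
  case (Cons e st)
  have r: "rows n st" "length (fst e) = 3" using Cons.prems by auto
  note C = fn_body[OF fn_any] fn_cst[OF fn_any[of "fst e"]]
  note IH = fn_body[OF Cons.IH[OF r(1)]] fn_cst[OF Cons.IH[OF r(1)]]
  have o: "ok (e # st) \<longleftrightarrow> vany (fst e) \<and> ok st" by (simp add: ok_def)
  show ?case using IH(2) C(2) r(2) unfolding o
    by (intro fnI, cases "vany (fst e)") (simp_all add: prog_nth b_ok_def wp_simps IH(1) C(1))
qed

section \<open>Propagation, candidate assignments and the two-colour stage\<close>

definition "cU n = 100 * n + (100 :: nat)"
definition "cR n = n * (cU n + 100) + (100 :: nat)"
definition "cI n = n * (cR n + 100) + (100 :: nat)"
definition "cP n = 3 * cI n + (100 :: nat)"

lemma fn_upd: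
  "length b = 3 \<Longrightarrow> length r \<le> length st \<Longrightarrow> rows n st \<Longrightarrow>
    fn f_upd [ebl b, ebl r, est st] (ebl (upd b r st)) (100 * length r + 100)"
proof (induction r arbitrary: b st)
  case Nil
  show ?case by (rule fnI) (simp add: prog_nth b_upd_def wp_simps)
next
  case (Cons x r)
  obtain e st' where st: "st = e # st'" using Cons.prems by (cases st) auto
  have e: "length (fst e) = 3" using Cons.prems st by auto
  have sl: "length (strike b (fst e)) = 3" by (simp add: strike_def)
  note S = fn_body[OF fn_strike[OF Cons.prems(1) e]] fn_cst[OF fn_strike[OF Cons.prems(1) e]]
  have H: "fn f_upd [ebl b, ebl r, est st'] (ebl (upd b r st')) (100 * length r + 100)"
    and H': "fn f_upd [ebl (strike b (fst e)), ebl r, est st'] (ebl (upd (strike b (fst e)) r st')) (100 * length r + 100)"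
    using Cons.IH[of _ st'] Cons.prems st sl by simp_all
  note IH = fn_body[OF H] fn_cst[OF H] fn_body[OF H'] fn_cst[OF H']
  show ?case unfolding st using IH(2,4) S(2)
    by (cases x; intro fnI) (simp_all add: prog_nth b_upd_def wp_simps IH(1,3) S(1))
qed

lemma fn_rnd:
  assumes "rows n st" "length st = n"
  shows "rows n rest \<Longrightarrow> fn f_rnd [est rest, est st] (est (map (\<lambda>e. (upd (fst e) (snd e) st, snd e)) rest))
    (length rest * (cU n + 100) + 100)"
proof (induction rest)
  case Nil
  show ?case by (rule fnI) (simp add: prog_nth b_rnd_def wp_simps)
next
  case (Cons e rest)
  have U: "fn f_upd [ebl (fst e), ebl (snd e), est st] (ebl (upd (fst e) (snd e) st)) (cU n)"
    using fn_upd[of "fst e" "snd e" st n] Cons.prems assms by (simp add: cU_def)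
  have H: "fn f_rnd [est rest, est st] (est (map (\<lambda>e. (upd (fst e) (snd e) st, snd e)) rest))
    (length rest * (cU n + 100) + 100)" using Cons by simp
  show ?case using fn_cst[OF H] fn_cst[OF U]
    by (intro fnI) (simp add: prog_nth b_rnd_def wp_simps fn_body[OF H] fn_body[OF U])
qed

lemma fn_iter:
  "shaped n st \<Longrightarrow> fn f_iter [enc_list xs, est st] (est ((rnd ^^ length xs) st)) (length xs * (cR n + 100) + 100)"
proof (induction xs arbitrary: st)
  case Nil
  show ?case by (rule fnI) (simp add: prog_nth b_iter_def wp_simps)
next
  case (Cons x xs)
  have R: "fn f_rnd [est st, est st] (est (rnd st)) (cR n)"
    using fn_rnd[OF rows_shaped[OF Cons.prems] shaped_length[OF Cons.prems] rows_shaped[OF Cons.prems]]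
    unfolding rnd_def shaped_length[OF Cons.prems] cR_def .
  note H = Cons.IH[OF shaped_rnd[OF Cons.prems]]
  show ?case using fn_cst[OF H] fn_cst[OF R]
    by (intro fnI) (simp add: prog_nth b_iter_def wp_simps fn_body[OF H] fn_body[OF R] funpow_swap1)
qed

lemma fn_prop:
  assumes "shaped n st"
  shows "fn f_prop [est st] (est (propagate st)) (cP n)"
proof -
  let ?r = "rnd ^^ n"
  note len = shaped_length[OF assms]
  have I: "fn f_iter [est st, est s] (est (?r s)) (cI n)" if "shaped n s" for s
    using fn_iter[OF that, of "map ent st"] by (simp add: len cI_def)
  note s1 = shaped_propagate[OF assms, of n]
  note s2 = shaped_propagate[OF s1, of n]
  have p: "propagate st = ?r (?r (?r st))"
    unfolding propagate_def len by (simp add: numeral_3_eq_3 funpow_add)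
  show ?thesis unfolding p
    using fn_cst[OF I[OF assms]] fn_cst[OF I[OF s1]] fn_cst[OF I[OF s2]]
    by (intro fnI) (simp add: prog_nth b_prop_def wp_simps fn_body[OF I[OF assms]] fn_body[OF I[OF s1]]
        fn_body[OF I[OF s2]] cP_def)
qed

abbreviation evs :: "(state \<times> state) list \<Rightarrow> tree" where
  "evs vs \<equiv> enc_list (map (\<lambda>q. Node (est (fst q)) (est (snd q))) vs)"

definition "cC n = 40 * n + (1000 :: nat)"
definition "cV n = n * (3 * cC n + 200) + (100 :: nat)"

lemma fn_cand:
  assumes "length (fst e) = 3" "length pre \<le> n" "length m = 3"
  shows "fn f_cand [est pre, ent e, est post, ebl m, evs acc] (evs (cand pre e post m @ acc)) (cC n)"
proof -
  have A: "fn f_vand [ebl (fst e), ebl m] (ebl (vand (fst e) m)) 80"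
    and D: "fn f_vdiff [ebl (fst e), ebl m] (ebl (vdiff (fst e) m)) 80"
    using fn_vand[of "fst e" m] fn_vdiff[of "fst e" m] assms by simp_all
  have l: "length (vand (fst e) m) = 3" "length (vdiff (fst e) m) = 3"
    using assms by (simp_all add: vand_def vdiff_def)
  have a: "fn f_any [ebl (vand (fst e) m)] (enc_bool (vany (vand (fst e) m))) 80"
    "fn f_any [ebl (vdiff (fst e) m)] (enc_bool (vany (vdiff (fst e) m))) 80"
    using fn_any[of "vand (fst e) m"] fn_any[of "vdiff (fst e) m"] l by simp_all
  have R: "fn f_rev [est pre, Node (Node (ebl x) (ebl (snd e))) (est post)]
      (est (rev pre @ (x, snd e) # post)) (20 * length pre + 20)" for x
    using fn_rev[of "map ent pre" "ent (x, snd e) # map ent post"] by (simp add: rev_map)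
  show ?thesis using assms(2)
      fn_cst[OF A] fn_cst[OF D] fn_cst[OF a(1)] fn_cst[OF a(2)] fn_cst[OF R[of "vand (fst e) m"]] fn_cst[OF R[of "vdiff (fst e) m"]]
    by (intro fnI, cases "vany (vand (fst e) m)"; cases "vany (vdiff (fst e) m)")
      (simp_all add: prog_nth b_cand_def wp_simps fn_body[OF A] fn_body[OF D] fn_body[OF a(1)] fn_body[OF a(2)]
        fn_body[OF R] cand_def cC_def)
qed

lemma fn_variants:
  "rows n post \<Longrightarrow> length pre + length post \<le> n \<Longrightarrow>
    fn f_variants [est pre, est post] (evs (variants pre post)) (length post * (3 * cC n + 200) + 100)"
proof (induction post arbitrary: pre)
  case Nil
  show ?case by (rule fnI) (simp add: prog_nth b_variants_def wp_simps)
next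
  case (Cons e es)
  have H: "fn f_variants [Node (ent e) (est pre), est es] (evs (variants (e # pre) es)) (length es * (3 * cC n + 200) + 100)"
    using Cons.IH[of "e # pre"] Cons.prems by simp
  have C: "fn f_cand [est pre, ent e, est es, ebl (mask c), evs acc] (evs (cand pre e es (mask c) @ acc)) (cC n)" for c acc
    by (rule fn_cand) (use Cons.prems in \<open>auto simp: mask_def\<close>)
  let ?v = "variants (e # pre) es"
  note C2 = C[of 2 ?v]
  note C1 = C[of 1 "cand pre e es (mask 2) @ ?v"]
  note C0 = C[of 0 "cand pre e es (mask 1) @ cand pre e es (mask 2) @ ?v"]
  show ?case using fn_cst[OF H] fn_cst[OF C2] fn_cst[OF C1] fn_cst[OF C0]
    by (intro fnI) (simp add: prog_nth b_variants_def wp_simps wp_mask fn_body[OF H]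
      fn_body[OF C2] fn_body[OF C1, simplified] fn_body[OF C0, simplified])
qed

lemma length_variants: "length (variants pre es) \<le> 3 * length es"
proof (induction pre es rule: variants.induct)
  case (2 pre e es)
  have "length (cand pre e es m) \<le> 1" for m by (simp add: cand_def)
  from this[of "mask 0"] this[of "mask 1"] this[of "mask 2"] 2 show ?case by simp
qed simp

lemma fn_variants':
  assumes "shaped n st"
  shows "fn f_variants [Leaf, est st] (evs (variants [] st)) (cV n)"
  using fn_variants[OF rows_shaped[OF assms], of "[]"] shaped_length[OF assms] by (simp add: cV_def)

lemma fn_ok': "shaped n st \<Longrightarrow> fn f_ok [est st] (enc_bool (ok st)) (200 * n + 20)"
  using fn_ok[OF rows_shaped] shaped_length by metis

definition "cFs n = 2 * cV n + 3 * n * (2 * cP n + (200 * n + 20) + 200) + (200 * n + 20) + (200 :: nat)"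

text \<open>The scan of \<open>fin\<close> over the candidates not yet tried, stated separately so
  that \<open>fn_fin2\<close> can use induction on that list.\<close>

definition fin2 :: "nat \<Rightarrow> (state \<times> state) list \<Rightarrow> state \<Rightarrow> bool" where
  "fin2 k vs st = (case find (\<lambda>q. ok (propagate (fst q))) vs of
      Some q \<Rightarrow> fin k (propagate (fst q)) | None \<Rightarrow> variants [] st = [] \<and> ok st)"

lemma fn_fin2:
  assumes IH: "\<And>s. wf_state n s \<Longrightarrow> fn f_fin [num k, est s] (enc_bool (fin k s)) T" and "wf_state n st"
  shows "\<forall>q \<in> set vs. wf_state n (fst q) \<Longrightarrow> fn f_fin2 [num k, evs vs, est st] (enc_bool (fin2 k vs st))
    (length vs * (2 * cP n + (200 * n + 20) + 200) + cV n + (200 * n + 20) + T + 100)"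
proof (induction vs)
  case Nil
  have s: "shaped n st" using assms wf_shaped by blast
  show ?case using fn_cst[OF fn_variants'[OF s]] fn_cst[OF fn_ok'[OF s]]
    by (intro fnI, cases "variants [] st = []")
      (simp_all add: prog_nth b_fin2_def wp_simps fn_body[OF fn_variants'[OF s]] fn_body[OF fn_ok'[OF s]] fin2_def)
next
  case (Cons q vs)
  have w: "wf_state n (fst q)" using Cons.prems by simp
  note s = wf_shaped[OF w]
  note P = fn_prop[OF s]
  note O = fn_ok'[OF propagate(1)[OF s]]
  note F = IH[OF wf_propagate[OF w]]
  have H: "fn f_fin2 [num k, evs vs, est st] (enc_bool (fin2 k vs st))
    (length vs * (2 * cP n + (200 * n + 20) + 200) + cV n + (200 * n + 20) + T + 100)"
    using Cons by simp
  have f: "fin2 k (q # vs) st = (if ok (propagate (fst q)) then fin k (propagate (fst q)) else fin2 k vs st)"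
    by (simp add: fin2_def)
  show ?case using fn_cst[OF P] fn_cst[OF O] fn_cst[OF F] fn_cst[OF H] unfolding f
    by (intro fnI, cases "ok (propagate (fst q))")
      (simp_all add: prog_nth b_fin2_def wp_simps fn_body[OF P] fn_body[OF O] fn_body[OF F] fn_body[OF H])
qed

lemma fn_fin: "wf_state n st \<Longrightarrow> fn f_fin [num k, est st] (enc_bool (fin k st)) (k * cFs n + 100)"
proof (induction k arbitrary: st)
  case 0
  show ?case by (rule fnI) (simp add: prog_nth b_fin_def wp_simps)
next
  case (Suc k)
  have s: "shaped n st" using Suc.prems by (rule wf_shaped)
  note V = fn_variants'[OF s]
  have "\<forall>q \<in> set (variants [] st). wf_state n (fst q)" using variant_state(1)[OF Suc.prems] by blast
  from fn_fin2[OF Suc.IH Suc.prems this]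
  have F: "fn f_fin2 [num k, evs (variants [] st), est st] (enc_bool (fin2 k (variants [] st) st))
    (length (variants [] st) * (2 * cP n + (200 * n + 20) + 200) + cV n + (200 * n + 20) + (k * cFs n + 100) + 100)" .
  have "length (variants [] st) * (2 * cP n + (200 * n + 20) + 200) \<le> 3 * n * (2 * cP n + (200 * n + 20) + 200)"
    using length_variants[of "[]" st] shaped_length[OF s] by (intro mult_le_mono1) simp
  moreover define a where "a = 3 * n * (2 * cP n + (200 * n + 20) + 200)"
  ultimately have "cst f_fin2 [num k, evs (variants [] st), est st] \<le> a + cV n + (200 * n + 20) + (k * cFs n + 100) + 100"
    using fn_cst[OF F] by linarith
  moreover have "cFs n = 2 * cV n + a + (200 * n + 20) + 200" unfolding cFs_def a_def ..
  ultimately have c: "cst f_fin2 [num k, evs (variants [] st), est st] + cst f_variants [Leaf, est st] + 100 \<le> Suc k * cFs n + 100"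
    using fn_cst[OF V] by simp
  have f: "fin (Suc k) st = fin2 k (variants [] st) st" by (simp add: fin2_def)
  show ?case using c unfolding f
    by (intro fnI) (simp add: prog_nth b_fin_def wp_simps fn_body[OF V] fn_body[OF F])
qed

section \<open>Finding a free step\<close>

fun eopt :: "state option \<Rightarrow> tree" where
  "eopt None = Leaf"
| "eopt (Some s) = Node (est s) Leaf"

definition "cHs n = cP n + 260 * n + (300 :: nat)"

lemma fn_heavy:
  assumes st: "shaped n st"
  shows "\<forall>q \<in> set vs. shaped n (fst q) \<Longrightarrow> fn f_heavy [evs vs, est st, num d]
    (eopt (map_option snd (find (\<lambda>q. meas (propagate (fst q)) + d \<le> meas st) vs))) (length vs * cHs n + 100)"
proof (induction vs)
  case Nil
  show ?case by (rule fnI) (simp add: prog_nth b_heavy_def wp_simps)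
next
  case (Cons q vs)
  have s: "shaped n (fst q)" using Cons.prems by simp
  note P = fn_prop[OF s]
  note M1 = fn_meas[OF rows_shaped[OF propagate(1)[OF s]], of d, unfolded shaped_length[OF propagate(1)[OF s]]]
  note M0 = fn_meas[OF rows_shaped[OF st], of 0, unfolded shaped_length[OF st] num_simps(1) add_0_left]
  note L = fn_leq[of "meas (propagate (fst q)) + d" "meas st"]
  have H: "fn f_heavy [evs vs, est st, num d]
    (eopt (map_option snd (find (\<lambda>q. meas (propagate (fst q)) + d \<le> meas st) vs))) (length vs * cHs n + 100)"
    using Cons by simp
  have l: "cst f_leq [num (meas (propagate (fst q)) + d), num (meas st)] \<le> 60 * n + 20"
    using fn_cst[OF L] meas_le[OF st] by linarith
  show ?case using fn_cst[OF P] fn_cst[OF M1] fn_cst[OF M0] l fn_cst[OF H]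
    by (intro fnI, cases "meas (propagate (fst q)) + d \<le> meas st")
      (simp_all add: prog_nth b_heavy_def wp_simps fn_body[OF P] fn_body[OF M1] fn_body[OF M0] fn_body[OF L]
        fn_body[OF H] add.commute[of d] cHs_def)
qed

lemma unit_split: "i < n \<Longrightarrow> unit n i = replicate i False @ True # replicate (n - Suc i) False"
  by (rule nth_equalityI) (auto simp: nth_append nth_Cons split: nat.splits)

definition "cUs n = 40 * n + (200 :: nat)"

lemma fn_units:
  "i + length xs = n \<Longrightarrow> fn f_units [enc_list (replicate i Leaf), enc_list xs]
     (enc_list (map (\<lambda>k. ebl (unit n k)) [i..<n])) (length xs * cUs n + 100)"
proof (induction xs arbitrary: i)
  case Nil
  then show ?case by (intro fnI) (simp add: prog_nth b_units_def wp_simps)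
next
  case (Cons x xs)
  have i: "i < n" "n - Suc i = length xs" using Cons.prems by auto
  note Z = fn_zeros[of xs]
  have u: "map enc_bool (unit n i) = replicate i Leaf @ Node Leaf Leaf # replicate (length xs) Leaf"
    using i by (simp add: unit_split map_replicate)
  have R: "fn f_rev [enc_list (replicate i Leaf), Node (Node Leaf Leaf) (enc_list (replicate (length xs) Leaf))]
     (ebl (unit n i)) (20 * i + 20)"
    using fn_rev[of "replicate i Leaf" "Node Leaf Leaf # replicate (length xs) Leaf"] by (simp add: u)
  have H: "fn f_units [Node Leaf (enc_list (replicate i Leaf)), enc_list xs]
     (enc_list (map (\<lambda>k. ebl (unit n k)) [Suc i..<n])) (length xs * cUs n + 100)"
    using Cons.IH[of "Suc i"] Cons.prems by simp
  show ?case using fn_cst[OF Z] fn_cst[OF R] fn_cst[OF H] Cons.prems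
    by (intro fnI) (simp add: prog_nth b_units_def wp_simps fn_body[OF Z] fn_body[OF R] fn_body[OF H]
      upt_conv_Cons[OF i(1)] cUs_def)
qed

lemma fn_sel_aux:
  "i < length st \<Longrightarrow> fn f_sel [enc_list (replicate i Leaf @ Node Leaf Leaf # us), est st] (ent (st ! i)) (20 * i + 20)"
proof (induction i arbitrary: st)
  case 0
  then obtain e st' where "st = e # st'" by (cases st) auto
  then show ?case by (intro fnI) (simp add: prog_nth b_sel_def wp_simps)
next
  case (Suc i)
  then obtain e st' where st: "st = e # st'" by (cases st) auto
  have H: "fn f_sel [enc_list (replicate i Leaf @ Node Leaf Leaf # us), est st'] (ent (st' ! i)) (20 * i + 20)"
    using Suc st by simp
  show ?case unfolding st using fn_cst[OF H]
    by (intro fnI) (simp add: prog_nth b_sel_def wp_simps fn_body[OF H])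
qed

lemma fn_sel:
  assumes "shaped n st" "i < n"
  shows "fn f_sel [ebl (unit n i), est st] (ent (st ! i)) (20 * n + 20)"
proof (rule fn_mono)
  show "fn f_sel [ebl (unit n i), est st] (ent (st ! i)) (20 * i + 20)"
    using fn_sel_aux[of i st "replicate (n - Suc i) Leaf"] assms(2) shaped_length[OF assms(1)]
    by (simp add: unit_split map_replicate)
qed (use assms in simp)

lemma fn_fulls: "rows n st \<Longrightarrow> fn f_fulls [est st] (ebl (map (\<lambda>e. full (fst e)) st)) (100 * length st + 100)"
proof (induction st)
  case Nil
  show ?case by (rule fnI) (simp add: prog_nth b_fulls_def wp_simps)
next
  case (Cons e st)
  have r: "rows n st" "length (fst e) = 3" using Cons.prems by auto
  note C = fn_full[OF r(2)]
  note H = Cons.IH[OF r(1)]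
  show ?case using fn_cst[OF H] fn_cst[OF C]
    by (intro fnI) (simp add: prog_nth b_fulls_def wp_simps fn_body[OF H] fn_body[OF C])
qed

definition "cTs n = 40 * n + (300 :: nat)"

lemma fn_touched:
  assumes "length m = n"
  shows "rows n st \<Longrightarrow> fn f_touched [est st, ebl m]
    (num (length (filter (\<lambda>e. full (fst e) \<and> vany (vand (snd e) m)) st))) (length st * cTs n + 100)"
proof (induction st)
  case Nil
  show ?case by (rule fnI) (simp add: prog_nth b_touched_def wp_simps)
next
  case (Cons e st)
  have r: "rows n st" "length (fst e) = 3" "length (snd e) = n" using Cons.prems by auto
  note C = fn_full[OF r(2)]
  have A: "fn f_vand [ebl (snd e), ebl m] (ebl (vand (snd e) m)) (20 * n + 20)"
    using fn_vand[of "snd e" m] r assms by simp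
  have B: "fn f_any [ebl (vand (snd e) m)] (enc_bool (vany (vand (snd e) m))) (20 * n + 20)"
    using fn_any[of "vand (snd e) m"] r assms by (simp add: vand_def)
  note H = Cons.IH[OF r(1)]
  show ?case using fn_cst[OF H] fn_cst[OF C] fn_cst[OF A] fn_cst[OF B]
    by (intro fnI, cases "full (fst e)"; cases "vany (vand (snd e) m)")
      (simp_all add: prog_nth b_touched_def wp_simps fn_body[OF H] fn_body[OF C] fn_body[OF A] fn_body[OF B] cTs_def)
qed

text \<open>With these congruence rules the simplifier evaluates programs by value: it does not
  descend into continuations.\<close>

lemma wp_cong: "env = env' \<Longrightarrow> e = e' \<Longrightarrow> wp env e Q \<longleftrightarrow> wp env' e' Q"
  and wps_cong: "env = env' \<Longrightarrow> wps env es Q' \<longleftrightarrow> wps env' es Q'"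
  and body_cong: "args = args' \<Longrightarrow> body f args Q \<longleftrightarrow> body f args' Q"
  by simp_all

lemmas eval_cong = wp_cong wps_cong body_cong

definition "cSs n = n * cTs n + 500 * n + (1000 :: nat)"

lemma vany_unit: "length r = n \<Longrightarrow> j < n \<Longrightarrow> vany (vand r (unit n j)) \<longleftrightarrow> r ! j"
  using vany_vand[of r n "unit n j"] by auto

lemma fn_similar:
  assumes s: "shaped n st" and i: "i < n" and j: "j < n"
  shows "fn f_similar [ent (st ! i), ent (st ! j), ebl (unit n i), ebl (unit n j), est st, num d]
    (enc_bool (similar d st i j)) (cSs n)"
proof -
  let ?ri = "snd (st ! i)" and ?rj = "snd (st ! j)"
  have l: "length (fst (st ! i)) = 3" "length (fst (st ! j)) = 3" "length ?ri = n" "length ?rj = n"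
    using shaped_nth[OF s] i j by auto
  note len = shaped_length[OF s]
  let ?f = "map (\<lambda>e. full (fst e)) st"
  let ?m = "vand (vand ?ri ?rj) ?f"
  have m: "length ?m = n" "length (vand ?ri ?rj) = n" using l len by (simp_all add: vand_def)
  note Fi = fn_full[OF l(1)]
  note Fj = fn_full[OF l(2)]
  have U: "fn f_vand [ebl (unit n i), ebl (unit n j)] (ebl (vand (unit n i) (unit n j))) (20 * n + 20)"
    using fn_vand[of "unit n i" "unit n j"] by simp
  define same where "same \<longleftrightarrow> i = j"
  have AU: "fn f_any [ebl (vand (unit n i) (unit n j))] (enc_bool same) (20 * n + 20)"
    using fn_any[of "vand (unit n i) (unit n j)"] vany_unit[of "unit n i" n j] i j
    by (simp add: vand_def eq_commute same_def)
  have R: "fn f_vand [ebl ?ri, ebl (unit n j)] (ebl (vand ?ri (unit n j))) (20 * n + 20)"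
    using fn_vand[of ?ri "unit n j"] l by simp
  have AR: "fn f_any [ebl (vand ?ri (unit n j))] (enc_bool (adj st i j)) (20 * n + 20)"
    using fn_any[of "vand ?ri (unit n j)"] vany_unit[of ?ri n j] l j by (simp add: vand_def adj_def)
  have RR: "fn f_vand [ebl ?ri, ebl ?rj] (ebl (vand ?ri ?rj)) (20 * n + 20)"
    using fn_vand[of ?ri ?rj] l by simp
  have FF: "fn f_fulls [est st] (ebl ?f) (100 * n + 100)"
    using fn_fulls[OF rows_shaped[OF s]] by (simp add: len)
  have MM: "fn f_vand [ebl (vand ?ri ?rj), ebl ?f] (ebl ?m) (20 * n + 20)"
    using fn_vand[of "vand ?ri ?rj" ?f] m len by simp
  have T: "fn f_touched [est st, ebl ?m] (num (touched st ?ri ?rj)) (n * cTs n + 100)"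
    using fn_touched[OF m(1) rows_shaped[OF s]] by (simp add: len touched_def)
  note L = fn_leq[of d "touched st ?ri ?rj"]
  have "touched st ?ri ?rj \<le> length st" unfolding touched_def by (rule length_filter_le)
  then have "touched st ?ri ?rj \<le> n" by (simp add: len)
  then have Lc: "cst f_leq [num d, num (touched st ?ri ?rj)] \<le> 20 * n + 20" using fn_cst[OF L] by linarith
  note bodies = fn_body[OF Fi] fn_body[OF Fj] fn_body[OF U] fn_body[OF AU] fn_body[OF R] fn_body[OF AR]
    fn_body[OF RR] fn_body[OF FF, simplified] fn_body[OF MM, simplified] fn_body[OF T] fn_body[OF L]
  note costs = fn_cst[OF Fi] fn_cst[OF Fj] fn_cst[OF U] fn_cst[OF AU] fn_cst[OF R] fn_cst[OF AR]
    fn_cst[OF RR] fn_cst[OF FF, simplified] fn_cst[OF MM, simplified] fn_cst[OF T] Lc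
  define c where "c = cSs n"
  have c: "80 + 8 * (20 * n + 20) + (100 * n + 100) + (n * cTs n + 100) + 300 \<le> c"
    by (simp add: c_def cSs_def)
  show ?thesis unfolding c_def[symmetric]
  proof (cases "full (fst (st ! i)) \<and> full (fst (st ! j)) \<and> \<not> same \<and> \<not> adj st i j")
    case True
    then have "similar d st i j \<longleftrightarrow> d \<le> touched st ?ri ?rj" by (simp add: similar_def same_def)
    then show "fn f_similar [ent (st ! i), ent (st ! j), ebl (unit n i), ebl (unit n j), est st, num d]
      (enc_bool (similar d st i j)) c"
      using costs c True by (intro fnI) (simp add: prog_nth b_similar_def wp_simps bodies cong: eval_cong)
  next
    case False
    then have F: "\<not> similar d st i j" by (auto simp: similar_def same_def)
    consider "\<not> full (fst (st ! i))" | "full (fst (st ! i))" "\<not> full (fst (st ! j))"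
      | "full (fst (st ! i))" "full (fst (st ! j))" "same"
      | "full (fst (st ! i))" "full (fst (st ! j))" "\<not> same" "adj st i j" using False by blast
    then show "fn f_similar [ent (st ! i), ent (st ! j), ebl (unit n i), ebl (unit n j), est st, num d]
      (enc_bool (similar d st i j)) c"
      using costs c F by cases (intro fnI, simp add: prog_nth b_similar_def wp_simps bodies cong: eval_cong)+
  qed
qed

text \<open>One row of \<open>merge\<close> as the program computes it: the bits \<open>a\<close>
  and \<open>b\<close> of two unit vectors replace the comparisons of the index with
  \<open>i\<close> and \<open>j\<close>.\<close>

definition merge_row :: "bool list \<times> bool list \<Rightarrow> bool \<Rightarrow> bool \<Rightarrow> bool list \<Rightarrow> bool list \<Rightarrow> bool list \<Rightarrow>
    bool list \<times> bool list" where
  "merge_row e a b ui uj rj = (if b then (mask 0, replicate (length (snd e)) False)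
     else if a then (fst e, vor (snd e) rj)
     else (fst e, if vany (vand (snd e) uj) then vdiff (vor (snd e) ui) uj else snd e))"

definition "cMs n = 120 * n + (500 :: nat)"

lemma fn_merge_rows:
  assumes l: "length ui = n" "length uj = n" "length rj = n"
  shows "length as = length es \<Longrightarrow> length bs = length es \<Longrightarrow> rows n es \<Longrightarrow>
    fn f_merge [est es, ebl as, ebl bs, ebl ui, ebl uj, ebl rj]
      (est (map2 (\<lambda>e (a, b). merge_row e a b ui uj rj) es (zip as bs))) (length es * cMs n + 100)"
proof (induction es arbitrary: as bs)
  case Nil
  show ?case by (rule fnI) (simp add: prog_nth b_merge_def wp_simps)
next
  case (Cons e es)
  obtain a as' where as: "as = a # as'" using Cons.prems by (cases as) auto
  obtain b bs' where bs: "bs = b # bs'" using Cons.prems by (cases bs) auto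
  have e: "length (snd e) = n" using Cons.prems by simp
  note H = Cons.IH[of as' bs']
  have H: "fn f_merge [est es, ebl as', ebl bs', ebl ui, ebl uj, ebl rj]
      (est (map2 (\<lambda>e (a, b). merge_row e a b ui uj rj) es (zip as' bs'))) (length es * cMs n + 100)"
    by (rule Cons.IH) (use Cons.prems as bs in auto)
  have Z: "fn f_zeros [ebl (snd e)] (enc_list (replicate n Leaf)) (20 * n + 20)"
    using fn_zeros[of "map enc_bool (snd e)"] e by simp
  have O: "fn f_vor [ebl (snd e), ebl rj] (ebl (vor (snd e) rj)) (20 * n + 20)"
    and O': "fn f_vor [ebl (snd e), ebl ui] (ebl (vor (snd e) ui)) (20 * n + 20)"
    and A: "fn f_vand [ebl (snd e), ebl uj] (ebl (vand (snd e) uj)) (20 * n + 20)"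
    using fn_vor[of "snd e" rj] fn_vor[of "snd e" ui] fn_vand[of "snd e" uj] e l by simp_all
  have D: "fn f_vdiff [ebl (vor (snd e) ui), ebl uj] (ebl (vdiff (vor (snd e) ui) uj)) (20 * n + 20)"
    using fn_vdiff[of "vor (snd e) ui" uj] e l by (simp add: vor_def)
  have Y: "fn f_any [ebl (vand (snd e) uj)] (enc_bool (vany (vand (snd e) uj))) (20 * n + 20)"
    using fn_any[of "vand (snd e) uj"] e l by (simp add: vand_def)
  note bodies = fn_body[OF H] fn_body[OF Z] fn_body[OF O] fn_body[OF O'] fn_body[OF A] fn_body[OF D] fn_body[OF Y]
  define c where "c = cMs n"
  have c: "5 * (20 * n + 20) + 400 \<le> c" by (simp add: c_def cMs_def)
  note costs = fn_cst[OF H, folded c_def] fn_cst[OF Z] fn_cst[OF O] fn_cst[OF O'] fn_cst[OF A] fn_cst[OF D] fn_cst[OF Y] c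
  have ee: "Node (ebl (fst e)) (ebl (snd e)) = ent e" by (simp add: ent_def)
  have m: "map enc_bool (replicate n False) = replicate n Leaf" by (simp add: map_replicate)
  consider "b" | "\<not> b" "a" | "\<not> b" "\<not> a" "vany (vand (snd e) uj)" | "\<not> b" "\<not> a" "\<not> vany (vand (snd e) uj)" by blast
  then show ?case unfolding as bs c_def[symmetric] using costs
    by cases (intro fnI, simp add: prog_nth b_merge_def wp_simps wp_mask bodies merge_row_def e m ee cong: eval_cong)+
qed

lemma merge_rows:
  assumes "shaped n st" "i < n" "j < n"
  shows "merge st i j = map2 (\<lambda>e (a, b). merge_row e a b (unit n i) (unit n j) (snd (st ! j))) st
    (zip (unit n i) (unit n j))"
proof -
  have len: "length st = n" by (rule shaped_length[OF assms(1)])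
  show ?thesis
  proof (rule nth_equalityI)
    fix w assume "w < length (merge st i j)"
    then have w: "w < n" by (simp add: merge_def len)
    have r: "length (snd (st ! w)) = n" using shaped_nth[OF assms(1) w] by simp
    show "merge st i j ! w = map2 (\<lambda>e (a, b). merge_row e a b (unit n i) (unit n j) (snd (st ! j))) st
      (zip (unit n i) (unit n j)) ! w"
      using w assms(2,3) r shaped_nth[OF assms(1,3)] vany_unit[OF r assms(3)]
      by (auto simp: merge_def len merge_row_def)
  qed (simp add: merge_def len)
qed

lemma fn_merge:
  assumes "shaped n st" "i < n" "j < n"
  shows "fn f_merge [est st, ebl (unit n i), ebl (unit n j), ebl (unit n i), ebl (unit n j), ebl (snd (st ! j))]
    (est (merge st i j)) (n * cMs n + 100)"
  using fn_merge_rows[of "unit n i" n "unit n j" "snd (st ! j)" "unit n i" st "unit n j"]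
    shaped_nth[OF assms(1,3)] shaped_length[OF assms(1)] rows_shaped[OF assms(1)]
  by (simp add: merge_rows[OF assms])

definition "cP2 n = cSs n + 3 * (20 * n + 20) + (n * cMs n + 100) + (500 :: nat)"

lemma fn_pair2:
  assumes s: "shaped n st" and i: "i < n"
  shows "set js \<subseteq> {..<n} \<Longrightarrow> fn f_pair2 [enc_list (map (\<lambda>k. ebl (unit n k)) js), ebl (unit n i), est st, num d]
    (eopt (map_option (merge st i) (find (similar d st i) js))) (length js * cP2 n + 100)"
proof (induction js)
  case Nil
  show ?case by (rule fnI) (simp add: prog_nth b_pair2_def wp_simps)
next
  case (Cons j js)
  have j: "j < n" using Cons.prems by simp
  have H: "fn f_pair2 [enc_list (map (\<lambda>k. ebl (unit n k)) js), ebl (unit n i), est st, num d]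
    (eopt (map_option (merge st i) (find (similar d st i) js))) (length js * cP2 n + 100)"
    using Cons by simp
  note Si = fn_sel[OF s i]
  note Sj = fn_sel[OF s j]
  note S = fn_similar[OF s i j, of d]
  note M = fn_merge[OF s i j]
  have u: "unit n j \<noteq> []" using length_unit[of n j] j by (metis gr_implies_not0 list.size(3))
  note bodies = fn_body[OF H] fn_body[OF Si] fn_body[OF Sj] fn_body[OF S] fn_body[OF M]
  define c where "c = cP2 n"
  have c: "cSs n + 3 * (20 * n + 20) + (n * cMs n + 100) + 500 \<le> c" by (simp add: c_def cP2_def)
  note costs = fn_cst[OF H, folded c_def] fn_cst[OF Si] fn_cst[OF Sj] fn_cst[OF S] fn_cst[OF M] c
  show ?case unfolding c_def[symmetric] using costs
    by (cases "similar d st i j"; intro fnI; simp add: prog_nth b_pair2_def wp_simps bodies cong: eval_cong)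
qed

text \<open>Matches the nested loops \<open>f_pair1\<close> and \<open>f_pair2\<close> with one
  search over pairs.\<close>

lemma find_product_Cons:
  "find P (List.product (x # xs) ys) = (case find (\<lambda>y. P (x, y)) ys of
     Some y \<Rightarrow> Some (x, y) | None \<Rightarrow> find P (List.product xs ys))"
proof -
  have "find P (map (Pair x) ys @ zs) = (case find (\<lambda>y. P (x, y)) ys of
     Some y \<Rightarrow> Some (x, y) | None \<Rightarrow> find P zs)" for zs
    by (induction ys) auto
  then show ?thesis by simp
qed

definition "cP1 n = 2 * (n * cP2 n + 100) + (200 :: nat)"

lemma fn_pair1:
  assumes s: "shaped n st"
  shows "set is \<subseteq> {..<n} \<Longrightarrow> fn f_pair1 [enc_list (map (\<lambda>k. ebl (unit n k)) is),
      enc_list (map (\<lambda>k. ebl (unit n k)) [0..<n]), est st, num d]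
    (eopt (map_option (\<lambda>p. merge st (fst p) (snd p))
       (find (\<lambda>p. similar d st (fst p) (snd p)) (List.product is [0..<n])))) (length is * cP1 n + 100)"
proof (induction "is")
  case Nil
  show ?case by (rule fnI) (simp add: prog_nth b_pair1_def wp_simps)
next
  case (Cons i "is")
  have i: "i < n" using Cons.prems by simp
  let ?all = "enc_list (map (\<lambda>k. ebl (unit n k)) [0..<n])"
  have H: "fn f_pair1 [enc_list (map (\<lambda>k. ebl (unit n k)) is), ?all, est st, num d]
    (eopt (map_option (\<lambda>p. merge st (fst p) (snd p))
       (find (\<lambda>p. similar d st (fst p) (snd p)) (List.product is [0..<n])))) (length is * cP1 n + 100)"
    using Cons by simp
  have S: "fn f_pair2 [?all, ebl (unit n i), est st, num d]
    (eopt (map_option (merge st i) (find (similar d st i) [0..<n]))) (n * cP2 n + 100)"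
    using fn_pair2[OF s i, of "[0..<n]" d] by (simp add: lessThan_atLeast0)
  note bodies = fn_body[OF H] fn_body[OF S]
  define c where "c = cP1 n"
  have c: "2 * (n * cP2 n + 100) + 200 \<le> c" by (simp add: c_def cP1_def)
  note costs = fn_cst[OF H, folded c_def] fn_cst[OF S] c
  show ?case unfolding c_def[symmetric] find_product_Cons using costs
    by (cases "find (similar d st i) [0..<n]"; intro fnI; simp add: prog_nth b_pair1_def wp_simps bodies
        del: upt_Suc cong: eval_cong)
qed

definition "cD n = 2 * (3 * n * cHs n + 100) + 2 * cV n + 2 * (n * cUs n + 100) + (n * cP1 n + 100) + (500 :: nat)"

lemma fn_dflt:
  assumes wf_state: "wf_state n st"
  shows "fn f_dflt [est st, num d] (eopt (dflt d st)) (cD n)"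
proof -
  have s: "shaped n st" using wf_state by (rule wf_shaped)
  note len = shaped_length[OF s]
  note V = fn_variants'[OF s]
  have H: "fn f_heavy [evs (variants [] st), est st, num d] (eopt (heavy d st)) (3 * n * cHs n + 100)"
  proof (rule fn_mono)
    show "fn f_heavy [evs (variants [] st), est st, num d] (eopt (heavy d st)) (length (variants [] st) * cHs n + 100)"
      unfolding heavy_def by (rule fn_heavy[OF s]) (use variant_state(1)[OF wf_state] wf_shaped in blast)
    have "length (variants [] st) * cHs n \<le> 3 * n * cHs n"
      using length_variants[of "[]" st] len by (intro mult_le_mono1) simp
    then show "length (variants [] st) * cHs n + 100 \<le> 3 * n * cHs n + 100" by simp
  qed
  have U: "fn f_units [Leaf, est st] (enc_list (map (\<lambda>k. ebl (unit n k)) [0..<n])) (n * cUs n + 100)"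
    using fn_units[of 0 "map ent st" n] by (simp add: len)
  have P: "fn f_pair1 [enc_list (map (\<lambda>k. ebl (unit n k)) [0..<n]), enc_list (map (\<lambda>k. ebl (unit n k)) [0..<n]), est st, num d]
    (eopt (map_option (\<lambda>p. merge st (fst p) (snd p))
       (find (\<lambda>p. similar d st (fst p) (snd p)) (List.product [0..<n] [0..<n])))) (n * cP1 n + 100)"
    using fn_pair1[OF s, of "[0..<n]" d] by (simp add: lessThan_atLeast0)
  note bodies = fn_body[OF V] fn_body[OF H] fn_body[OF U] fn_body[OF P]
  have c: "2 * (3 * n * cHs n + 100) + 2 * cV n + 2 * (n * cUs n + 100) + (n * cP1 n + 100) + 500 \<le> cD n"
    by (simp add: cD_def)
  note costs = fn_cst[OF V] fn_cst[OF H] fn_cst[OF U] fn_cst[OF P] c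
  show ?thesis using costs
    by (cases "heavy d st"; intro fnI; simp add: prog_nth b_dflt_def wp_simps bodies dflt_def len cong: eval_cong)
qed

section \<open>The size of the search tree\<close>

definition "cN n = (3 * n + 1) * cFs n + (100 * n + 20) + 2 * cV n + 300 * n + cD n + cP n + (2000 :: nat)"

text \<open>Only a guess branches, with at most \<open>3 * n\<close> alternatives, and it occurs at
  one of the \<open>F\<close> levels. Hence the number of guesses is in the exponent and the fuel
  only in the base.\<close>

definition cSolve :: "nat \<Rightarrow> nat \<Rightarrow> nat \<Rightarrow> nat" where
  "cSolve n F k = cN n * ((3 * n + 1) * (F + 1)) ^ (k + 1)"

lemma power_step: "(x::nat) ^ (k + 1) + x ^ k \<le> (x + 1) ^ (k + 1)"
proof -
  have "x ^ (k + 1) + x ^ k = (x + 1) * x ^ k" by simp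
  also have "\<dots> \<le> (x + 1) * (x + 1) ^ k" by (intro mult_le_mono2 power_mono) auto
  finally show ?thesis by simp
qed

text \<open>The two recursive terms are combined by \<open>power_step\<close>. Since the base uses
  \<open>3 * n + 1\<close> for a branching of \<open>3 * n\<close>, a term \<open>cN n * y\<close>
  is left over and pays for the work at the node.\<close>

lemma cSolve_step:
  "cN n + (if k = 0 then 0 else 3 * n * cSolve n F (k - 1)) + cSolve n F k \<le> cSolve n (Suc F) k"
proof -
  define a where "a = 3 * n + 1"
  define x where "x = F + 1"
  define y where "y = (a * x) ^ k"
  have y: "1 \<le> y" unfolding y_def a_def x_def by simp
  have "a ^ (k + 1) * (x ^ (k + 1) + x ^ k) \<le> a ^ (k + 1) * (x + 1) ^ (k + 1)"
    by (rule mult_le_mono2[OF power_step])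
  moreover have "(a * x) ^ (k + 1) + a * y = a ^ (k + 1) * (x ^ (k + 1) + x ^ k)"
    by (simp add: y_def power_mult_distrib distrib_left mult_ac)
  moreover have "(a * (x + 1)) ^ (k + 1) = a ^ (k + 1) * (x + 1) ^ (k + 1)" by (rule power_mult_distrib)
  ultimately have "(a * x) ^ (k + 1) + a * y \<le> (a * (x + 1)) ^ (k + 1)" by simp
  then have "cN n * ((a * x) ^ (k + 1) + a * y) \<le> cSolve n (Suc F) k"
    unfolding cSolve_def a_def x_def by (intro mult_le_mono2) (simp add: algebra_simps)
  moreover have "cN n * ((a * x) ^ (k + 1) + a * y) = cSolve n F k + cN n * y + 3 * n * (cN n * y)"
    unfolding cSolve_def a_def x_def by (simp add: algebra_simps)
  moreover have "cN n \<le> cN n * y" using y by simp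
  moreover have "(if k = 0 then 0 else 3 * n * cSolve n F (k - 1)) \<le> 3 * n * (cN n * y)"
    by (cases k) (simp_all add: cSolve_def y_def a_def x_def)
  ultimately show ?thesis by linarith
qed

lemma fn_some:
  assumes "\<And>s. wf_state n s \<Longrightarrow> fn f_solve [num F, num k, est s, num d] (enc_bool (solve d F k s)) T"
  shows "\<forall>q \<in> set vs. wf_state n (fst q) \<Longrightarrow> fn f_some [num F, num k, evs vs, num d]
    (enc_bool (\<exists>q \<in> set vs. solve d F k (fst q))) (length vs * (T + 100) + 100)"
proof (induction vs)
  case Nil
  show ?case by (rule fnI) (simp add: prog_nth b_some_def wp_simps)
next
  case (Cons q vs)
  have S: "fn f_solve [num F, num k, est (fst q), num d] (enc_bool (solve d F k (fst q))) T"
    using assms Cons.prems by simp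
  have H: "fn f_some [num F, num k, evs vs, num d]
    (enc_bool (\<exists>q \<in> set vs. solve d F k (fst q))) (length vs * (T + 100) + 100)"
    using Cons by simp
  show ?case using fn_cst[OF S] fn_cst[OF H]
    by (cases "solve d F k (fst q)"; intro fnI; simp add: prog_nth b_some_def wp_simps fn_body[OF S] fn_body[OF H]
      cong: eval_cong)
qed

lemma fn_option:
  assumes "\<And>s. q = Some s \<Longrightarrow> fn f_solve [num F, num k, est s, num d] (enc_bool (solve d F k s)) T"
  shows "fn f_option [num F, num k, eopt q, num d]
    (enc_bool (case q of None \<Rightarrow> False | Some s \<Rightarrow> solve d F k s)) (T + 100)"
proof (cases q)
  case None
  then show ?thesis by (intro fnI) (simp add: prog_nth b_option_def wp_simps cong: eval_cong)
next
  case (Some s)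
  note S = assms[OF Some]
  show ?thesis unfolding Some using fn_cst[OF S]
    by (intro fnI) (simp add: prog_nth b_option_def wp_simps fn_body[OF S] cong: eval_cong)
qed

lemma wf_dflt:
  assumes "wf_state n p" "dflt d p = Some s" shows "wf_state n s"
  using wf_shaped[OF assms(1)] assms(2)
proof (cases rule: dflt_Some)
  case (1 q) then show ?thesis using variant_state(3)[OF assms(1)] by blast
next
  case (2 i j)
  then interpret merging n p i j using similar_merging(1)[OF assms(1)] by blast
  show ?thesis using wf_merge 2 by simp
qed

lemma fn_solve:
  "wf_state n st \<Longrightarrow> fn f_solve [num F, num k, est st, num d] (enc_bool (solve d F k st)) (cSolve n F k)"
proof (induction F arbitrary: k st)
  case 0
  have "2000 * 1 \<le> cSolve n 0 k" unfolding cSolve_def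
    by (rule mult_le_mono[OF _ one_le_power]) (simp_all add: cN_def)
  then show ?case by (intro fnI) (simp add: prog_nth b_solve_def wp_simps cong: eval_cong)
next
  case (Suc F)
  define p where "p = propagate st"
  note s = wf_shaped[OF Suc.prems]
  have wp: "wf_state n p" unfolding p_def by (rule wf_propagate[OF Suc.prems])
  note sp = wf_shaped[OF wp]
  note P = fn_prop[OF s, folded p_def]
  note V = fn_variants'[OF sp]
  note M = fn_meas[OF rows_shaped[OF sp], of 0, unfolded shaped_length[OF sp] num_simps(1) add_0_left]
  have Fi: "fn f_fin [Node Leaf (num (meas p)), est p] (enc_bool (fin (Suc (meas p)) p)) ((3 * n + 1) * cFs n + 100)"
  proof (rule fn_mono)
    show "fn f_fin [Node Leaf (num (meas p)), est p] (enc_bool (fin (Suc (meas p)) p)) (Suc (meas p) * cFs n + 100)"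
      using fn_fin[OF wp, of "Suc (meas p)"] by simp
    have "Suc (meas p) * cFs n \<le> (3 * n + 1) * cFs n" using meas_le[OF sp] by (intro mult_le_mono1) simp
    then show "Suc (meas p) * cFs n + 100 \<le> (3 * n + 1) * cFs n + 100" by simp
  qed
  note D = fn_dflt[OF wp, of d]
  have O: "fn f_option [num F, num k, eopt (dflt d p), num d]
    (enc_bool (case dflt d p of None \<Rightarrow> False | Some s \<Rightarrow> solve d F k s)) (cSolve n F k + 100)"
    by (rule fn_option) (use Suc.IH wf_dflt[OF wp] in blast)
  have wv: "\<forall>q \<in> set (variants [] p). wf_state n (fst q)" using variant_state(1)[OF wp] by blast
  have A: "fn f_some [num F, num k', evs (variants [] p), num d]
    (enc_bool (\<exists>q \<in> set (variants [] p). solve d F k' (fst q))) (3 * n * (cSolve n F k' + 100) + 100)" for k'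
  proof (rule fn_mono)
    show "fn f_some [num F, num k', evs (variants [] p), num d]
    (enc_bool (\<exists>q \<in> set (variants [] p). solve d F k' (fst q))) (length (variants [] p) * (cSolve n F k' + 100) + 100)"
      by (rule fn_some[OF _ wv]) (rule Suc.IH)
    have "length (variants [] p) * (cSolve n F k' + 100) \<le> 3 * n * (cSolve n F k' + 100)"
      using length_variants[of "[]" p] shaped_length[OF sp] by (intro mult_le_mono1) simp
    then show "length (variants [] p) * (cSolve n F k' + 100) + 100 \<le> 3 * n * (cSolve n F k' + 100) + 100" by simp
  qed
  define Ak where "Ak = (k > 0 \<and> (\<exists>q \<in> set (variants [] p). solve d F (k - 1) (fst q)))"
  define Ok where "Ok = (case dflt d p of None \<Rightarrow> False | Some s \<Rightarrow> solve d F k s)"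
  define Fk where "Fk = fin (Suc (meas p)) p"
  have sol: "solve d (Suc F) k st = (Fk \<or> Ak \<or> Ok)"
    by (simp add: Fk_def Ak_def Ok_def p_def)
  note O' = O[folded Ok_def]
  note Fi' = Fi[folded Fk_def]
  define a where "a = (3 * n + 1) * cFs n"
  have N: "fn f_node [num F, num k, est p, num d] (enc_bool (Fk \<or> Ak \<or> Ok)) (cSolve n (Suc F) k - cP n - 100)"
  proof -
    define b where "b = (if k = 0 then 0 else 3 * n * cSolve n F (k - 1))"
    have c: "a + (100 * n + 20) + cV n + 300 * n + cD n + b + cSolve n F k + 1000 \<le> cSolve n (Suc F) k - cP n - 100"
      using cSolve_step[of n k F] unfolding cN_def a_def[symmetric] b_def[symmetric] by linarith
    note bodies = fn_body[OF M] fn_body[OF Fi'] fn_body[OF V] fn_body[OF D] fn_body[OF O']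
    note costs = fn_cst[OF M] fn_cst[OF Fi', folded a_def] fn_cst[OF V] fn_cst[OF D] fn_cst[OF O'] c
    show ?thesis
    proof (cases k)
      case 0
      then have "\<not> Ak" by (simp add: Ak_def)
      show ?thesis using costs \<open>\<not> Ak\<close> bodies(5)[unfolded 0] unfolding 0
        by (cases Fk; intro fnI; simp add: prog_nth b_node_def wp_simps bodies(1-4) cong: eval_cong)
    next
      case (Suc k')
      have A': "fn f_some [num F, num k', evs (variants [] p), num d] (enc_bool Ak) (b + 300 * n + 100)"
        using A[of k'] Suc by (simp add: Ak_def b_def algebra_simps)
      show ?thesis using costs fn_cst[OF A'] bodies(5)[unfolded Suc num_simps] unfolding Suc
        by (cases Fk; cases Ak; intro fnI; simp add: prog_nth b_node_def wp_simps bodies(1-4) fn_body[OF A'] cong: eval_cong)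
    qed
  qed
  have c: "cSolve n (Suc F) k \<ge> cP n + 100 + 100"
    using cSolve_step[of n k F] unfolding cN_def by linarith
  show ?case unfolding sol using fn_cst[OF P] fn_cst[OF N] c
    by (intro fnI) (simp add: prog_nth b_solve_def wp_simps fn_body[OF P] fn_body[OF N] cong: eval_cong)
qed

section \<open>Unary arithmetic\<close>

lemma wp_lit: "wp env (lit k) Q \<longleftrightarrow> Q (num k) (2 * k + 1)"
  by (induction k arbitrary: Q) (simp_all add: wp_simps)

lemma fn_add: "fn f_rev [num a, num b] (num (a + b)) (20 * a + 20)"
  using fn_rev[of "replicate a Leaf" "replicate b Leaf"] by (simp add: num_def replicate_add)

lemma fn_mul: "fn f_mul [num a, num b] (num (a * b)) (a * (20 * b + 100) + 100)"
proof (induction a)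
  case 0
  show ?case by (rule fnI) (simp add: prog_nth b_mul_def wp_simps)
next
  case (Suc a)
  note A = fn_add[of b "a * b"]
  show ?case using fn_cst[OF Suc] fn_cst[OF A]
    by (intro fnI) (simp add: prog_nth b_mul_def wp_simps fn_body[OF Suc] fn_body[OF A] cong: eval_cong)
qed

definition "cPow s B e = e * (s * (20 * B + 100) + 300) + (100 :: nat)"

text \<open>Powers of \<open>s\<close> may decrease in the exponent when \<open>s = 0\<close>; a
  bound on powers of \<open>s + 1\<close> passes to smaller exponents, and one \<open>B\<close> then
  serves all steps of \<open>fn_search\<close>.\<close>

lemma fn_pow: "(s + 1) ^ e \<le> B \<Longrightarrow> fn f_pow [num s, num e] (num (s ^ e)) (cPow s B e)"
proof (induction e)
  case 0
  show ?case by (rule fnI) (simp add: prog_nth b_pow_def wp_simps cPow_def)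
next
  case (Suc e)
  have "(s + 1) ^ e \<le> (s + 1) ^ Suc e" by simp
  then have B: "(s + 1) ^ e \<le> B" using Suc.prems by linarith
  note H = Suc.IH[OF B]
  have "s ^ e \<le> (s + 1) ^ e" by (intro power_mono) auto
  then have "s * (20 * s ^ e + 100) \<le> s * (20 * B + 100)" using B by (intro mult_le_mono2) linarith
  then have M: "fn f_mul [num s, num (s ^ e)] (num (s * s ^ e)) (s * (20 * B + 100) + 100)"
    by (intro fn_mono[OF fn_mul]) simp
  show ?case using fn_cst[OF H] fn_cst[OF M]
    by (intro fnI) (simp add: prog_nth b_pow_def wp_simps fn_body[OF H] fn_body[OF M] cPow_def cong: eval_cong)
qed

section \<open>The choice of the parameters\<close>

text \<open>All thresholds are powers of \<open>r = root96 n\<close>: \<open>d = r ^ 36\<close> and \<open>t = r ^ 24\<close>, and the exponent \<open>61\<close> of the budget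
  is \<open>60\<close> plus one to absorb \<open>log n\<close>.\<close>

definition root96 :: "nat \<Rightarrow> nat" where
  "root96 m = (LEAST s. m \<le> s ^ 96)"

lemma root96: "m \<le> root96 m ^ 96" "root96 m \<le> m" "s < root96 m \<Longrightarrow> s ^ 96 < m"
proof -
  have "m \<le> m ^ 96" by (cases "m = 0") (simp_all add: self_le_power)
  then show "m \<le> root96 m ^ 96" "root96 m \<le> m"
    unfolding root96_def by (rule LeastI, rule Least_le)
  show "s < root96 m \<Longrightarrow> s ^ 96 < m" unfolding root96_def using not_less_Least by fastforce
qed

definition "cQ m = cPow (root96 m) ((root96 m + 1) ^ 96) 96 + 20 * (root96 m + 1) ^ 96 + (1000 :: nat)"

lemma fn_search:
  "s + j = root96 m \<Longrightarrow> fn f_search [num s, num m] (num (root96 m)) (Suc j * cQ m)"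
proof (induction j arbitrary: s)
  case 0
  then have s: "s = root96 m" by simp
  have P: "fn f_pow [num s, num 96] (num (s ^ 96)) (cPow s ((s + 1) ^ 96) 96)" by (rule fn_pow) simp
  note L = fn_leq[of m "s ^ 96"]
  have "s ^ 96 \<le> (s + 1) ^ 96" by (intro power_mono) auto
  then have "cst f_leq [num m, num (s ^ 96)] \<le> 20 * (s + 1) ^ 96 + 20" using fn_cst[OF L] by linarith
  then show ?case using fn_cst[OF P] root96(1)[of m] unfolding s
    by (intro fnI) (simp add: prog_nth b_search_def wp_simps wp_lit fn_body[OF P[unfolded s]] fn_body[OF L[unfolded s]] cQ_def cong: eval_cong)
next
  case (Suc j)
  then have s: "s < root96 m" by simp
  have B: "(s + 1) ^ 96 \<le> (root96 m + 1) ^ 96" using s by (intro power_mono) auto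
  have P: "fn f_pow [num s, num 96] (num (s ^ 96)) (cPow (root96 m) ((root96 m + 1) ^ 96) 96)"
  proof (rule fn_mono[OF fn_pow[OF B]])
    show "cPow s ((root96 m + 1) ^ 96) 96 \<le> cPow (root96 m) ((root96 m + 1) ^ 96) 96"
      unfolding cPow_def using s by (intro add_mono mult_le_mono) auto
  qed
  note L = fn_leq[of m "s ^ 96"]
  have "s ^ 96 \<le> (s + 1) ^ 96" by (intro power_mono) auto
  then have l: "cst f_leq [num m, num (s ^ 96)] \<le> 20 * (root96 m + 1) ^ 96 + 20" using fn_cst[OF L] B by linarith
  have H: "fn f_search [Node Leaf (num s), num m] (num (root96 m)) (Suc j * cQ m)"
    using Suc.IH[of "Suc s"] Suc.prems by simp
  have no: "\<not> m \<le> s ^ 96" using root96(3)[OF s] by simp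
  define q where "q = cQ m"
  have q: "cPow (root96 m) ((root96 m + 1) ^ 96) 96 + 20 * (root96 m + 1) ^ 96 + 1000 \<le> q" by (simp add: q_def cQ_def)
  define X where "X = (root96 m + 1) ^ 96"
  show ?case unfolding q_def[symmetric]
    using fn_cst[OF P, folded X_def] l[folded X_def] fn_cst[OF H, folded q_def] q[folded X_def] no
    by (intro fnI) (simp add: prog_nth b_search_def wp_simps wp_lit fn_body[OF P] fn_body[OF L] fn_body[OF H] cong: eval_cong)
qed

text \<open>The constant rounds up \<open>277929 = 1440 * 193 + 6 + 3\<close>, the sum that arises
  in \<open>pot_budget\<close>.\<close>

definition "budget n = 300000 * root96 n ^ 61"

definition "fuel n = budget n + 3 * n + (1 :: nat)"

definition "cMain n = Suc (root96 n) * cQ n + 2 * cPow (root96 n) ((root96 n + 1) ^ 61) 61 +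
  300000 * (20 * root96 n ^ 61 + 100) + 20 * budget n + 200 * n + (700000 :: nat)"

lemma root96_pow: "j \<le> 61 \<Longrightarrow> fn f_pow [num (root96 n), num j] (num (root96 n ^ j)) (cPow (root96 n) ((root96 n + 1) ^ 61) 61)"
proof (rule fn_mono[OF fn_pow])
  assume "j \<le> 61"
  then show "(root96 n + 1) ^ j \<le> (root96 n + 1) ^ 61" by (intro power_increasing) auto
  show "cPow (root96 n) ((root96 n + 1) ^ 61) j \<le> cPow (root96 n) ((root96 n + 1) ^ 61) 61"
    unfolding cPow_def using \<open>j \<le> 61\<close> by (intro add_mono mult_le_mono1) auto
qed

lemma fn_main:
  assumes wf_state: "wf_state n st"
  shows "fn 0 [est st] (enc_bool (solve (root96 n ^ 36) (budget n + Suc (meas st)) (budget n) st))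
    (cMain n + cSolve n (fuel n) (budget n))"
proof -
  define r where "r = root96 n"
  define K where "K = budget n"
  define d where "d = r ^ 36"
  note s = wf_shaped[OF wf_state]
  note len = shaped_length[OF s]
  have Z: "fn f_zeros [est st] (num n) (20 * n + 20)"
    using fn_zeros[of "map ent st"] by (simp add: len num_def)
  have R: "fn f_search [Leaf, num n] (num r) (Suc r * cQ n)"
    using fn_search[of 0 r n] by (simp add: r_def)
  define cp where "cp = cPow r ((r + 1) ^ 61) 61"
  note D = root96_pow[of 36 n, folded r_def, folded d_def]
  note E = root96_pow[of 61 n, folded r_def]
  have M: "fn f_mul [num 300000, num (r ^ 61)] (num K) (300000 * (20 * r ^ 61 + 100) + 100)"
    using fn_mul[of 300000 "r ^ 61"] by (simp only: K_def budget_def r_def)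
  note Me = fn_meas[OF rows_shaped[OF s], of 0, unfolded len num_simps(1) add_0_left]
  have A: "fn f_rev [num K, Node Leaf (num (meas st))] (num (K + Suc (meas st))) (20 * K + 20)"
    using fn_add[of K "Suc (meas st)"] by simp
  define F where "F = K + Suc (meas st)"
  note S = fn_solve[OF wf_state, of F K d]
  have "F + 1 \<le> fuel n + 1" using meas_le[OF s] by (simp add: F_def fuel_def K_def)
  then have cS: "cst f_solve [num F, num K, est st, num d] \<le> cSolve n (fuel n) (budget n)"
    using fn_cst[OF S] unfolding cSolve_def K_def
    by (elim order_trans) (intro mult_le_mono2 power_mono, auto)
  define cs where "cs = cSolve n (fuel n) (budget n)"
  define m where "m = (300000 :: nat)"
  have cM: "Suc r * cQ n + 2 * cp + (m * (20 * r ^ 61 + 100)) + 20 * K + 200 * n + 700000 = cMain n"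
    by (simp only: cMain_def r_def cp_def K_def m_def)
  define t where "t = m * (20 * r ^ 61 + 100)"
  define u where "u = Suc r * cQ n"
  have b2: "fn f_main2 [est st, num d, num K] (enc_bool (solve d F K st)) (20 * K + 100 * n + cs + 200)"
    using fn_cst[OF Me] fn_cst[OF A] cS[folded cs_def]
    by (intro fnI) (simp add: prog_nth b_main2_def wp_simps fn_body[OF Me] fn_body[OF A, folded F_def] fn_body[OF S] cong: eval_cong)
  have b1: "fn f_main1 [est st, num r] (enc_bool (solve d F K st)) (2 * cp + t + 20 * K + 100 * n + cs + 601000)"
    using fn_cst[OF b2] fn_cst[OF D, folded cp_def] fn_cst[OF E, folded cp_def] fn_cst[OF M, folded m_def, folded t_def]
    by (intro fnI) (simp add: prog_nth prog_nth(2)[unfolded One_nat_def] b_main1_def wp_simps wp_lit fn_body[OF b2] fn_body[OF D] fn_body[OF E]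
      fn_body[OF M] m_def cong: eval_cong)
  have "fn 0 [est st] (enc_bool (solve d F K st)) (u + 2 * cp + t + 20 * K + 200 * n + cs + 700000)"
    using fn_cst[OF b1, unfolded One_nat_def] fn_cst[OF Z] fn_cst[OF R, folded u_def]
    by (intro fnI) (simp add: prog_nth b_main_def wp_simps fn_body[OF b1, unfolded One_nat_def] fn_body[OF Z] fn_body[OF R] cong: eval_cong)
  then show ?thesis using cM[folded t_def, folded u_def] unfolding F_def K_def d_def r_def cs_def[symmetric]
    by (elim fn_mono) simp
qed

section \<open>The time bound\<close>

text \<open>Only the budget enters the exponent of the running time, so for all other costs some
  polynomial of unspecified degree is enough.\<close>

definition polyb :: "(nat \<Rightarrow> nat) \<Rightarrow> bool" where
  "polyb f \<longleftrightarrow> (\<exists>c e. \<forall>n. f n \<le> c * (n + 1) ^ e)"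

lemma polyb_mono: "polyb g \<Longrightarrow> (\<And>n. f n \<le> g n) \<Longrightarrow> polyb f"
  unfolding polyb_def by (meson order_trans)

lemma polyb_const: "polyb (\<lambda>_. k)"
  unfolding polyb_def by (intro exI[of _ k] exI[of _ 0]) simp

lemma polyb_id: "polyb (\<lambda>n. n)"
  unfolding polyb_def by (intro exI[of _ 1] exI[of _ 1]) simp

lemma polyb_add: assumes "polyb f" "polyb g" shows "polyb (\<lambda>n. f n + g n)"
proof -
  obtain c e c' e' where f: "\<And>n. f n \<le> c * (n + 1) ^ e" and g: "\<And>n. g n \<le> c' * (n + 1) ^ e'"
    using assms unfolding polyb_def by blast
  have "f n + g n \<le> (c + c') * (n + 1) ^ (e + e')" for n
  proof -
    have "(n + 1) ^ e \<le> (n + 1) ^ (e + e')" "(n + 1) ^ e' \<le> (n + 1) ^ (e + e')"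
      by (rule power_increasing; simp)+
    then have "c * (n + 1) ^ e \<le> c * (n + 1) ^ (e + e')" "c' * (n + 1) ^ e' \<le> c' * (n + 1) ^ (e + e')"
      by (auto intro: mult_le_mono2)
    then show ?thesis unfolding add_mult_distrib using f[of n] g[of n] by linarith
  qed
  then show ?thesis unfolding polyb_def by blast
qed

lemma polyb_mult: assumes "polyb f" "polyb g" shows "polyb (\<lambda>n. f n * g n)"
proof -
  obtain c e c' e' where f: "\<And>n. f n \<le> c * (n + 1) ^ e" and g: "\<And>n. g n \<le> c' * (n + 1) ^ e'"
    using assms unfolding polyb_def by blast
  have "f n * g n \<le> (c * c') * (n + 1) ^ (e + e')" for n
    using mult_le_mono[OF f[of n] g[of n]] by (simp add: power_add mult_ac)
  then show ?thesis unfolding polyb_def by blast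
qed

lemma polyb_power: "polyb f \<Longrightarrow> polyb (\<lambda>n. f n ^ k)"
  by (induction k) (simp_all add: polyb_const polyb_mult)

lemma polyb_Suc: "polyb f \<Longrightarrow> polyb (\<lambda>n. Suc (f n))"
  using polyb_add[of f "\<lambda>_. 1"] polyb_const by simp

lemma polyb_root96: "polyb root96"
  by (rule polyb_mono[OF polyb_id root96(2)])

lemmas polyb_intros = polyb_const polyb_id polyb_add polyb_mult polyb_power polyb_Suc polyb_root96

lemma polyb_costs: "polyb cN" "polyb cMain" "polyb fuel"
proof -
  have U: "polyb cU" unfolding cU_def[abs_def] by (intro polyb_intros)
  have R: "polyb cR" unfolding cR_def[abs_def] by (intro polyb_intros U)
  have I: "polyb cI" unfolding cI_def[abs_def] by (intro polyb_intros R)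
  have P: "polyb cP" unfolding cP_def[abs_def] by (intro polyb_intros I)
  have C: "polyb cC" unfolding cC_def[abs_def] by (intro polyb_intros)
  have V: "polyb cV" unfolding cV_def[abs_def] by (intro polyb_intros C)
  have Fs: "polyb cFs" unfolding cFs_def[abs_def] by (intro polyb_intros V P)
  have Hs: "polyb cHs" unfolding cHs_def[abs_def] by (intro polyb_intros P)
  have Us: "polyb cUs" unfolding cUs_def[abs_def] by (intro polyb_intros)
  have Ts: "polyb cTs" unfolding cTs_def[abs_def] by (intro polyb_intros)
  have Ss: "polyb cSs" unfolding cSs_def[abs_def] by (intro polyb_intros Ts)
  have Ms: "polyb cMs" unfolding cMs_def[abs_def] by (intro polyb_intros)
  have P2: "polyb cP2" unfolding cP2_def[abs_def] by (intro polyb_intros Ss Ms)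
  have P1: "polyb cP1" unfolding cP1_def[abs_def] by (intro polyb_intros P2)
  have D: "polyb cD" unfolding cD_def[abs_def] by (intro polyb_intros Hs V Us P1)
  show "polyb cN" unfolding cN_def[abs_def] by (intro polyb_intros Fs V D P)
  have B: "polyb budget" unfolding budget_def[abs_def] by (intro polyb_intros)
  show "polyb fuel" unfolding fuel_def[abs_def] by (intro polyb_intros B)
  have Q: "polyb cQ" unfolding cQ_def[abs_def] cPow_def by (intro polyb_intros)
  show "polyb cMain" unfolding cMain_def[abs_def] cPow_def by (intro polyb_intros Q B)
qed

definition run_time :: "nat \<Rightarrow> nat" where
  "run_time n = cMain n + cSolve n (fuel n) (budget n) + 3"

lemma run_time_bound:
  obtains c e where "2 \<le> c" "\<And>n. run_time n \<le> (c * (n + 1) ^ e) ^ (budget n + 3)"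
proof -
  have "polyb (\<lambda>n. cMain n + 3 + cN n + (3 * n + 1) * (fuel n + 1))"
    by (intro polyb_intros polyb_costs)
  then obtain c e where c: "\<And>n. cMain n + 3 + cN n + (3 * n + 1) * (fuel n + 1) \<le> c * (n + 1) ^ e"
    unfolding polyb_def by blast
  have "3 \<le> c" using c[of 0] by simp
  have "run_time n \<le> (c * (n + 1) ^ e) ^ (budget n + 3)" for n
  proof -
    define P where "P = c * (n + 1) ^ e"
    define k where "k = budget n"
    define y where "y = P ^ (k + 1)"
    have P: "cMain n + 3 \<le> P" "cN n \<le> P" "(3 * n + 1) * (fuel n + 1) \<le> P"
      using c[of n] unfolding P_def by linarith+
    have y: "1 \<le> y" unfolding y_def using P(1) by (intro one_le_power) linarith
    have "cSolve n (fuel n) k \<le> P * y" unfolding cSolve_def y_def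
      by (intro mult_le_mono P power_mono) auto
    then have "run_time n \<le> P + P * y" using P(1) unfolding run_time_def k_def by linarith
    also have "\<dots> \<le> P * y + P * y" using y by simp
    also have "\<dots> = 2 * (P * y)" by simp
    also have "\<dots> \<le> P * (P * y)" using P(1) by (intro mult_le_mono1) linarith
    also have "\<dots> = P ^ (k + 3)" by (simp add: y_def power_add power3_eq_cube)
    finally show ?thesis by (simp add: P_def k_def)
  qed
  then show ?thesis using that[of c e] \<open>3 \<le> c\<close> by simp
qed

text \<open>By minimality \<open>root96 n - 1\<close> is below the true root, and the factor two
  absorbs the rounding.\<close>

lemma root96_le: "n \<ge> 1 \<Longrightarrow> real (root96 n) \<le> 2 * real n powr (1 / 96)"
proof -
  assume n: "n \<ge> 1"
  define r where "r = root96 n"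
  have "r \<noteq> 0" using root96(1)[of n] n unfolding r_def by (intro notI) simp
  then have "(r - 1) ^ 96 < n" using root96(3)[of "r - 1" n] by (simp add: r_def)
  then have "real (r - 1) ^ 96 \<le> real n" by (metis less_imp_le of_nat_mono of_nat_power)
  then have "(real (r - 1) ^ 96) powr (1 / 96) \<le> real n powr (1 / 96)" by (intro powr_mono2) auto
  moreover have "(real (r - 1) ^ 96) powr (1 / 96) = real (r - 1)"
  proof (cases "r - 1 = 0")
    case False
    then show ?thesis using powr_powr[of "real (r - 1)" 96 "1 / 96"] by (simp del: of_nat_diff)
  qed simp
  moreover have "1 \<le> real n powr (1 / 96)" using n by (intro ge_one_powr_ge_zero) auto
  moreover have "real r = real (r - 1) + 1" using \<open>r \<noteq> 0\<close> by simp
  ultimately show ?thesis unfolding r_def[symmetric] by linarith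
qed

lemma budget_le: "n \<ge> 1 \<Longrightarrow> real (budget n + 3) \<le> (300000 * 2 ^ 61 + 3) * real n powr (61 / 96)"
proof -
  assume n: "n \<ge> 1"
  have "real (root96 n) ^ 61 \<le> (2 * real n powr (1 / 96)) ^ 61" by (intro power_mono root96_le n) auto
  also have "\<dots> = 2 ^ 61 * real n powr (61 / 96)"
    using powr_powr[of "real n" "1 / 96" 61] by (simp add: power_mult_distrib)
  finally have "real (budget n) \<le> 300000 * (2 ^ 61 * real n powr (61 / 96))"
    by (simp add: budget_def)
  moreover have "1 \<le> real n powr (61 / 96)" using n by (intro ge_one_powr_ge_zero) auto
  ultimately show ?thesis by (simp add: algebra_simps)
qed

lemma log_run_time:
  fixes \<epsilon> :: real assumes "\<epsilon> < 1 / 33"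
  shows "(\<lambda>n. log 2 (real (run_time n))) \<in> O(\<lambda>n. real n powr (2 / 3 - \<epsilon>))"
proof -
  obtain c e where c: "2 \<le> c" "\<And>n. run_time n \<le> (c * (n + 1) ^ e) ^ (budget n + 3)"
    using run_time_bound by blast
  \<comment> \<open>\<open>1 / 1056\<close> is exactly \<open>7 / 11 - 61 / 96\<close>, and
    \<open>7 / 11 = 2 / 3 - 1 / 33\<close>. So \<open>n powr \<delta>\<close> absorbs the factor
    \<open>log n\<close> that comes from the polynomial base.\<close>
  define \<delta> :: real where "\<delta> = 1 / 1056"
  define A where "A = log 2 (real c) + real e + real e * (1056 / ln 2)"
  define B :: real where "B = 300000 * 2 ^ 61 + 3"
  have "norm (log 2 (real (run_time n))) \<le> (B * A) * norm (real n powr (2 / 3 - \<epsilon>))" if n: "n \<ge> 1" for n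
  proof -
    define X where "X = real (c * (n + 1) ^ e)"
    have "1 \<le> c * (n + 1) ^ e" using c(1) by (simp add: Suc_le_eq)
    then have X: "1 \<le> X" unfolding X_def by linarith
    have rt: "1 \<le> real (run_time n)" by (simp add: run_time_def)
    have "real (run_time n) \<le> X ^ (budget n + 3)"
      unfolding X_def of_nat_power[symmetric] of_nat_le_iff by (rule c(2))
    then have "log 2 (real (run_time n)) \<le> log 2 (X ^ (budget n + 3))"
      using rt X by (subst log_le_cancel_iff) auto
    also have "\<dots> = real (budget n + 3) * log 2 X"
      using X by (simp add: log_nat_power)
    also have "\<dots> \<le> (B * real n powr (61 / 96)) * (A * real n powr \<delta>)"
    proof (intro mult_mono)
      show "real (budget n + 3) \<le> B * real n powr (61 / 96)" unfolding B_def by (rule budget_le[OF n])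
      have nd: "1 \<le> real n powr \<delta>" using n by (intro ge_one_powr_ge_zero) (auto simp: \<delta>_def)
      have "log 2 X = log 2 (real c) + real e * log 2 (real n + 1)"
        unfolding X_def using c(1) by (simp add: log_mult log_nat_power add.commute)
      also have "log 2 (real n + 1) \<le> log 2 (2 * real n)" using n by (subst log_le_cancel_iff) auto
      also have "log 2 (2 * real n) = 1 + ln (real n) / ln 2"
        using n by (simp add: log_def ln_mult add_divide_distrib)
      also have "ln (real n) / ln 2 \<le> (real n powr \<delta> / \<delta>) / ln 2"
        using n by (intro divide_right_mono ln_powr_bound) (auto simp: \<delta>_def)
      finally have "log 2 X \<le> log 2 (real c) + real e * (1 + (real n powr \<delta> / \<delta>) / ln 2)"
        by (simp add: mult_left_mono)
      also have "\<dots> = log 2 (real c) + real e + real e * (1056 / ln 2) * real n powr \<delta>"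
        by (simp add: \<delta>_def algebra_simps)
      also have "\<dots> \<le> A * real n powr \<delta>"
      proof -
        have "0 \<le> log 2 (real c) + real e" using c(1) by (intro add_nonneg_nonneg) auto
        then have "(log 2 (real c) + real e) * 1 \<le> (log 2 (real c) + real e) * real n powr \<delta>"
          using nd by (intro mult_left_mono)
        then show ?thesis by (simp add: A_def algebra_simps)
      qed
      finally show "log 2 X \<le> A * real n powr \<delta>" .
    qed (use X in \<open>auto simp: B_def\<close>)
    also have "\<dots> = (B * A) * real n powr (7 / 11)"
      by (simp add: \<delta>_def powr_add[symmetric])
    also have "\<dots> \<le> (B * A) * real n powr (2 / 3 - \<epsilon>)"
    proof (intro mult_left_mono powr_mono)
      show "0 \<le> B * A" unfolding A_def B_def using c(1) by (intro mult_nonneg_nonneg add_nonneg_nonneg) auto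
    qed (use n assms in auto)
    finally show ?thesis using rt by simp
  qed
  then show ?thesis by (intro bigoI[of _ "B * A"] eventually_sequentiallyI[of 1])
qed

text \<open>The colour term is at most \<open>6 * r ^ 60\<close> since
  \<open>n \<le> r ^ 96\<close>. There are at most \<open>r ^ 192\<close> arcs, so
  \<open>1 + ln\<close> of their number is at most \<open>193 * r\<close>; this factor
  \<open>r\<close> raises the exponent \<open>60 = 36 + 24\<close> to \<open>61\<close>.\<close>

lemma pot_budget:
  assumes wf_state: "wf_state n st" and n: "1 \<le> n"
  shows "pot (root96 n ^ 36) (root96 n ^ 24) n (propagate st) \<le> budget n"
proof -
  define r where "r = root96 n"
  define p where "p = propagate st"
  have nr: "n \<le> r ^ 96" unfolding r_def by (rule root96(1))
  then have "r \<noteq> 0" using n by (intro notI) simp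
  then have r: "1 \<le> real r" by simp
  have s: "shaped n p" unfolding p_def by (rule propagate(1)[OF wf_shaped[OF wf_state]])
  have "real (meas p) \<le> real (3 * n)" using meas_le[OF s] of_nat_mono by blast
  also have "\<dots> \<le> 3 * real r ^ 96" using of_nat_mono[OF nr, where 'a = real] by simp
  also have "\<dots> = 3 * real r ^ 60 * real r ^ 36" by (simp flip: power_add)
  finally have "2 * real (meas p) / real (r ^ 36) \<le> 6 * real r ^ 60"
    using r by (simp add: field_simps)
  also have "\<dots> \<le> 6 * real r ^ 61" using r by (intro mult_left_mono power_increasing) auto
  finally have 1: "real (2 * meas p) / real (r ^ 36) \<le> 6 * real r ^ 61" by simp
  have 2: "real (3 * r ^ 36) \<le> 3 * real r ^ 61"
    using r by (simp add: power_increasing)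
  have 3: "real (1440 * r ^ 36 * r ^ 24) * (1 + ln (card (full_arcs n p))) \<le> 277920 * real r ^ 61" if "full_arcs n p \<noteq> {}"
  proof -
    have pos: "1 \<le> card (full_arcs n p)" using that by (simp add: Suc_le_eq card_gt_0_iff)
    have "full_arcs n p \<subseteq> {..<n} \<times> {..<n}" unfolding full_arcs_def Nb_def Full_def by auto
    then have "card (full_arcs n p) \<le> card ({..<n} \<times> {..<n})" by (intro card_mono) auto
    also have "\<dots> = n * n" by simp
    also have "\<dots> \<le> r ^ 96 * r ^ 96" by (intro mult_le_mono nr)
    also have "\<dots> = r ^ 192" by (simp flip: power_add)
    finally have "real (card (full_arcs n p)) \<le> real r ^ 192" using of_nat_mono by fastforce
    then have "ln (real (card (full_arcs n p))) \<le> ln (real r ^ 192)" using pos r by (subst ln_le_cancel_iff) auto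
    also have "\<dots> = 192 * ln (real r)" using r by (simp add: ln_realpow)
    also have "\<dots> \<le> 192 * real r" using ln_bound[of "real r"] r by simp
    finally have "1 + ln (real (card (full_arcs n p))) \<le> 193 * real r" using r by linarith
    then have "real (1440 * r ^ 36 * r ^ 24) * (1 + ln (card (full_arcs n p))) \<le> real (1440 * r ^ 36 * r ^ 24) * (193 * real r)"
      by (intro mult_left_mono) auto
    also have "\<dots> = 277920 * (real r ^ 36 * real r ^ 24 * real r ^ 1)" by simp
    also have "real r ^ 36 * real r ^ 24 * real r ^ 1 = real r ^ 61" unfolding power_add[symmetric] by simp
    finally show ?thesis .
  qed
  have 4: "277929 * real r ^ 61 \<le> real (budget n)" by (simp add: budget_def r_def)
  have 5: "0 \<le> real r ^ 61" by simp
  have "pot (r ^ 36) (r ^ 24) n p \<le> real (budget n)"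
  proof (cases "full_arcs n p = {}")
    case True
    then show ?thesis unfolding pot_def if_P[OF True] using 1 2 4 5 by simp
  next
    case False
    have "1440 * real (r ^ 36) * real (r ^ 24) * (1 + ln (card (full_arcs n p))) \<le> 277920 * real r ^ 61"
      using 3[OF False] by simp
    then show ?thesis unfolding pot_def if_not_P[OF False] using 1 2 4 by linarith
  qed
  then show ?thesis by (simp add: r_def p_def)
qed

section \<open>Correctness on graphs of diameter three\<close>

text \<open>Colours are shifted: colour \<open>c\<close> of the state stands for colour
  \<open>Suc c\<close> of the instance.\<close>

definition state_of :: "'a pair_pre_digraph \<Rightarrow> ('a \<Rightarrow> nat set) \<Rightarrow> 'a list \<Rightarrow> state" where
  "state_of G L vs = map (\<lambda>v. (map (\<lambda>c. c \<in> L v) [1, 2, 3], map (\<lambda>w. (v, w) \<in> parcs G) vs)) vs"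

lemma enc_instance_eq: "enc_instance G L vs = est (state_of G L vs)"
  unfolding enc_instance_def state_of_def map_map comp_def ent_Pair ..

text \<open>Shorter paths are padded to exactly three steps, some of which stand still; this is the
  form that \<open>near\<close> asks for.\<close>

lemma apath_3:
  assumes "pre_digraph.apath (with_proj G) u p v" "length p \<le> 3" "pair_wf_digraph G"
  shows "\<exists>a \<in> pverts G. \<exists>b \<in> pverts G. (u = a \<or> (u, a) \<in> parcs G) \<and> (a = b \<or> (a, b) \<in> parcs G) \<and>
    (b = v \<or> (b, v) \<in> parcs G)"
proof -
  interpret pair_wf_digraph G by fact
  have w: "u \<in> pverts G" "set p \<subseteq> parcs G" "pcas u p v"
    using assms(1) unfolding pre_digraph.apath_def pre_digraph.awalk_def by simp_all
  have V: "x \<in> pverts G" "y \<in> pverts G" if "(x, y) \<in> parcs G" for x y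
    using in_arcsD1[OF that] in_arcsD2[OF that] by auto
  consider "p = []" | e1 where "p = [e1]" | e1 e2 where "p = [e1, e2]" | e1 e2 e3 where "p = [e1, e2, e3]"
  proof (cases p)
    case (Cons e1 q)
    show ?thesis
    proof (cases q)
      case Nil then show ?thesis using Cons that by blast
    next
      case c2: (Cons e2 q2)
      show ?thesis
      proof (cases q2)
        case Nil then show ?thesis using Cons c2 that by blast
      next
        case (Cons e3 q3)
        then have "q3 = []" using assms(2) \<open>p = e1 # q\<close> c2 by (cases q3) auto
        then show ?thesis using \<open>p = e1 # q\<close> c2 Cons that by blast
      qed
    qed
  qed (use that in blast)
  then show ?thesis
  proof cases
    case 1 then show ?thesis using w by auto
  next
    case (2 e1)
    then have "(u, v) \<in> parcs G" using w by (cases e1) auto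
    then show ?thesis using V by blast
  next
    case (3 e1 e2)
    then have "(u, snd e1) \<in> parcs G" "(snd e1, v) \<in> parcs G" using w by (cases e1; cases e2; auto)+
    then show ?thesis using V by blast
  next
    case (4 e1 e2 e3)
    then have "(u, snd e1) \<in> parcs G" "(snd e1, snd e2) \<in> parcs G" "(snd e2, v) \<in> parcs G"
      using w by (cases e1; cases e2; cases e3; auto)+
    then show ?thesis using V by blast
  qed
qed

context
  fixes G :: "'a pair_pre_digraph" and L :: "'a \<Rightarrow> nat set" and vs :: "'a list" and n :: nat
  assumes inst: "list_3_colouring_instance G L" and vs: "distinct vs" "set vs = pverts G" and n: "n = length vs"
begin

lemma adj_state_of: "i < n \<Longrightarrow> j < n \<Longrightarrow> adj (state_of G L vs) i j \<longleftrightarrow> (vs ! i, vs ! j) \<in> parcs G"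
  by (simp add: adj_def state_of_def n)

lemma colours_state_of: "i < n \<Longrightarrow> colours (state_of G L vs) i = {c. c < 3 \<and> Suc c \<in> L (vs ! i)}"
proof -
  assume "i < n"
  then have "fst (state_of G L vs ! i) = map (\<lambda>c. c \<in> L (vs ! i)) [1, 2, 3]" by (simp add: state_of_def n)
  moreover have "map (\<lambda>c. c \<in> L (vs ! i)) [1, 2, 3] ! c \<longleftrightarrow> Suc c \<in> L (vs ! i)" if "c < 3" for c
    by (rule less_3_cases[OF that]) (simp_all add: numeral_2_eq_2 numeral_3_eq_3)
  ultimately show ?thesis unfolding colours_def by auto
qed

lemma wf_state_of: "wf_state n (state_of G L vs)"
proof -
  interpret pair_graph G using inst by (simp add: list_3_colouring_instance_def)
  have "shaped n (state_of G L vs)" by (rule shapedI) (simp_all add: state_of_def n)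
  moreover have "\<not> adj (state_of G L vs) i i" if "i < n" for i
    using adj_state_of[OF that that] no_loops' by blast
  moreover have "adj (state_of G L vs) j i" if "i < n" "j < n" "adj (state_of G L vs) i j" for i j
    using that arcs_symmetric by (simp add: adj_state_of)
  ultimately show ?thesis unfolding wf_state_def by blast
qed

lemma colourable_state_of: "list_3_colourable G L \<longleftrightarrow> (\<exists>f. coloured n (state_of G L vs) f)"
proof
  assume "list_3_colourable G L"
  then obtain h where h: "\<And>v. v \<in> pverts G \<Longrightarrow> h v \<in> L v" "\<And>u v. (u, v) \<in> parcs G \<Longrightarrow> h u \<noteq> h v"
    unfolding list_3_colourable_def by blast
  have v: "vs ! i \<in> pverts G" if "i < n" for i using that vs(2) nth_mem n by blast
  have c: "1 \<le> h (vs ! i)" "h (vs ! i) < 4" if "i < n" for i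
    using h(1)[OF v[OF that]] inst v[OF that] unfolding list_3_colouring_instance_def by force+
  have "coloured n (state_of G L vs) (\<lambda>i. h (vs ! i) - 1)"
    unfolding coloured_def
  proof (intro conjI allI impI)
    fix i assume i: "i < n"
    then show "h (vs ! i) - 1 \<in> colours (state_of G L vs) i"
      using c[OF i] h(1)[OF v[OF i]] by (auto simp: colours_state_of)
    fix j assume j: "j < n" "adj (state_of G L vs) i j"
    then show "h (vs ! i) - 1 \<noteq> h (vs ! j) - 1"
      using c(1)[OF i] c(1)[OF j(1)] h(2)[of "vs ! i" "vs ! j"] i by (simp add: adj_state_of)
  qed
  then show "\<exists>f. coloured n (state_of G L vs) f" by blast
next
  interpret pair_graph G using inst by (simp add: list_3_colouring_instance_def)
  assume "\<exists>f. coloured n (state_of G L vs) f"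
  then obtain f where f: "\<And>i. i < n \<Longrightarrow> f i \<in> colours (state_of G L vs) i"
    "\<And>i j. i < n \<Longrightarrow> j < n \<Longrightarrow> adj (state_of G L vs) i j \<Longrightarrow> f i \<noteq> f j"
    unfolding coloured_def by blast
  define ix where "ix v = (SOME i. i < n \<and> vs ! i = v)" for v
  have ix: "ix v < n" "vs ! ix v = v" if "v \<in> pverts G" for v
  proof -
    have "\<exists>i. i < n \<and> vs ! i = v" using that vs(2) n by (metis in_set_conv_nth)
    then have "ix v < n \<and> vs ! ix v = v" unfolding ix_def by (rule someI_ex)
    then show "ix v < n" "vs ! ix v = v" by blast+
  qed
  show "list_3_colourable G L"
    unfolding list_3_colourable_def
  proof (intro exI[of _ "\<lambda>v. Suc (f (ix v))"] conjI ballI)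
    fix v assume "v \<in> pverts G"
    then show "Suc (f (ix v)) \<in> L v" using f(1)[OF ix(1)] ix by (simp add: colours_state_of)
  next
    fix e assume "e \<in> parcs G"
    then obtain u v where e: "e = (u, v)" "(u, v) \<in> parcs G" by (cases e) auto
    then have uv: "u \<in> pverts G" "v \<in> pverts G" using in_arcsD1 in_arcsD2 by auto
    then have "f (ix u) \<noteq> f (ix v)" using f(2)[OF ix(1) ix(1)] ix e(2) by (simp add: adj_state_of)
    then show "case e of (u, v) \<Rightarrow> Suc (f (ix u)) \<noteq> Suc (f (ix v))" using e by simp
  qed
qed

lemma near_state_of:
  assumes "has_diameter G 3"
  shows "near n (state_of G L vs)"
  unfolding near_def
proof (intro ballI)
  interpret pair_graph G using inst by (simp add: list_3_colouring_instance_def)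
  fix x z assume "x \<in> Full n (state_of G L vs)" "z \<in> Full n (state_of G L vs)"
  then have xz: "x < n" "z < n" by (simp_all add: Full_less)
  then have "vs ! x \<in> pverts G" "vs ! z \<in> pverts G" using vs(2) nth_mem n by blast+
  then obtain p where "pre_digraph.apath (with_proj G) (vs ! x) p (vs ! z)" "length p \<le> 3"
    using assms unfolding has_diameter_def by blast
  then obtain a b where ab: "a \<in> pverts G" "b \<in> pverts G" "vs ! x = a \<or> (vs ! x, a) \<in> parcs G"
    "a = b \<or> (a, b) \<in> parcs G" "b = vs ! z \<or> (b, vs ! z) \<in> parcs G"
    using apath_3[OF _ _ pair_wf_digraph_axioms] by blast
  obtain i j where ij: "i < n" "vs ! i = a" "j < n" "vs ! j = b"
    using ab(1,2) vs(2) n by (metis in_set_conv_nth)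
  have eq: "vs ! k = vs ! l \<longleftrightarrow> k = l" if "k < n" "l < n" for k l
    using that nth_eq_iff_index_eq[OF vs(1)] n by simp
  show "\<exists>a<n. \<exists>b<n. (x = a \<or> adj (state_of G L vs) x a) \<and> (a = b \<or> adj (state_of G L vs) a b) \<and>
      (b = z \<or> adj (state_of G L vs) b z)"
    using ab(3-5) unfolding ij(2,4)[symmetric]
    by (intro exI[of _ i] conjI exI[of _ j] ij) (use xz ij(1,3) in \<open>simp_all add: eq adj_state_of\<close>)
qed

end

lemma solve_correct:
  assumes "list_3_colouring_instance G L" "has_diameter G 3" "distinct vs" "set vs = pverts G"
  defines "n \<equiv> length vs" and "st \<equiv> state_of G L vs"
  shows "solve (root96 n ^ 36) (budget n + Suc (meas st)) (budget n) st \<longleftrightarrow> list_3_colourable G L"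
proof
  note I = assms(1,3,4) n_def[THEN meta_eq_to_obj_eq]
  note wf = wf_state_of[OF I, folded st_def]
  assume "solve (root96 n ^ 36) (budget n + Suc (meas st)) (budget n) st"
  then show "list_3_colourable G L"
    using solve_sound[OF wf] colourable_state_of[OF I, folded st_def] by blast
next
  note I = assms(1,3,4) n_def[THEN meta_eq_to_obj_eq]
  note wf = wf_state_of[OF I, folded st_def]
  note s = wf_shaped[OF wf]
  assume "list_3_colourable G L"
  then obtain f where f: "coloured n st f" using colourable_state_of[OF I, folded st_def] by blast
  have "pverts G \<noteq> {}" using assms(2) unfolding has_diameter_def by blast
  then have n: "1 \<le> n" using assms(4) unfolding n_def by (cases vs) auto
  define r where "r = root96 n"
  have nr: "n \<le> r ^ 96" unfolding r_def by (rule root96(1))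
  then have r: "0 < r" using n by (cases "r = 0") auto
  have "n\<^sup>2 \<le> (r ^ 96)\<^sup>2" using nr by (intro power_mono) auto
  \<comment> \<open>The parameters satisfy the condition with equality up to rounding of the root:
    \<open>2 * 96 = 2 * 36 + 5 * 24\<close>.\<close>
  also have "\<dots> = (r ^ 36)\<^sup>2 * (r ^ 24) ^ 5" by (simp flip: power_mult power_add)
  finally have nn: "n\<^sup>2 \<le> (r ^ 36)\<^sup>2 * (r ^ 24) ^ 5" .
  have near: "near n (propagate st)"
    by (rule same_graph_near[OF propagate(2)[OF s] near_state_of[OF I assms(2), folded st_def]])
  have "meas (propagate st) \<le> meas st" by (rule same_graph_meas[OF s propagate(1,2)[OF s]])
  then show "solve (root96 n ^ 36) (budget n + Suc (meas st)) (budget n) st"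
    unfolding r_def[symmetric]
    by (intro solve_complete[OF _ _ nn wf f near]) (use r pot_budget[OF wf n] in \<open>simp_all add: r_def\<close>)
qed

lemma runs_prog:
  assumes "fn 0 [x] y T" shows "\<exists>t. runs prog x y t \<and> t \<le> T + 3"
proof -
  have "wp [x] (Call 0 [Param 0]) (\<lambda>v t. v = y \<and> t \<le> T + 3)"
    using fn_cst[OF assms] by (simp add: wp_simps fn_body[OF assms])
  then show ?thesis unfolding wp_def runs_def by blast
qed

theorem theorem1:
  fixes \<epsilon> :: real
  assumes "\<epsilon> < 1 / 33"
  shows "\<exists>(P :: program) (g :: nat \<Rightarrow> real).
           g \<in> O(\<lambda>n. real n powr (2 / 3 - \<epsilon>)) \<and>
           solves_list_3_colouring P (\<lambda>G. has_diameter G 3) (\<lambda>n. 2 powr g n)"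
proof (intro exI conjI)
  show "(\<lambda>n. log 2 (real (run_time n))) \<in> O(\<lambda>n. real n powr (2 / 3 - \<epsilon>))"
    by (rule log_run_time[OF assms])
  show "solves_list_3_colouring prog (\<lambda>G. has_diameter G 3) (\<lambda>n. 2 powr log 2 (real (run_time n)))"
    unfolding solves_list_3_colouring_def
  proof (intro allI impI, elim conjE)
    fix G :: "nat pair_pre_digraph" and L vs
    assume G: "list_3_colouring_instance G L" "has_diameter G 3" "distinct vs" "set vs = pverts G"
    define n where "n = length vs"
    have n: "card (pverts G) = n" using distinct_card[OF G(3)] G(4) by (simp add: n_def)
    have "\<exists>t. runs prog (est (state_of G L vs)) (enc_bool (list_3_colourable G L)) t \<and>
        t \<le> cMain n + cSolve n (fuel n) (budget n) + 3"
      using runs_prog[OF fn_main[OF wf_state_of[OF G(1,3,4) n_def]]] solve_correct[OF G] by (simp add: n_def)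
    then obtain t where t: "runs prog (enc_instance G L vs) (enc_bool (list_3_colourable G L)) t"
      "t \<le> run_time n"
      unfolding enc_instance_eq run_time_def by blast
    have "0 < run_time n" by (simp add: run_time_def)
    then have "real t \<le> 2 powr log 2 (real (run_time n))" using t(2) by simp
    then show "\<exists>t. runs prog (enc_instance G L vs) (enc_bool (list_3_colourable G L)) t \<and>
        real t \<le> 2 powr log 2 (real (run_time (card (pverts G))))"
      using t(1) n by auto
  qed
qed

end
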